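(* Let $d\ge2$. Let $\kappa\in(0,\infty]$ and let $\phi:(0,\kappa)\to\mathbb{R}$ be a convex and twice differentiable function with $\lim_{r\nearrow\kappa}\phi(r)=\infty$. Let $\pi$ be the probability measure on $\mathbb{R}^d$ with not necessarily normalized (Lebesgue-integrable) density $$\varrho(x)=\exp(-\phi(\|x\|))\,\mathbf{1}_{(0,\kappa)}(\|x\|),\qquad x\in\mathbb{R}^d .$$ Let $P$ be the transition kernel of polar slice sampling for $\pi$. Then $$\mathrm{gap}_\pi(P)\ \ge\ \frac12 .$$
   Context: $\|\cdot\|$ is the Euclidean norm, $\mathbb{R}_+=[0,\infty)$, $\lambda$ is Lebesgue measure on $\mathbb{R}$. "Not necessarily normalized density" means $\pi(A)=C^{-1}\int_A\varrho(x)\,dx$ with $C=\int_{\mathbb{R}^d}\varrho(x)\,dx\in(0,\infty)$. Polar slice sampling (PSS) is slice sampling based on the (Lebesgue-a.e.) factorization $\varrho=p_0\,p_1$ with $p_0(x)=\|x\|^{1-d}$ and $p_1(x)=\|x\|^{d-1}\varrho(x)$ (the value of $p_0$ at $x=0$ is irrelevant). Put $L(t,p_1):=\{z\in\mathbb{R}^d:p_1(z)>t\}$ for $t>0$. Define $U_T(x,A)=\lambda(A\cap(0,p_1(x)))/p_1(x)$ for $x\in\mathbb{R}^d$ and Borel $A\subseteq(0,\infty)$, and $U_X(t,B)=\int_{B\cap L(t,p_1)}p_0(z)\,dz\,/\,\int_{L(t,p_1)}p_0(z)\,dz$ for $t>0$ and Borel $B\subseteq\mathbb{R}^d$. Where a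 denominator vanishes, the kernel is set to an arbitrary fixed probability measure (this does not affect the induced $L_2$ operators). The transition kernel of PSS is $P=U_TU_X$, i.e. $P(x,B)=\int_{(0,\infty)}U_X(t,B)\,U_T(x,dt)$; it is reversible with respect to $\pi$. Spectral gap: $P$ acts on $L_2(\pi)$ by $Pg(x)=\int g(y)P(x,dy)$, $\pi$ is viewed as the operator $g\mapsto\int g\,d\pi$ (constant function), and $\mathrm{gap}_\pi(P):=1-\|P-\pi\|_{L_2(\pi)\to L_2(\pi)}$ (operator norm). *)

theory Defs
  imports "HOL-Probability.Probability"
begin

section \<open>Square-integrable functions and the spectral gap\<close>

definition L2 :: "'a measure \<Rightarrow> ('a \<Rightarrow> real) set" where
  "L2 M = {g \<in> borel_measurable M. integrable M (\<lambda>x. (g x)\<^sup>2)}"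

text \<open>
  The elements of \<open>L2\<close> are functions rather than equivalence classes. The norm takes the value
  \<open>\<infinity>\<close> outside \<open>L2\<close>, so that an operator that fails to map \<open>L2\<close> to itself has operator norm
  \<open>\<infinity>\<close>.
\<close>

definition L2_norm :: "'a measure \<Rightarrow> ('a \<Rightarrow> real) \<Rightarrow> ereal" where
  "L2_norm M g = (if g \<in> L2 M then ereal (sqrt (\<integral>x. (g x)\<^sup>2 \<partial>M)) else \<infinity>)"

definition L2_opnorm :: "'a measure \<Rightarrow> (('a \<Rightarrow> real) \<Rightarrow> ('a \<Rightarrow> real)) \<Rightarrow> ereal" where
  "L2_opnorm M T = (SUP g \<in> {g. L2_norm M g \<le> 1}. L2_norm M (T g))"

definition kernel_op :: "('a \<Rightarrow> 'a measure) \<Rightarrow> ('a \<Rightarrow> real) \<Rightarrow> 'a \<Rightarrow> real" where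
  "kernel_op P g x = (\<integral>y. g y \<partial>P x)"

definition mean_op :: "'a measure \<Rightarrow> ('a \<Rightarrow> real) \<Rightarrow> 'a \<Rightarrow> real" where
  "mean_op M g x = (\<integral>y. g y \<partial>M)"

definition spectral_gap :: "'a measure \<Rightarrow> ('a \<Rightarrow> 'a measure) \<Rightarrow> ereal" where
  "spectral_gap M P = 1 - L2_opnorm M (\<lambda>g x. kernel_op P g x - mean_op M g x)"

section \<open>Polar slice sampling\<close>

definition normalized_measure :: "('a::euclidean_space \<Rightarrow> real) \<Rightarrow> 'a measure" where
  "normalized_measure \<rho> = density lborel (\<lambda>x. ennreal (\<rho> x / (\<integral>y. \<rho> y \<partial>lborel)))"

text \<open>The exponent is an integer; the value at the origin is \<open>0\<close> if the dimension is at least 2.\<close>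

definition pss_p0 :: "'a::euclidean_space \<Rightarrow> real" where
  "pss_p0 x = norm x powi (1 - int DIM('a))"

definition pss_p1 :: "('a::euclidean_space \<Rightarrow> real) \<Rightarrow> 'a \<Rightarrow> real" where
  "pss_p1 \<rho> x = norm x ^ (DIM('a) - 1) * \<rho> x"

definition pss_level :: "('a::euclidean_space \<Rightarrow> real) \<Rightarrow> real \<Rightarrow> 'a set" where
  "pss_level \<rho> t = {z. pss_p1 \<rho> z > t}"

definition pss_base :: "'a::euclidean_space measure" where
  "pss_base = density lborel (\<lambda>z. ennreal (pss_p0 z))"

text \<open>
  The measures \<open>\<nu>T\<close> (concentrated on the positive half-line) and \<open>\<nu>X\<close> are the arbitrary fixed
  probability measures that are used where a denominator vanishes.
  \<open>pss_UT\<close> is formally a measure on the whole real line.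
\<close>

definition pss_UT :: "('a::euclidean_space \<Rightarrow> real) \<Rightarrow> real measure \<Rightarrow> 'a \<Rightarrow> real measure" where
  "pss_UT \<rho> \<nu>T x =
     (if pss_p1 \<rho> x = 0 then \<nu>T else uniform_measure lborel {0<..<pss_p1 \<rho> x})"

definition pss_UX :: "('a::euclidean_space \<Rightarrow> real) \<Rightarrow> 'a measure \<Rightarrow> real \<Rightarrow> 'a measure" where
  "pss_UX \<rho> \<nu>X t =
     (if emeasure pss_base (pss_level \<rho> t) = 0 then \<nu>X
      else uniform_measure pss_base (pss_level \<rho> t))"

definition pss_kernel ::
  "('a::euclidean_space \<Rightarrow> real) \<Rightarrow> real measure \<Rightarrow> 'a measure \<Rightarrow> 'a \<Rightarrow> 'a measure" where
  "pss_kernel \<rho> \<nu>T \<nu>X x = measure_of UNIV (sets borel)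
     (\<lambda>B. \<integral>\<^sup>+t\<in>{0<..}. emeasure (pss_UX \<rho> \<nu>X t) B \<partial>pss_UT \<rho> \<nu>T x)"

lemma sets_pss_base [simp, measurable_cong]: "sets pss_base = sets borel"
  by (simp add: pss_base_def)

lemma pss_p0_measurable [measurable]: "pss_p0 \<in> borel_measurable borel"
proof -
  have eq: "pss_p0 = (\<lambda>x::'a. inverse (norm x ^ (DIM('a) - 1)))"
  proof
    fix x :: 'a
    have "1 - int DIM('a) = - int (DIM('a) - 1)"
      using DIM_positive[where 'a='a] by linarith
    then show "pss_p0 x = inverse (norm x ^ (DIM('a) - 1))"
      by (simp only: pss_p0_def power_int_minus power_int_of_nat)
  qed
  show ?thesis unfolding eq by measurable
qed

lemma sigma_finite_pss_base: "sigma_finite_measure (pss_base :: 'a::euclidean_space measure)"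
  unfolding pss_base_def
  by (subst sigma_finite_measure.sigma_finite_iff_density_finite'[OF sigma_finite_lborel]) auto

lemma pss_level_measurable [measurable]:
  assumes [measurable]: "\<rho> \<in> borel_measurable borel"
  shows "pss_level \<rho> t \<in> sets borel"
  unfolding pss_level_def pss_p1_def by measurable

lemma measurable_pss_UX:
  assumes [measurable]: "\<rho> \<in> borel_measurable borel" and B [measurable]: "B \<in> sets borel"
  shows "(\<lambda>t. emeasure (pss_UX \<rho> \<nu>X t) B) \<in> borel_measurable borel"
proof -
  interpret sigma_finite_measure "pss_base :: 'a measure" by (rule sigma_finite_pss_base)
  have m: "(\<lambda>t. emeasure pss_base (pss_level \<rho> t \<inter> B)) \<in> borel_measurable borel"
    if [measurable]: "B \<in> sets borel" for B
  proof -
    have "{p \<in> space (borel \<Otimes>\<^sub>M borel). fst p < pss_p1 \<rho> (snd p) \<and> snd p \<in> B}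
      \<in> sets (borel \<Otimes>\<^sub>M borel)" unfolding pss_p1_def by measurable
    then have "{p::real \<times> 'a. fst p < pss_p1 \<rho> (snd p) \<and> snd p \<in> B} \<in> sets (borel \<Otimes>\<^sub>M pss_base)"
      by (simp add: space_pair_measure cong: sets_pair_measure_cong)
    from measurable_emeasure_Pair[OF this] show ?thesis
      by (simp add: pss_level_def vimage_def Int_def)
  qed
  have *: "emeasure (pss_UX \<rho> \<nu>X t) B =
    (if emeasure pss_base (pss_level \<rho> t) = 0 then emeasure \<nu>X B
     else emeasure pss_base (pss_level \<rho> t \<inter> B) / emeasure pss_base (pss_level \<rho> t))" for t
    by (simp add: pss_UX_def)
  note [measurable] = m[OF B] m[of UNIV, simplified]
  show ?thesis unfolding * by measurable
qed

text \<open>The set function in the definition of the kernel is indeed a measure.\<close>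

lemma emeasure_pss_kernel:
  assumes [measurable]: "\<rho> \<in> borel_measurable borel"
    and s: "sets \<nu>T = sets borel" "sets \<nu>X = sets borel" and B: "B \<in> sets borel"
  shows "emeasure (pss_kernel \<rho> \<nu>T \<nu>X x) B =
    (\<integral>\<^sup>+t\<in>{0<..}. emeasure (pss_UX \<rho> \<nu>X t) B \<partial>pss_UT \<rho> \<nu>T x)"
proof (rule emeasure_measure_of[OF pss_kernel_def])
  have sUX: "sets (pss_UX \<rho> \<nu>X t) = sets borel" for t
    by (simp add: pss_UX_def s)
  have sUT: "sets (pss_UT \<rho> \<nu>T x) = sets borel"
    by (simp add: pss_UT_def s)
  show "B \<in> sets (pss_kernel \<rho> \<nu>T \<nu>X x)"
    using B sets.sigma_sets_eq[of "borel :: 'a measure"] by (simp add: pss_kernel_def)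
  show "countably_additive (sets (pss_kernel \<rho> \<nu>T \<nu>X x))
    (\<lambda>B. \<integral>\<^sup>+t\<in>{0<..}. emeasure (pss_UX \<rho> \<nu>X t) B \<partial>pss_UT \<rho> \<nu>T x)"
  proof (rule countably_additiveI)
    fix A :: "nat \<Rightarrow> 'a set"
    assume A: "range A \<subseteq> sets (pss_kernel \<rho> \<nu>T \<nu>X x)" "disjoint_family A"
    have Ab: "range A \<subseteq> sets borel"
      using A(1) sets.sigma_sets_eq[of "borel :: 'a measure"] by (simp add: pss_kernel_def)
    have [measurable]: "(\<lambda>t. emeasure (pss_UX \<rho> \<nu>X t) (A i)) \<in> borel_measurable (pss_UT \<rho> \<nu>T x)" for i
      using Ab by (subst measurable_cong_sets[OF sUT refl]) (auto intro!: measurable_pss_UX)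
    have [measurable]: "{0<..} \<in> sets (pss_UT \<rho> \<nu>T x)" by (simp add: sUT)
    have "(\<Sum>i. emeasure (pss_UX \<rho> \<nu>X t) (A i)) = emeasure (pss_UX \<rho> \<nu>X t) (\<Union>i. A i)" for t
      using A(2) Ab by (intro suminf_emeasure) (auto simp: sUX)
    note UN = this
    show "(\<Sum>i. \<integral>\<^sup>+t\<in>{0<..}. emeasure (pss_UX \<rho> \<nu>X t) (A i) \<partial>pss_UT \<rho> \<nu>T x) =
      (\<integral>\<^sup>+t\<in>{0<..}. emeasure (pss_UX \<rho> \<nu>X t) (\<Union>i. A i) \<partial>pss_UT \<rho> \<nu>T x)"
      by (subst nn_integral_suminf[symmetric]) (simp_all add: UN)
  qed
qed (auto simp: positive_def)

end

theory Submission
  imports Defs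
begin

text \<open>
  Write \<open>\<nu>\<close> for the measure \<open>p\<^sub>0(z) dz\<close>, \<open>h\<close> for \<open>p\<^sub>1\<close>, \<open>l(t)\<close> for \<open>\<nu>{h > t}\<close> and \<open>C\<close> for
  the integral of \<open>h\<close> against \<open>\<nu>\<close>. The kernel alternates between a height, uniform on \<open>(0, h(x))\<close>, and
  a point, drawn from \<open>\<nu>\<close> conditioned on \<open>{h > t}\<close>. The two half-steps \<open>U\<^sub>T\<close> and \<open>U\<^sub>X\<close> are adjoint
  to each other between \<open>L\<^sub>2\<close> of \<open>h d\<nu>\<close> and \<open>L\<^sub>2\<close> of \<open>l(t) dt\<close>. Hence the operator norm of
  \<open>P - \<pi>\<close> is at most 1/2 as soon as \<open>U\<^sub>X\<close> halves the squared norm of every centred function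
  (\<open>slice_mean_contraction\<close>); the same then holds for \<open>U\<^sub>T\<close> by duality (\<open>height_mean_contraction\<close>), and
  \<open>P = U\<^sub>T U\<^sub>X\<close> divides squared norms by 4 (\<open>slice_sampling_contraction\<close>).

  To see that \<open>U\<^sub>X\<close> halves squared norms, let \<open>B(t)\<close> be the mean of \<open>g\<close> over \<open>{h > t}\<close>, and let
  \<open>D = g - B \<circ> h\<close> be the deviation of \<open>g\<close> from the mean over the level set through the point. Three facts
  are combined.

  \<^item> Energy (\<open>total_energy\<close>): the integral of \<open>D\<^sup>2 h d\<nu>\<close> plus the integral of \<open>B\<^sup>2 l dt\<close> is at most the
    integral of \<open>g\<^sup>2 h d\<nu>\<close>. In the coordinate \<open>u = l \<circ> h\<close>, whose law under \<open>\<nu>\<close> is Lebesgue measure, \<open>B\<close>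
    is a Cesaro mean, and this is the classical fact that the identity minus the Cesaro operator is an
    isometry of \<open>L\<^sub>2\<close> of the half-line.
  \<^item> Increments (\<open>slice_mean_increment\<close>): \<open>B(s) - B(t)\<close> is the integral of \<open>D / l(h)\<close> over
    \<open>{s < h < t}\<close>, so its square is at most \<open>l(s) - l(t)\<close> times the integral of \<open>D\<^sup>2 / l(h)\<^sup>2\<close>.
  \<^item> Straddling pairs (\<open>straddling_bound\<close>): the integral of \<open>(l(s) - l(t)) l(s) l(t)\<close> over \<open>s < a < t\<close> is
    at most \<open>C a l(a)\<^sup>2\<close> for every \<open>a\<close>. This is where log-concavity enters, in the form that
    \<open>l(r t) - l(t)\<close> increases with \<open>t\<close> for each \<open>r < 1\<close>, as long as \<open>l(t) > 0\<close>.

  Expand the variance of \<open>B\<close> under \<open>l(t) dt\<close> over ordered pairs \<open>s < t\<close>, insert the bound on the increments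
  and exchange the integrals: the factor of \<open>D(x)\<^sup>2\<close> is the integral over pairs that straddle \<open>h(x)\<close>,
  divided by \<open>l(h(x))\<^sup>2\<close>. Hence, for centred \<open>g\<close>, the integral of \<open>B\<^sup>2 l\<close> is at most that of \<open>D\<^sup>2 h\<close>, and the
  energy inequality turns this into half of the integral of \<open>g\<^sup>2 h\<close>.

  It remains to see why \<open>l\<close> has the required shape. In polar coordinates \<open>\<nu>\<close> is a multiple of Lebesgue
  measure in the radius, and \<open>h(x) = exp (-\<psi>(\<parallel>x\<parallel>))\<close> with \<open>\<psi>(r) = \<phi>(r) - (d - 1) ln r\<close>. The potential \<open>\<psi>\<close> is
  strictly convex because \<open>d \<ge> 2\<close>. Its sublevel sets are intervals, and their length is a concave function
  of the level, which is the one-dimensional Brunn-Minkowski inequality (\<open>sublevel_length_concave\<close>). Strict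
  convexity rules out that \<open>\<nu>\<close> charges a set \<open>{h = t}\<close>, so \<open>l\<close> is continuous.
\<close>

section \<open>Averages along a uniform rank\<close>

lemma integral_inverse_square:
  fixes m b :: real
  assumes "0 < m" "m \<le> b"
  shows "(\<integral>z. (if m < z \<and> z < b then 1 / z\<^sup>2 else 0) \<partial>lborel) = 1 / m - 1 / b"
proof -
  have "(\<integral>z. indicator {m..b} z *\<^sub>R (1 / z\<^sup>2) \<partial>lborel) = (- 1 / b) - (- 1 / m)"
  proof (rule integral_FTC_Icc[OF assms(2)])
    fix x assume "m \<le> x" "x \<le> b"
    then have "x \<noteq> 0" using assms by auto
    then show "((\<lambda>z. - 1 / z) has_vector_derivative 1 / x\<^sup>2) (at x within {m..b})"
      by (auto intro!: derivative_eq_intros simp: has_real_derivative_iff_has_vector_derivative[symmetric] power2_eq_square)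
  next
    show "continuous_on {m..b} (\<lambda>x. 1 / x\<^sup>2)"
      using assms by (intro continuous_intros) auto
  qed
  moreover have "(\<integral>z. (if m < z \<and> z < b then 1 / z\<^sup>2 else 0) \<partial>lborel) = (\<integral>z. indicator {m..b} z *\<^sub>R (1 / z\<^sup>2) \<partial>lborel)"
  proof (rule integral_cong_AE)
    have "AE z in lborel. z \<noteq> m \<and> z \<noteq> b"
      using AE_lborel_singleton[of m] AE_lborel_singleton[of b] by eventually_elim auto
    then show "AE z in lborel. (if m < z \<and> z < b then 1 / z\<^sup>2 else 0) = indicator {m..b} z *\<^sub>R (1 / z\<^sup>2)"
      by eventually_elim (auto simp: indicator_def)
  qed measurable
  ultimately show ?thesis by simp
qed

text \<open>
  Monotone convergence as the cut-off tends to 0. It transfers bounds that are derived away from a possible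
  singularity at \<open>u = 0\<close>.
\<close>

lemma nn_integral_truncation_le:
  fixes u :: "'a \<Rightarrow> real"
  assumes [measurable]: "f \<in> borel_measurable M" "u \<in> borel_measurable M"
    and "0 < b" and le: "\<And>w. 0 < w \<Longrightarrow> w \<le> b \<Longrightarrow> (\<integral>\<^sup>+x. (if w < u x then f x else 0) \<partial>M) \<le> R"
  shows "(\<integral>\<^sup>+x. (if 0 < u x then f x else 0) \<partial>M) \<le> R"
proof -
  define w where "w n = b / (real n + 1)" for n
  have w: "0 < w n" "w n \<le> b" for n
    using \<open>0 < b\<close> by (auto simp: w_def divide_simps)
  have w_decr: "w (Suc n) \<le> w n" for n
    using \<open>0 < b\<close> by (auto simp: w_def intro!: divide_left_mono)
  have w_lim: "\<exists>n. w n < z" if "0 < z" for z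
  proof -
    obtain n where "b / z < real n" using reals_Archimedean2 by blast
    then show ?thesis using that \<open>0 < b\<close> by (intro exI[of _ n]) (auto simp: w_def field_simps)
  qed
  let ?f = "\<lambda>n x. if w n < u x then f x else 0"
  have "(if 0 < u x then f x else 0) = (SUP n. ?f n x)" for x
  proof (cases "0 < u x")
    case True
    then obtain n where n: "w n < u x" using w_lim by blast
    have "f x \<le> (SUP n. ?f n x)"
      by (rule SUP_upper2[of n]) (use n in auto)
    moreover have "(SUP n. ?f n x) \<le> f x"
      by (rule SUP_least) auto
    ultimately show ?thesis using True by auto
  next
    case False
    then have "\<not> w n < u x" for n using w(1)[of n] by auto
    then show ?thesis using False by simp
  qed
  then have "(\<integral>\<^sup>+x. (if 0 < u x then f x else 0) \<partial>M) = (\<integral>\<^sup>+x. (SUP n. ?f n x) \<partial>M)"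
    by simp
  also have "\<dots> = (SUP n. \<integral>\<^sup>+x. ?f n x \<partial>M)"
  proof (rule nn_integral_monotone_convergence_SUP)
    show "incseq ?f"
      using w_decr by (intro incseq_SucI le_funI) (auto intro: le_less_trans)
  qed measurable
  also have "\<dots> \<le> R"
    by (intro SUP_least le w)
  finally show ?thesis .
qed

text \<open>
  Cauchy-Schwarz against the constant 1 on \<open>S\<close>.
\<close>

lemma integral_square_le:
  fixes f :: "'a \<Rightarrow> real"
  assumes [measurable]: "f \<in> borel_measurable M" "S \<in> sets M"
  shows "ennreal ((\<integral>x. indicator S x * f x \<partial>M)\<^sup>2) \<le>
    emeasure M S * (\<integral>\<^sup>+x. indicator S x * ennreal ((f x)\<^sup>2) \<partial>M)"
proof (cases "integrable M (\<lambda>x. indicator S x * f x)")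
  case True
  have "ennreal \<bar>\<integral>x. indicator S x * f x \<partial>M\<bar> \<le> (\<integral>\<^sup>+x. ennreal \<bar>indicator S x * f x\<bar> \<partial>M)"
    using integral_norm_bound_ennreal[OF True] by simp
  also have "\<dots> = (\<integral>\<^sup>+x. indicator S x * (indicator S x * ennreal \<bar>f x\<bar>) \<partial>M)"
    by (intro nn_integral_cong) (auto simp: indicator_def)
  finally have "(ennreal \<bar>\<integral>x. indicator S x * f x \<partial>M\<bar>)\<^sup>2 \<le> (\<integral>\<^sup>+x. indicator S x * (indicator S x * ennreal \<bar>f x\<bar>) \<partial>M)\<^sup>2"
    by (rule power_mono) simp
  also have "\<dots> \<le> (\<integral>\<^sup>+x. (indicator S x)\<^sup>2 \<partial>M) * (\<integral>\<^sup>+x. (indicator S x * ennreal \<bar>f x\<bar>)\<^sup>2 \<partial>M)"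
    by (rule Cauchy_Schwarz_nn_integral) measurable
  also have "(\<integral>\<^sup>+x. (indicator S x)\<^sup>2 \<partial>M) = (\<integral>\<^sup>+x. indicator S x \<partial>M)"
    by (intro nn_integral_cong) (auto simp: indicator_def)
  also have "\<dots> = emeasure M S" by simp
  also have "(\<integral>\<^sup>+x. (indicator S x * ennreal \<bar>f x\<bar>)\<^sup>2 \<partial>M) = (\<integral>\<^sup>+x. indicator S x * ennreal ((f x)\<^sup>2) \<partial>M)"
    by (intro nn_integral_cong) (auto simp: indicator_def ennreal_power)
  finally show ?thesis by (simp add: ennreal_power)
qed (simp add: not_integrable_integral_eq)

text \<open>
  The function \<open>u\<close> ranks the points of \<open>N\<close> without ties: the points of rank below \<open>z\<close> have total measure \<open>z\<close>, for
  every \<open>z \<le> b\<close>. In slice sampling, the rank of \<open>x\<close> is the mass of the level set through \<open>x\<close>. The function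
  \<open>avg k\<close> is then the Cesaro mean of \<open>k\<close> in the coordinate \<open>u\<close>.
\<close>

locale uniform_rank = finite_measure N for N :: "'a measure" +
  fixes u :: "'a \<Rightarrow> real" and b :: real
  assumes u [measurable]: "u \<in> borel_measurable N"
    and b_pos: "0 < b"
    and distr_u: "distr N borel u = density lborel (\<lambda>z. indicator {0<..<b} z)"
begin

definition cumul :: "('a \<Rightarrow> real) \<Rightarrow> real \<Rightarrow> real" where
  "cumul k z = (\<integral>x. (if u x < z then k x else 0) \<partial>N)"

definition avg :: "('a \<Rightarrow> real) \<Rightarrow> real \<Rightarrow> real" where
  "avg k z = cumul k z / z"

lemma AE_rank: "AE x in N. 0 < u x \<and> u x < b"
proof -
  have "AE z in distr N borel u. 0 < z \<and> z < b"
    unfolding distr_u by (subst AE_density) (auto simp: indicator_def)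
  then show ?thesis by (subst (asm) AE_distr_iff) auto
qed

lemma AE_rank_neq: "AE x in N. u x \<noteq> w"
proof -
  have "AE z in distr N borel u. z \<noteq> w"
    unfolding distr_u using AE_lborel_singleton[of w] by (subst AE_density) auto
  then show ?thesis by (subst (asm) AE_distr_iff) auto
qed

lemma emeasure_rank:
  assumes [measurable]: "B \<in> sets borel"
  shows "emeasure N {x \<in> space N. u x \<in> B} = emeasure lborel ({0<..<b} \<inter> B)"
proof -
  have "emeasure N {x \<in> space N. u x \<in> B} = emeasure (distr N borel u) B"
    by (subst emeasure_distr) (auto intro!: arg_cong[where f="emeasure N"])
  also have "\<dots> = (\<integral>\<^sup>+z. indicator ({0<..<b} \<inter> B) z \<partial>lborel)"
    unfolding distr_u by (subst emeasure_density, simp, simp, intro nn_integral_cong) (auto simp: indicator_def)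
  also have "\<dots> = emeasure lborel ({0<..<b} \<inter> B)"
    by (rule nn_integral_indicator) measurable
  finally show ?thesis .
qed

lemma integral_rank:
  fixes f :: "real \<Rightarrow> real"
  assumes [measurable]: "f \<in> borel_measurable borel"
  shows "(\<integral>x. f (u x) \<partial>N) = (\<integral>z. (if 0 < z \<and> z < b then f z else 0) \<partial>lborel)"
proof -
  have "(\<integral>x. f (u x) \<partial>N) = (\<integral>z. f z \<partial>distr N borel u)"
    by (subst integral_distr) auto
  also have "\<dots> = (\<integral>z. indicator {0<..<b} z * f z \<partial>lborel)"
    unfolding distr_u ennreal_indicator[symmetric] by (subst integral_density) auto
  also have "\<dots> = (\<integral>z. (if 0 < z \<and> z < b then f z else 0) \<partial>lborel)"
    by (intro Bochner_Integration.integral_cong) (auto simp: indicator_def)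
  finally show ?thesis .
qed

lemma measurable_cumul [measurable]:
  assumes [measurable]: "k \<in> borel_measurable N"
  shows "cumul k \<in> borel_measurable borel"
  unfolding cumul_def by measurable

lemma measurable_avg [measurable]:
  assumes [measurable]: "k \<in> borel_measurable N"
  shows "avg k \<in> borel_measurable borel"
  unfolding avg_def by measurable

lemma abs_cumul_le:
  assumes "integrable N k"
  shows "\<bar>cumul k z\<bar> \<le> (\<integral>x. \<bar>k x\<bar> \<partial>N)"
proof -
  have [measurable]: "k \<in> borel_measurable N" using assms by auto
  have "\<bar>cumul k z\<bar> \<le> (\<integral>x. \<bar>if u x < z then k x else 0\<bar> \<partial>N)"
    unfolding cumul_def by (rule integral_abs_bound)
  also have "\<dots> \<le> (\<integral>x. \<bar>k x\<bar> \<partial>N)"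
    using assms by (intro integral_mono integrable_abs) (auto intro: Bochner_Integration.integrable_bound)
  finally show ?thesis .
qed

lemma cumul_top:
  assumes [measurable]: "k \<in> borel_measurable N"
  shows "cumul k b = (\<integral>x. k x \<partial>N)"
  unfolding cumul_def
proof (rule integral_cong_AE)
  show "AE x in N. (if u x < b then k x else 0) = k x"
    using AE_rank by eventually_elim auto
qed measurable

lemma integrable_pair_snd:
  fixes k :: "'a \<Rightarrow> real"
  assumes "integrable N k"
  shows "integrable (N \<Otimes>\<^sub>M N) (\<lambda>p. k (snd p))"
proof -
  interpret NN: pair_sigma_finite N N ..
  have [measurable]: "k \<in> borel_measurable N" using assms by auto
  show ?thesis
    by (rule NN.Fubini_integrable) (use assms in auto)
qed

text \<open>
  On the left, \<open>y\<close> contributes to \<open>cumul k z\<close> for all \<open>z > u y\<close>. Exchanging the integrals leaves the integral of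
  \<open>1 / z\<^sup>2\<close> from \<open>max (u y) w\<close> to \<open>b\<close>.
\<close>

lemma cumul_fubini:
  assumes k: "integrable N k" and w: "0 < w" "w \<le> b"
  shows "(\<integral>x. (if w < u x then cumul k (u x) / (u x)\<^sup>2 else 0) \<partial>N) =
         (\<integral>y. k y * (1 / max (u y) w - 1 / b) \<partial>N)"
proof -
  interpret NN: pair_sigma_finite N N ..
  have [measurable]: "k \<in> borel_measurable N" using k by auto
  define F where "F = (\<lambda>(x, y). (if w < u x then 1 / (u x)\<^sup>2 else 0) * (if u y < u x then k y else 0))"
  have [measurable]: "F \<in> borel_measurable (N \<Otimes>\<^sub>M N)"
    unfolding F_def by measurable
  have int: "integrable (N \<Otimes>\<^sub>M N) F"
  proof (rule Bochner_Integration.integrable_bound)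
    show "integrable (N \<Otimes>\<^sub>M N) (\<lambda>p. 1 / w\<^sup>2 * k (snd p))"
      using integrable_pair_snd[OF k] by (intro integrable_mult_right)
    have "\<bar>F (x, y)\<bar> \<le> \<bar>1 / w\<^sup>2 * k y\<bar>" for x y
    proof (cases "w < u x")
      case True
      then have "1 / (u x)\<^sup>2 \<le> 1 / w\<^sup>2"
        using w by (intro divide_left_mono power_mono mult_pos_pos zero_less_power) auto
      from mult_right_mono[OF this, of "\<bar>k y\<bar>"] show ?thesis
        using True w by (auto simp: F_def abs_mult)
    qed (auto simp: F_def)
    then show "AE p in N \<Otimes>\<^sub>M N. norm (F p) \<le> norm (1 / w\<^sup>2 * k (snd p))"
      by auto
  qed measurable
  have "(\<integral>x. (if w < u x then cumul k (u x) / (u x)\<^sup>2 else 0) \<partial>N) = (\<integral>x. \<integral>y. F (x, y) \<partial>N \<partial>N)"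
    by (intro Bochner_Integration.integral_cong refl) (simp add: F_def cumul_def)
  also have "\<dots> = (\<integral>y. \<integral>x. F (x, y) \<partial>N \<partial>N)"
    using NN.Fubini_integral[of "\<lambda>x y. F (x, y)"] int by simp
  also have "\<dots> = (\<integral>y. k y * (1 / max (u y) w - 1 / b) \<partial>N)"
  proof (rule integral_cong_AE)
    show "AE y in N. (\<integral>x. F (x, y) \<partial>N) = k y * (1 / max (u y) w - 1 / b)"
      using AE_rank
    proof eventually_elim
      case (elim y)
      define m where "m = max (u y) w"
      have m: "0 < m" "m \<le> b" using elim w by (auto simp: m_def)
      have "(\<integral>x. F (x, y) \<partial>N) = (\<integral>x. k y * (if m < u x then 1 / (u x)\<^sup>2 else 0) \<partial>N)"
        by (intro Bochner_Integration.integral_cong refl) (auto simp: F_def m_def)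
      also have "\<dots> = k y * (\<integral>x. (if m < u x then 1 / (u x)\<^sup>2 else 0) \<partial>N)"
        by (rule integral_mult_right_zero)
      also have "(\<integral>x. (if m < u x then 1 / (u x)\<^sup>2 else 0) \<partial>N) =
          (\<integral>z. (if 0 < z \<and> z < b then if m < z then 1 / z\<^sup>2 else 0 else 0) \<partial>lborel)"
        by (rule integral_rank) measurable
      also have "\<dots> = (\<integral>z. (if m < z \<and> z < b then 1 / z\<^sup>2 else 0) \<partial>lborel)"
        using m by (intro Bochner_Integration.integral_cong) auto
      also have "\<dots> = 1 / m - 1 / b"
        by (rule integral_inverse_square[OF m])
      finally show ?case by (simp add: m_def)
    qed
  qed measurable
  finally show ?thesis .
qed

lemma integrable_above:
  fixes f :: "'a \<Rightarrow> real"
  assumes f: "integrable N f" and [measurable]: "c \<in> borel_measurable borel"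
    and "\<And>z. w < z \<Longrightarrow> \<bar>c z\<bar> \<le> C"
  shows "integrable N (\<lambda>x. if w < u x then c (u x) * f x else 0)"
proof (rule Bochner_Integration.integrable_bound)
  have [measurable]: "f \<in> borel_measurable N" using f by auto
  show "integrable N (\<lambda>x. \<bar>C\<bar> * f x)" using f by (intro integrable_mult_right)
  show "(\<lambda>x. if w < u x then c (u x) * f x else 0) \<in> borel_measurable N" by measurable
  show "AE x in N. norm (if w < u x then c (u x) * f x else 0) \<le> norm (\<bar>C\<bar> * f x)"
    using assms(3) by (intro AE_I2) (fastforce simp: abs_mult intro!: mult_right_mono)
qed

lemma integrable_div_rank:
  assumes f: "integrable N f" and w: "0 < w"
  shows "integrable N (\<lambda>x. if w < u x then f x / u x else 0)"
  using integrable_above[OF f, of "\<lambda>z. 1 / z" w "1 / w"] w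
  by (simp add: frac_le cong: if_cong)

lemma integrable_cumul_div:
  assumes f: "integrable N k" and w: "0 < w"
  shows "integrable N (\<lambda>x. if w < u x then cumul k (u x) / (u x)\<^sup>2 else 0)"
proof (rule Bochner_Integration.integrable_bound)
  have [measurable]: "k \<in> borel_measurable N" using f by auto
  show "(\<lambda>x. if w < u x then cumul k (u x) / (u x)\<^sup>2 else 0) \<in> borel_measurable N" by measurable
  show "integrable N (\<lambda>x. (\<integral>x. \<bar>k x\<bar> \<partial>N) / w\<^sup>2)" by simp
  show "AE x in N. norm (if w < u x then cumul k (u x) / (u x)\<^sup>2 else 0) \<le> norm ((\<integral>x. \<bar>k x\<bar> \<partial>N) / w\<^sup>2)"
    using abs_cumul_le[OF f] w by (intro AE_I2) (auto intro!: frac_le power_mono)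
qed

text \<open>
  Integration by parts of \<open>cumul k\<close> against \<open>-1 / z\<close>. It comes from Fubini because \<open>k\<close> is merely integrable.
\<close>

lemma integral_cumul_div:
  assumes k: "integrable N k" and w: "0 < w" "w \<le> b"
  shows "(\<integral>x. (if w < u x then cumul k (u x) / (u x)\<^sup>2 else 0) \<partial>N) =
      avg k w + (\<integral>y. (if w < u y then k y / u y else 0) \<partial>N) - avg k b"
proof -
  have [measurable]: "k \<in> borel_measurable N" using k by auto
  have i: "integrable N (\<lambda>x. if u x < w then k x else 0)"
    by (rule Bochner_Integration.integrable_bound[OF k]) auto
  have "(\<integral>y. k y * (1 / max (u y) w - 1 / b) \<partial>N) =
    (\<integral>y. (if u y < w then k y else 0) / w + (if w < u y then k y / u y else 0) - k y / b \<partial>N)"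
  proof (rule integral_cong_AE)
    show "AE y in N. k y * (1 / max (u y) w - 1 / b) =
      (if u y < w then k y else 0) / w + (if w < u y then k y / u y else 0) - k y / b"
      using AE_rank_neq[of w] AE_rank by eventually_elim (auto simp: max_def algebra_simps)
  qed measurable
  also have "\<dots> = avg k w + (\<integral>y. (if w < u y then k y / u y else 0) \<partial>N) - avg k b"
    using integrable_div_rank[OF k w(1)] i k by (simp add: avg_def cumul_def[of k w] cumul_top)
  finally show ?thesis
    by (simp only: cumul_fubini[OF k w])
qed

text \<open>
  The derivative of \<open>avg g\<close> at \<open>z\<close> is \<open>(g - avg g) / z\<close>.
\<close>

lemma avg_increment:
  assumes g: "integrable N g" and w: "0 < w" "w \<le> b"
  shows "avg g b - avg g w = (\<integral>x. (if w < u x then (g x - avg g (u x)) / u x else 0) \<partial>N)"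
proof -
  have [measurable]: "g \<in> borel_measurable N" using g by auto
  have eq: "(if w < u x then (g x - avg g (u x)) / u x else 0) =
    (if w < u x then g x / u x else 0) - (if w < u x then cumul g (u x) / (u x)\<^sup>2 else 0)" for x
    using w by (auto simp: avg_def field_simps power2_eq_square)
  show ?thesis unfolding eq
    using integrable_div_rank[OF g w(1)] integrable_cumul_div[OF g w(1)] integral_cumul_div[OF g w]
    by simp
qed

text \<open>
  Split the square of the integral into the pairs with \<open>u y < u x\<close> and those with \<open>u x < u y\<close>. By symmetry both
  halves are equal, and ties have measure zero.
\<close>

lemma cumul_square:
  assumes g: "integrable N g"
  shows "(cumul g z)\<^sup>2 = cumul (\<lambda>x. 2 * g x * cumul g (u x)) z"
proof -
  interpret NN: pair_sigma_finite N N ..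
  have [measurable]: "g \<in> borel_measurable N" using g by auto
  define F where "F = (\<lambda>(x, y). (if u x < z then g x else 0) * (if u y < u x then g y else 0))"
  have [measurable]: "F \<in> borel_measurable (N \<Otimes>\<^sub>M N)"
    unfolding F_def by measurable
  have gg: "integrable (N \<Otimes>\<^sub>M N) (\<lambda>p. g (fst p) * g (snd p))"
  proof (rule NN.Fubini_integrable)
    show "integrable N (\<lambda>x. \<integral>y. norm (g (fst (x, y)) * g (snd (x, y))) \<partial>N)"
      using g by (simp add: abs_mult)
    show "AE x in N. integrable N (\<lambda>y. g (fst (x, y)) * g (snd (x, y)))"
      using g by simp
  qed measurable
  have int: "integrable (N \<Otimes>\<^sub>M N) F"
    by (rule Bochner_Integration.integrable_bound[OF gg]) (auto simp: F_def abs_mult)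
  have int': "integrable (N \<Otimes>\<^sub>M N) (\<lambda>(x, y). F (y, x))"
    by (rule Bochner_Integration.integrable_bound[OF gg]) (auto simp: F_def abs_mult)
  have "(cumul g z)\<^sup>2 = (\<integral>x. \<integral>y. (if u x < z then g x else 0) * (if u y < z then g y else 0) \<partial>N \<partial>N)"
    by (simp add: cumul_def power2_eq_square)
  also have "\<dots> = (\<integral>x. (\<integral>y. F (x, y) + F (y, x) \<partial>N) \<partial>N)"
  proof (rule integral_cong_AE)
    have "(\<integral>y. (if u x < z then g x else 0) * (if u y < z then g y else 0) \<partial>N) = (\<integral>y. F (x, y) + F (y, x) \<partial>N)"
      if [measurable]: "x \<in> space N" for x
    proof (rule integral_cong_AE)
      show "(\<lambda>y. F (x, y) + F (y, x)) \<in> borel_measurable N"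
        unfolding F_def by simp
      show "AE y in N. (if u x < z then g x else 0) * (if u y < z then g y else 0) = F (x, y) + F (y, x)"
        using AE_rank_neq[of "u x"] by eventually_elim (auto simp: F_def)
    qed simp
    then show "AE x in N. (\<integral>y. (if u x < z then g x else 0) * (if u y < z then g y else 0) \<partial>N) = (\<integral>y. F (x, y) + F (y, x) \<partial>N)"
      by auto
  qed measurable
  also have "\<dots> = (\<integral>p. F p + (case p of (x, y) \<Rightarrow> F (y, x)) \<partial>(N \<Otimes>\<^sub>M N))"
    using Bochner_Integration.integrable_add[OF int int']
    by (subst NN.integral_fst'[symmetric]) auto
  also have "\<dots> = (\<integral>p. F p \<partial>(N \<Otimes>\<^sub>M N)) + (\<integral>p. (case p of (x, y) \<Rightarrow> F (y, x)) \<partial>(N \<Otimes>\<^sub>M N))"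
    by (rule Bochner_Integration.integral_add[OF int int'])
  also have "(\<integral>p. (case p of (x, y) \<Rightarrow> F (y, x)) \<partial>(N \<Otimes>\<^sub>M N)) = (\<integral>p. F p \<partial>(N \<Otimes>\<^sub>M N))"
    by (rule NN.integral_product_swap) measurable
  also have "(\<integral>p. F p \<partial>(N \<Otimes>\<^sub>M N)) = (\<integral>x. \<integral>y. F (x, y) \<partial>N \<partial>N)"
    using int by (rule NN.integral_fst'[symmetric])
  also have "\<dots> = (\<integral>x. (if u x < z then g x else 0) * cumul g (u x) \<partial>N)"
    by (simp add: F_def cumul_def)
  finally have "(cumul g z)\<^sup>2 = 2 * (\<integral>x. (if u x < z then g x else 0) * cumul g (u x) \<partial>N)" by simp
  also have "\<dots> = (\<integral>x. 2 * ((if u x < z then g x else 0) * cumul g (u x)) \<partial>N)"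
    by simp
  also have "\<dots> = cumul (\<lambda>x. 2 * g x * cumul g (u x)) z"
    unfolding cumul_def[of "\<lambda>x. 2 * g x * cumul g (u x)"] by (intro Bochner_Integration.integral_cong) auto
  finally show ?thesis .
qed

lemma avg_increment_square:
  assumes g: "integrable N g" and w: "0 < w" "w \<le> b"
  shows "ennreal ((avg g b - avg g w)\<^sup>2) \<le>
    ennreal (b - w) * (\<integral>\<^sup>+x. (if w < u x then ennreal (((g x - avg g (u x)) / u x)\<^sup>2) else 0) \<partial>N)"
proof -
  have [measurable]: "g \<in> borel_measurable N" using g by auto
  define S where "S = {x \<in> space N. w < u x}"
  have [measurable]: "S \<in> sets N" unfolding S_def by measurable
  let ?D = "\<lambda>x. (g x - avg g (u x)) / u x"
  have "{0<..<b} \<inter> {w<..} = {w<..<b}" using w by auto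
  then have S: "emeasure N S = ennreal (b - w)"
    using emeasure_rank[of "{w<..}"] w by (simp add: S_def)
  have "(\<integral>x. (if w < u x then ?D x else 0) \<partial>N) =
     (\<integral>x. indicator S x * (?D x) \<partial>N)"
    by (intro Bochner_Integration.integral_cong) (auto simp: S_def indicator_def)
  then have "ennreal ((avg g b - avg g w)\<^sup>2) \<le> emeasure N S * (\<integral>\<^sup>+x. indicator S x * ennreal ((?D x)\<^sup>2) \<partial>N)"
    unfolding avg_increment[OF g w] by (simp only:) (rule integral_square_le; measurable)
  also have "(\<integral>\<^sup>+x. indicator S x * ennreal ((?D x)\<^sup>2) \<partial>N) =
    (\<integral>\<^sup>+x. (if w < u x then ennreal ((?D x)\<^sup>2) else 0) \<partial>N)"
    by (intro nn_integral_cong) (auto simp: S_def indicator_def)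
  finally show ?thesis unfolding S .
qed

text \<open>
  The identity behind this bound is that the derivative of \<open>z (avg g z)\<^sup>2\<close> is \<open>g\<^sup>2 - (g - avg g)\<^sup>2\<close>. In integrated
  form it is the integration by parts above with \<open>k = 2 g (cumul g \<circ> u)\<close>, for which \<open>cumul k = (cumul g)\<^sup>2\<close>.
\<close>

lemma deviation_energy_above:
  assumes g: "g \<in> borel_measurable N" and g2: "integrable N (\<lambda>x. (g x)\<^sup>2)" and w: "0 < w" "w \<le> b"
  shows "(\<integral>\<^sup>+x. (if w < u x then ennreal ((g x - avg g (u x))\<^sup>2) else 0) \<partial>N) \<le>
    ennreal ((\<integral>x. (g x)\<^sup>2 \<partial>N) - b * (avg g b)\<^sup>2)"
proof -
  note g[measurable]
  let ?D = "\<lambda>x. if w < u x then (g x - avg g (u x))\<^sup>2 else 0"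
  let ?G = "\<lambda>x. if w < u x then (g x)\<^sup>2 else 0"
  let ?L = "\<lambda>x. if u x < w then (g x)\<^sup>2 else 0"
  have g1: "integrable N g" using g g2 by (rule square_integrable_imp_integrable)
  define k where "k x = 2 * g x * cumul g (u x)" for x
  define C where "C = (\<integral>x. \<bar>g x\<bar> \<partial>N)"
  have k: "integrable N k"
  proof (rule Bochner_Integration.integrable_bound)
    show "integrable N (\<lambda>x. (2 * C) * g x)" using g1 by (intro integrable_mult_right)
    show "k \<in> borel_measurable N" unfolding k_def by measurable
    show "AE x in N. norm (k x) \<le> norm ((2 * C) * g x)"
      using abs_cumul_le[OF g1] unfolding k_def C_def
      by (intro AE_I2) (simp add: abs_mult mult.commute, rule mult_left_mono, auto)
  qed
  have ck: "cumul k z = (cumul g z)\<^sup>2" for z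
    using cumul_square[OF g1, of z] by (simp add: k_def[abs_def])
  have ak: "avg k z = z * (avg g z)\<^sup>2" for z
    by (simp add: avg_def ck power2_eq_square)
  have i1: "integrable N ?G"
    by (rule Bochner_Integration.integrable_bound[OF g2]) auto
  have i2: "integrable N ?L"
    by (rule Bochner_Integration.integrable_bound[OF g2]) auto
  note j = integrable_div_rank[OF k w(1)] integrable_cumul_div[OF k w(1)]
  have eq: "(?D x) =
    (?G x) - (if w < u x then k x / u x else 0)
      + (if w < u x then cumul k (u x) / (u x)\<^sup>2 else 0)" for x
    by (simp add: ck k_def avg_def power2_diff power_divide)
  have int: "integrable N ?D"
    unfolding eq using i1 j by auto
  have "(\<integral>x. (?D x) \<partial>N) =
    (\<integral>x. (?G x) \<partial>N) + w * (avg g w)\<^sup>2 - b * (avg g b)\<^sup>2"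
    unfolding eq using i1 j integral_cumul_div[OF k w] by (simp add: ak)
  \<comment> \<open>By Cauchy-Schwarz, the boundary term at \<open>w\<close> is at most the energy of \<open>g\<close>
    below \<open>w\<close>.\<close>
  also have "w * (avg g w)\<^sup>2 \<le> (\<integral>x. (?L x) \<partial>N)"
  proof -
    define S where "S = {x \<in> space N. u x < w}"
    have [measurable]: "S \<in> sets N" unfolding S_def by measurable
    have "{0<..<b} \<inter> {..<w} = {0<..<w}" using w by auto
    then have S: "emeasure N S = ennreal w"
      using emeasure_rank[of "{..<w}"] w by (simp add: S_def)
    have "cumul g w = (\<integral>x. indicator S x * g x \<partial>N)"
      unfolding cumul_def by (intro Bochner_Integration.integral_cong) (auto simp: S_def indicator_def)
    then have "ennreal ((cumul g w)\<^sup>2) \<le> ennreal w * (\<integral>\<^sup>+x. indicator S x * ennreal ((g x)\<^sup>2) \<partial>N)"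
      using integral_square_le[of g N S] S by simp
    also have "(\<integral>\<^sup>+x. indicator S x * ennreal ((g x)\<^sup>2) \<partial>N) = (\<integral>\<^sup>+x. ennreal (?L x) \<partial>N)"
      by (intro nn_integral_cong) (auto simp: S_def indicator_def)
    also have "\<dots> = ennreal (\<integral>x. (?L x) \<partial>N)"
      by (rule nn_integral_eq_integral[OF i2]) auto
    finally have "ennreal ((cumul g w)\<^sup>2) \<le> ennreal (w * (\<integral>x. (?L x) \<partial>N))"
      using w by (simp add: ennreal_mult' )
    then have "(cumul g w)\<^sup>2 \<le> w * (\<integral>x. (?L x) \<partial>N)"
      using w by (subst (asm) ennreal_le_iff) (auto intro!: mult_nonneg_nonneg integral_nonneg_AE)
    then show ?thesis
      using w by (simp add: avg_def power_divide divide_simps power2_eq_square mult_ac)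
  qed
  also have "(\<integral>x. (?G x) \<partial>N) + (\<integral>x. (?L x) \<partial>N) =
    (\<integral>x. (?G x) + (?L x) \<partial>N)"
    using i1 i2 by simp
  also have "\<dots> \<le> (\<integral>x. (g x)\<^sup>2 \<partial>N)"
    using i1 i2 g2 by (intro integral_mono) auto
  finally have le: "(\<integral>x. (?D x) \<partial>N) \<le> (\<integral>x. (g x)\<^sup>2 \<partial>N) - b * (avg g b)\<^sup>2"
    by simp
  have "(\<integral>\<^sup>+x. (if w < u x then ennreal ((g x - avg g (u x))\<^sup>2) else 0) \<partial>N) =
    (\<integral>\<^sup>+x. ennreal (?D x) \<partial>N)"
    by (intro nn_integral_cong) auto
  also have "\<dots> = ennreal (\<integral>x. (?D x) \<partial>N)"
    by (rule nn_integral_eq_integral[OF int]) auto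
  finally show ?thesis using le by (simp add: ennreal_leI)
qed

lemma deviation_energy:
  assumes g: "g \<in> borel_measurable N" and g2: "integrable N (\<lambda>x. (g x)\<^sup>2)"
  shows "(\<integral>\<^sup>+x. ennreal ((g x - avg g (u x))\<^sup>2) \<partial>N) + ennreal (b * (avg g b)\<^sup>2) \<le> (\<integral>\<^sup>+x. ennreal ((g x)\<^sup>2) \<partial>N)"
proof -
  note g[measurable]
  let ?R = "(\<integral>x. (g x)\<^sup>2 \<partial>N) - b * (avg g b)\<^sup>2"
  have "(\<integral>\<^sup>+x. ennreal ((g x - avg g (u x))\<^sup>2) \<partial>N) =
      (\<integral>\<^sup>+x. (if 0 < u x then ennreal ((g x - avg g (u x))\<^sup>2) else 0) \<partial>N)"
    by (rule nn_integral_cong_AE) (use AE_rank in \<open>auto elim!: eventually_mono\<close>)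
  also have "\<dots> \<le> ennreal ?R"
    by (rule nn_integral_truncation_le[OF _ _ b_pos deviation_energy_above[OF g g2]]) measurable
  finally have *: "(\<integral>\<^sup>+x. ennreal ((g x - avg g (u x))\<^sup>2) \<partial>N) \<le> ennreal ?R" .
  \<comment> \<open>The bound \<open>ennreal ?R\<close> is only informative if \<open>?R\<close> is nonnegative,
    which is Cauchy-Schwarz on all of \<open>N\<close>.\<close>
  have R: "0 \<le> ?R"
  proof -
    define S where "S = space N"
    have S: "emeasure N S = ennreal b"
      using emeasure_rank[of UNIV] b_pos by (simp add: S_def)
    have "cumul g b = (\<integral>x. indicator S x * g x \<partial>N)"
      unfolding cumul_top[OF g] by (intro Bochner_Integration.integral_cong) (auto simp: S_def)
    then have "ennreal ((cumul g b)\<^sup>2) \<le> ennreal b * (\<integral>\<^sup>+x. indicator S x * ennreal ((g x)\<^sup>2) \<partial>N)"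
      using integral_square_le[of g N S] S by (simp add: S_def)
    also have "(\<integral>\<^sup>+x. indicator S x * ennreal ((g x)\<^sup>2) \<partial>N) = (\<integral>\<^sup>+x. ennreal ((g x)\<^sup>2) \<partial>N)"
      by (intro nn_integral_cong) (auto simp: S_def)
    also have "\<dots> = ennreal (\<integral>x. (g x)\<^sup>2 \<partial>N)"
      by (rule nn_integral_eq_integral[OF g2]) auto
    finally have "(cumul g b)\<^sup>2 \<le> b * (\<integral>x. (g x)\<^sup>2 \<partial>N)"
      using b_pos by (subst (asm) ennreal_mult'[symmetric]) (auto intro!: mult_nonneg_nonneg)
    then show ?thesis
      using b_pos by (simp add: avg_def power_divide divide_simps power2_eq_square mult_ac)
  qed
  have "(\<integral>\<^sup>+x. ennreal ((g x - avg g (u x))\<^sup>2) \<partial>N) + ennreal (b * (avg g b)\<^sup>2) \<le> ennreal ?R + ennreal (b * (avg g b)\<^sup>2)"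
    by (rule add_right_mono[OF *])
  also have "\<dots> = ennreal (\<integral>x. (g x)\<^sup>2 \<partial>N)"
    using R b_pos by (subst ennreal_plus[symmetric]) auto
  also have "\<dots> = (\<integral>\<^sup>+x. ennreal ((g x)\<^sup>2) \<partial>N)"
    by (rule nn_integral_eq_integral[OF g2, symmetric]) auto
  finally show ?thesis .
qed

end

section \<open>Tails with a concave logarithmic profile\<close>

text \<open>
  The assumption \<open>l_increment\<close> expresses that \<open>s \<mapsto> l (exp (-s))\<close> is concave where it is positive: the increment over a step of length
  \<open>- ln r\<close> decreases as \<open>s\<close> grows. Stated with dilations \<open>t \<mapsto> r t\<close>, it is used directly in integrals, and
  derivatives of \<open>l\<close> never appear.
\<close>

locale log_concave_tail =
  fixes l :: "real \<Rightarrow> real"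
  assumes l_measurable [measurable]: "l \<in> borel_measurable borel"
    and l_nonneg: "\<And>t. 0 \<le> l t"
    and l_antimono: "\<And>s t. 0 < s \<Longrightarrow> s \<le> t \<Longrightarrow> l t \<le> l s"
    and l_integrable: "integrable lborel (\<lambda>t. if 0 < t then l t else 0)"
    and l_increment: "\<And>r s t. 0 < r \<Longrightarrow> r < 1 \<Longrightarrow> 0 < s \<Longrightarrow> s \<le> t \<Longrightarrow> 0 < l t \<Longrightarrow> l (r * s) - l s \<le> l (r * t) - l t"
begin

lemma integrable_if_bounded:
  assumes "\<And>t. P t \<Longrightarrow> 0 < t \<and> l t \<le> B" and [measurable]: "Measurable.pred borel P"
  shows "integrable lborel (\<lambda>t. if P t then l t else 0)" "integrable lborel (\<lambda>t. if P t then (l t)\<^sup>2 else 0)"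
proof -
  show 1: "integrable lborel (\<lambda>t. if P t then l t else 0)"
    by (rule Bochner_Integration.integrable_bound[OF l_integrable]) (use assms l_nonneg in auto)
  have "integrable lborel (\<lambda>t. B * (if P t then l t else 0))"
    using 1 by (rule integrable_mult_right)
  then show "integrable lborel (\<lambda>t. if P t then (l t)\<^sup>2 else 0)"
    by (rule Bochner_Integration.integrable_bound)
      (use assms l_nonneg in \<open>auto simp: power2_eq_square abs_mult intro!: mult_right_mono AE_I2 order_trans[OF _ abs_ge_self]\<close>)
qed

lemma dilation:
  fixes f :: "real \<Rightarrow> real"
  assumes "0 < r" "integrable lborel f"
  shows "integrable lborel (\<lambda>t. f (r * t))" "(\<integral>t. f (r * t) \<partial>lborel) = (\<integral>t. f t \<partial>lborel) / r"
  using lborel_integrable_real_affine[of f r 0] lborel_integral_real_affine[of r f 0] assms by auto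

text \<open>
  The pairs of heights \<open>s < a < t\<close>, weighted by their masses and by the mass \<open>l s - l t\<close> between them. After
  division by \<open>(l a)\<^sup>2\<close> this is the factor of the squared deviation at level \<open>a\<close> when the variance of the slice means is
  expanded over pairs.
\<close>

definition straddling :: "real \<Rightarrow> ennreal" where
  "straddling a = (\<integral>\<^sup>+s. (if 0 < s \<and> s < a then \<integral>\<^sup>+t. (if a < t then ennreal ((l s - l t) * l s * l t) else 0) \<partial>lborel else 0) \<partial>lborel)"

context
  fixes a :: real assumes a: "0 < a" "0 < l a"
begin

definition "mass_below = (\<integral>t. (if 0 < t \<and> t < a then l t else 0) \<partial>lborel)"
definition "square_below = (\<integral>t. (if 0 < t \<and> t < a then (l t)\<^sup>2 else 0) \<partial>lborel)"
definition "mass_above = (\<integral>t. (if a < t then l t else 0) \<partial>lborel)"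
definition "square_above = (\<integral>t. (if a < t then (l t)\<^sup>2 else 0) \<partial>lborel)"
definition "square_between r = (\<integral>t. (if r * a < t \<and> t \<le> a then (l t)\<^sup>2 else 0) \<partial>lborel)"

text \<open>
  For \<open>t > a\<close>, factor \<open>l(r t)\<^sup>2 - l(t)\<^sup>2 = (l(r t) - l(t)) (l(r t) + l(t))\<close>. The first factor is at least its value
  at \<open>a\<close>, and the second is at least \<open>2 l(t)\<close>. A change of variables evaluates the integral of the left side up to
  the boundary term \<open>square_between r\<close>.
\<close>

lemma above_le:
  assumes r: "0 < r" "r < 1"
  shows "2 * r * (l (r * a) - l a) * mass_above \<le> (1 - r) * square_above + square_between r"
proof -
  define d where "d = l (r * a) - l a"
  have d: "0 \<le> d" using l_antimono[of "r * a" a] a r by (auto simp: d_def)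
  have i: "integrable lborel (\<lambda>t. if a < t then l t else 0)" "integrable lborel (\<lambda>t. if a < t then (l t)\<^sup>2 else 0)"
    by (rule integrable_if_bounded[where B="l a"]; use a l_antimono in auto)+
  have ra: "0 < r * a" "r * a < a" using r a by auto
  have i': "integrable lborel (\<lambda>t. if r * a < t then (l t)\<^sup>2 else 0)"
    by (rule integrable_if_bounded[where B="l (r * a)"]; use ra a l_antimono in auto)
  have iE: "integrable lborel (\<lambda>t. if r * a < t \<and> t \<le> a then (l t)\<^sup>2 else 0)"
    by (rule integrable_if_bounded[where B="l (r * a)"]; use ra a l_antimono in auto)
  note dil = dilation[OF r(1) i']
  have "square_above + 2 * d * mass_above = (\<integral>t. (if a < t then (l t)\<^sup>2 else 0) + 2 * d * (if a < t then l t else 0) \<partial>lborel)"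
    using i by (simp add: mass_above_def square_above_def)
  also have "\<dots> \<le> (\<integral>t. (if r * a < r * t then (l (r * t))\<^sup>2 else 0) \<partial>lborel)"
  proof (rule integral_mono)
    show "integrable lborel (\<lambda>t. (if a < t then (l t)\<^sup>2 else 0) + 2 * d * (if a < t then l t else 0))"
      using i by auto
    show "integrable lborel (\<lambda>t. if r * a < r * t then (l (r * t))\<^sup>2 else 0)"
      by (rule dil)
    fix t
    show "(if a < t then (l t)\<^sup>2 else 0) + 2 * d * (if a < t then l t else 0) \<le> (if r * a < r * t then (l (r * t))\<^sup>2 else 0)"
    proof (cases "a < t \<and> 0 < l t")
      case True
      then have "d + l t \<le> l (r * t)"
        using l_increment[OF r, of a t] a by (auto simp: d_def)
      then have "(d + l t)\<^sup>2 \<le> (l (r * t))\<^sup>2"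
        using d l_nonneg[of t] by (intro power_mono) auto
      moreover have "(l t)\<^sup>2 + 2 * d * l t \<le> (d + l t)\<^sup>2"
        by (simp add: power2_sum)
      ultimately show ?thesis using True r by auto
    next
      case False
      then show ?thesis using l_nonneg[of t] by auto
    qed
  qed
  also have "\<dots> = (\<integral>t. (if r * a < t then (l t)\<^sup>2 else 0) \<partial>lborel) / r"
    by (rule dil)
  also have "(\<integral>t. (if r * a < t then (l t)\<^sup>2 else 0) \<partial>lborel) =
    (\<integral>t. (if r * a < t \<and> t \<le> a then (l t)\<^sup>2 else 0) + (if a < t then (l t)\<^sup>2 else 0) \<partial>lborel)"
    using ra by (intro Bochner_Integration.integral_cong) auto
  also have "\<dots> = square_between r + square_above"
    unfolding square_between_def square_above_def by (rule Bochner_Integration.integral_add[OF iE i(2)])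
  finally show ?thesis
    using r by (simp add: d_def field_simps)
qed

text \<open>
  The counterpart for \<open>t < a\<close>, where \<open>l(r t) - l(t)\<close> is at most its value at \<open>a\<close>. Since \<open>l\<close> may blow up at 0,
  the square of \<open>l\<close> is first integrated away from 0; the bound that results shows that it is integrable.
\<close>

lemma below_le_truncated:
  assumes r: "0 < r" "r < 1" and w: "0 < w" "w < r * a"
  shows "(1 - r) * (\<integral>t. (if w < t \<and> t < a then (l t)\<^sup>2 else 0) \<partial>lborel) \<le> 2 * (l (r * a) - l a) * mass_below + square_between r"
proof -
  define d where "d = l (r * a) - l a"
  let ?low1 = "\<lambda>t. if r * w < t \<and> t < r * a then l t else 0"
  let ?low2 = "\<lambda>t. if r * w < t \<and> t < r * a then (l t)\<^sup>2 else 0"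
  let ?dil1 = "\<lambda>t. if r * w < r * t \<and> r * t < r * a then l (r * t) else 0"
  let ?dil2 = "\<lambda>t. if r * w < r * t \<and> r * t < r * a then (l (r * t))\<^sup>2 else 0"
  let ?l1 = "\<lambda>t. if w < t \<and> t < a then l t else 0"
  let ?l2 = "\<lambda>t. if w < t \<and> t < a then (l t)\<^sup>2 else 0"
  have d: "0 \<le> d" using l_antimono[of "r * a" a] a r by (auto simp: d_def)
  have ra: "0 < r * a" "r * a < a" using r a by auto
  have rw: "0 < r * w" "r * w < w" using r w by auto
  have i: "integrable lborel ?l1" "integrable lborel ?l2"
    by (rule integrable_if_bounded[where B="l w"]; use w l_antimono in auto)+
  have i': "integrable lborel ?low1" "integrable lborel ?low2"
    by (rule integrable_if_bounded[where B="l (r * w)"]; use rw l_antimono in auto)+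
  have iE: "integrable lborel (\<lambda>t. if r * a < t \<and> t \<le> a then (l t)\<^sup>2 else 0)"
    by (rule integrable_if_bounded[where B="l (r * a)"]; use ra a l_antimono in auto)
  have i1: "integrable lborel (\<lambda>t. if 0 < t \<and> t < a then l t else 0)"
    by (rule Bochner_Integration.integrable_bound[OF l_integrable]) (use l_nonneg in auto)
  note dil = dilation[OF r(1) i'(1)] dilation[OF r(1) i'(2)]
  let ?X = "\<integral>t. ?l2 t \<partial>lborel"
  have "?X \<le> (\<integral>t. ?low2 t + (if r * a < t \<and> t \<le> a then (l t)\<^sup>2 else 0) \<partial>lborel)"
  proof (rule integral_mono_AE)
    show "AE t in lborel. ?l2 t
         \<le> ?low2 t + (if r * a < t \<and> t \<le> a then (l t)\<^sup>2 else 0)"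
      using AE_lborel_singleton[of "r * a"] by eventually_elim (use rw in auto)
  qed (use i i' iE in auto)
  also have "\<dots> = r * (\<integral>t. ?dil2 t \<partial>lborel) + square_between r"
    unfolding dil(4) using i' iE r by (simp add: square_between_def)
  also have "(\<integral>t. ?dil2 t \<partial>lborel) \<le>
    (\<integral>t. ?l2 t + d * (?dil1 t + ?l1 t) \<partial>lborel)"
  proof (rule integral_mono)
    show "integrable lborel ?dil2" by (rule dil)
    show "integrable lborel (\<lambda>t. ?l2 t + d * (?dil1 t + ?l1 t))"
      by (intro Bochner_Integration.integrable_add integrable_mult_right dil i)
    fix t
    have eq: "(l (r * t))\<^sup>2 = (l t)\<^sup>2 + (l (r * t) - l t) * (l (r * t) + l t)"
      by (simp add: power2_eq_square algebra_simps)
    have "(l (r * t) - l t) * (l (r * t) + l t) \<le> d * (l (r * t) + l t)" if "w < t" "t < a"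
      using l_increment[OF r, of t a] that a w l_nonneg by (intro mult_right_mono) (auto simp: d_def)
    then show "?dil2 t \<le>
      ?l2 t + d * (?dil1 t + ?l1 t)"
      using r unfolding eq by simp
  qed
  also have "\<dots> = ?X + d * ((\<integral>t. ?low1 t \<partial>lborel) / r + (\<integral>t. ?l1 t \<partial>lborel))"
    unfolding dil(2)[symmetric] using dil(1) i by (subst Bochner_Integration.integral_add) (auto simp del: mult_less_cancel_left_pos)
  also have "\<dots> \<le> ?X + d * (mass_below / r + mass_below)"
  proof -
    have "(\<integral>t. ?low1 t \<partial>lborel) \<le> mass_below"
      unfolding mass_below_def using i' i1 ra rw l_nonneg by (intro integral_mono) auto
    moreover have "(\<integral>t. ?l1 t \<partial>lborel) \<le> mass_below"
      unfolding mass_below_def using i i1 w l_nonneg by (intro integral_mono) auto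
    ultimately show ?thesis
      using d r by (intro add_left_mono mult_left_mono add_mono divide_right_mono) auto
  qed
  finally have "?X \<le> r * (?X + d * (mass_below / r + mass_below)) + square_between r"
    using r by (simp add: mult_left_mono)
  also have "\<dots> = r * ?X + (1 + r) * (d * mass_below) + square_between r"
    using r by (simp add: field_simps)
  also have "(1 + r) * (d * mass_below) \<le> 2 * (d * mass_below)"
  proof (rule mult_right_mono)
    have "0 \<le> mass_below" unfolding mass_below_def using l_nonneg by (intro integral_nonneg_AE) auto
    then show "0 \<le> d * mass_below" using d by simp
  qed (use r in auto)
  finally show ?thesis
    by (simp add: d_def algebra_simps)
qed

lemma below_le:
  assumes r: "0 < r" "r < 1"
  shows "integrable lborel (\<lambda>t. if 0 < t \<and> t < a then (l t)\<^sup>2 else 0)"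
    and "(1 - r) * square_below \<le> 2 * (l (r * a) - l a) * mass_below + square_between r"
proof -
  define R where "R = (2 * (l (r * a) - l a) * mass_below + square_between r) / (1 - r)"
  have ra: "0 < r * a / 2" using r a by auto
  have "(\<integral>\<^sup>+t. (if 0 < t then ennreal (if t < a then (l t)\<^sup>2 else 0) else 0) \<partial>lborel) \<le> ennreal R"
  proof (rule nn_integral_truncation_le[OF _ _ ra])
    fix w assume w: "0 < w" "w \<le> r * a / 2"
    have i: "integrable lborel (\<lambda>t. if w < t \<and> t < a then (l t)\<^sup>2 else 0)"
      by (rule integrable_if_bounded[where B="l w"]; use w l_antimono in auto)
    have "(\<integral>\<^sup>+t. (if w < t then ennreal (if t < a then (l t)\<^sup>2 else 0) else 0) \<partial>lborel) =
      (\<integral>\<^sup>+t. ennreal (if w < t \<and> t < a then (l t)\<^sup>2 else 0) \<partial>lborel)"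
      by (intro nn_integral_cong) auto
    also have "\<dots> = ennreal (\<integral>t. (if w < t \<and> t < a then (l t)\<^sup>2 else 0) \<partial>lborel)"
      by (rule nn_integral_eq_integral[OF i]) auto
    also have "\<dots> \<le> ennreal R"
      using below_le_truncated[OF r w(1)] w ra r unfolding R_def
      by (intro ennreal_leI) (simp add: pos_le_divide_eq mult.commute)
    finally show "(\<integral>\<^sup>+t. (if w < t then ennreal (if t < a then (l t)\<^sup>2 else 0) else 0) \<partial>lborel) \<le> ennreal R" .
  qed measurable
  also have "(\<integral>\<^sup>+t. (if 0 < t then ennreal (if t < a then (l t)\<^sup>2 else 0) else 0) \<partial>lborel) =
      (\<integral>\<^sup>+t. ennreal (if 0 < t \<and> t < a then (l t)\<^sup>2 else 0) \<partial>lborel)"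
    by (intro nn_integral_cong) auto
  finally have le: "(\<integral>\<^sup>+t. ennreal (if 0 < t \<and> t < a then (l t)\<^sup>2 else 0) \<partial>lborel) \<le> ennreal R" .
  then have "(\<integral>\<^sup>+t. ennreal (norm (if 0 < t \<and> t < a then (l t)\<^sup>2 else 0)) \<partial>lborel) < \<infinity>"
    by (auto simp: less_top[symmetric] top_unique cong: if_cong)
  then show int: "integrable lborel (\<lambda>t. if 0 < t \<and> t < a then (l t)\<^sup>2 else 0)"
    by (intro integrableI_bounded) auto
  have "0 \<le> mass_below" unfolding mass_below_def using l_nonneg by (intro integral_nonneg_AE) auto
  moreover have "l a \<le> l (r * a)" using l_antimono[of "r * a" a] a r by auto
  moreover have "0 \<le> square_between r" unfolding square_between_def by (intro integral_nonneg_AE) auto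
  ultimately have "0 \<le> R" unfolding R_def using r by auto
  have "ennreal square_below = (\<integral>\<^sup>+t. ennreal (if 0 < t \<and> t < a then (l t)\<^sup>2 else 0) \<partial>lborel)"
    unfolding square_below_def by (rule nn_integral_eq_integral[OF int, symmetric]) auto
  with le have "ennreal square_below \<le> ennreal R" by (simp only:)
  with \<open>0 \<le> R\<close> have "square_below \<le> R" by (simp only: ennreal_le_iff)
  then show "(1 - r) * square_below \<le> 2 * (l (r * a) - l a) * mass_below + square_between r"
    unfolding R_def using r by (simp add: pos_le_divide_eq mult.commute)
qed

text \<open>
  In the combination of the bounds above and below \<open>a\<close>, the terms with \<open>l(r a) - l(a)\<close> cancel up to a factor
  \<open>1 - r\<close>. After division by \<open>1 - r\<close> only the boundary term survives the limit \<open>r \<rightarrow> 1\<close>, and it tends to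
  \<open>a (l a)\<^sup>2\<close> by continuity.
\<close>

lemma moment_product_le:
  assumes cont: "isCont l a"
  shows "square_below * mass_above - mass_below * square_above \<le> (\<integral>t. (if 0 < t then l t else 0) \<partial>lborel) * (a * (l a)\<^sup>2)"
proof -
  define C where "C = (\<integral>t. (if 0 < t then l t else 0) \<partial>lborel)"
  have i1: "integrable lborel (\<lambda>t. if 0 < t \<and> t < a then l t else 0)"
    by (rule Bochner_Integration.integrable_bound[OF l_integrable]) (use l_nonneg in auto)
  have i2: "integrable lborel (\<lambda>t. if a < t then l t else 0)"
    by (rule Bochner_Integration.integrable_bound[OF l_integrable]) (use l_nonneg a in auto)
  have "C = (\<integral>t. (if 0 < t \<and> t < a then l t else 0) + (if a < t then l t else 0) \<partial>lborel)"
    unfolding C_def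
  proof (rule integral_cong_AE)
    show "AE t in lborel. (if 0 < t then l t else 0) = (if 0 < t \<and> t < a then l t else 0) + (if a < t then l t else 0)"
      using AE_lborel_singleton[of a] by eventually_elim (use a in auto)
  qed measurable
  also have "\<dots> = mass_below + mass_above" using i1 i2 by (simp add: mass_below_def mass_above_def)
  finally have C: "C = mass_below + mass_above" .
  have nn: "0 \<le> mass_below" "0 \<le> mass_above"
    unfolding mass_below_def mass_above_def using l_nonneg by (auto intro!: integral_nonneg_AE)
  \<comment> \<open>The inequality at a fixed dilation, whose limit \<open>r \<rightarrow> 1\<close> is the
    claim.\<close>
  have bound: "square_below * mass_above - mass_below * square_above \<le> a * (l (r * a))\<^sup>2 * C + 2 * (l (r * a) - l a) * mass_below * mass_above" if r: "0 < r" "r < 1" for r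
  proof -
    define d where "d = l (r * a) - l a"
    have ra: "0 < r * a" "r * a < a" using r a by auto
    have "square_between r \<le> (\<integral>t. indicator {r * a..a} t * (l (r * a))\<^sup>2 \<partial>lborel)"
      unfolding square_between_def
    proof (rule integral_mono)
      show "integrable lborel (\<lambda>t. if r * a < t \<and> t \<le> a then (l t)\<^sup>2 else 0)"
        by (rule integrable_if_bounded[where B="l (r * a)"]; use ra a l_antimono in auto)
      have "integrable lborel (indicator {r * a..a} :: real \<Rightarrow> real)"
        by (rule integrable_real_indicator) (use ra in \<open>auto simp: emeasure_lborel_Icc_eq\<close>)
      then show "integrable lborel (\<lambda>t. indicator {r * a..a} t * (l (r * a))\<^sup>2)" by simp
      show "(if r * a < t \<and> t \<le> a then (l t)\<^sup>2 else 0) \<le> indicator {r * a..a} t * (l (r * a))\<^sup>2" for t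
        using l_antimono[of "r * a" t] l_nonneg ra by (auto simp: indicator_def intro!: power_mono)
    qed
    also have "\<dots> = (1 - r) * (a * (l (r * a))\<^sup>2)" using ra r by (simp add: algebra_simps)
    finally have E: "square_between r \<le> (1 - r) * (a * (l (r * a))\<^sup>2)" .
    have "(1 - r) * (square_below * mass_above - mass_below * square_above) = ((1 - r) * square_below) * mass_above - mass_below * ((1 - r) * square_above)" by (simp add: algebra_simps)
    also have "\<dots> \<le> (2 * d * mass_below + square_between r) * mass_above - mass_below * (2 * r * d * mass_above - square_between r)"
      using mult_right_mono[OF below_le(2)[OF r] nn(2)] above_le[OF r] nn(1)
        mult_left_mono[of "2 * r * d * mass_above - square_between r" "(1 - r) * square_above" mass_below] unfolding d_def by linarith
    also have "\<dots> = square_between r * C + (1 - r) * (2 * d * mass_below * mass_above)" by (simp add: C algebra_simps)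
    also have "\<dots> \<le> (1 - r) * (a * (l (r * a))\<^sup>2) * C + (1 - r) * (2 * d * mass_below * mass_above)"
      using nn by (intro add_right_mono mult_right_mono E) (auto simp: C)
    also have "\<dots> = (1 - r) * (a * (l (r * a))\<^sup>2 * C + 2 * d * mass_below * mass_above)" by (simp add: algebra_simps)
    finally show ?thesis using r unfolding d_def by (simp add: mult_le_cancel_left_pos)
  qed
  have "((\<lambda>r. r * a) \<longlongrightarrow> 1 * a) (at_left 1)" by (intro tendsto_intros)
  then have "((\<lambda>r. l (r * a)) \<longlongrightarrow> l a) (at_left 1)"
    using isCont_tendsto_compose[OF cont] by simp
  then have "((\<lambda>r. a * (l (r * a))\<^sup>2 * C + 2 * (l (r * a) - l a) * mass_below * mass_above) \<longlongrightarrow> a * (l a)\<^sup>2 * C + 2 * (l a - l a) * mass_below * mass_above) (at_left 1)"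
    by (intro tendsto_intros)
  moreover have "eventually (\<lambda>r::real. 0 < r \<and> r < 1) (at_left 1)"
    using eventually_at_left[of 0 "1::real"] by (auto intro!: exI[of _ 0])
  then have "eventually (\<lambda>r. square_below * mass_above - mass_below * square_above \<le> a * (l (r * a))\<^sup>2 * C + 2 * (l (r * a) - l a) * mass_below * mass_above) (at_left 1)"
    by eventually_elim (rule bound; simp)
  ultimately have "square_below * mass_above - mass_below * square_above \<le> a * (l a)\<^sup>2 * C + 2 * (l a - l a) * mass_below * mass_above"
    by (intro tendsto_lowerbound) auto
  then show ?thesis by (simp add: C_def mult_ac)
qed

lemma straddling_integral:
  "straddling a
    = ennreal (square_below * mass_above - mass_below * square_above)"
proof -
  have j: "integrable lborel (\<lambda>t. if a < t then l t else 0)" "integrable lborel (\<lambda>t. if a < t then (l t)\<^sup>2 else 0)"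
    by (rule integrable_if_bounded[where B="l a"]; use a l_antimono in auto)+
  have i1: "integrable lborel (\<lambda>t. if 0 < t \<and> t < a then l t else 0)"
    by (rule Bochner_Integration.integrable_bound[OF l_integrable]) (use l_nonneg in auto)
  have i2: "integrable lborel (\<lambda>t. if 0 < t \<and> t < a then (l t)\<^sup>2 else 0)"
    by (rule below_le(1)[of "1/2"]) auto
  have inner: "(\<integral>\<^sup>+t. (if a < t then ennreal ((l s - l t) * l s * l t) else 0) \<partial>lborel) = ennreal ((l s)\<^sup>2 * mass_above - l s * square_above)"
    and inner_nn: "0 \<le> (l s)\<^sup>2 * mass_above - l s * square_above"
    if s: "0 < s" "s < a" for s
  proof -
    let ?f = "\<lambda>t. (l s)\<^sup>2 * (if a < t then l t else 0) - l s * (if a < t then (l t)\<^sup>2 else 0)"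
    have eq: "(if a < t then (l s - l t) * l s * l t else 0) = ?f t" for t
      by (simp add: power2_eq_square algebra_simps)
    have nn: "0 \<le> ?f t" for t
      using s l_antimono[of s t] l_nonneg by (auto simp: eq[symmetric])
    have int: "integrable lborel ?f" using j by auto
    have I: "(\<integral>t. ?f t \<partial>lborel) = (l s)\<^sup>2 * mass_above - l s * square_above"
      using j by (simp add: mass_above_def square_above_def)
    have "(\<integral>\<^sup>+t. (if a < t then ennreal ((l s - l t) * l s * l t) else 0) \<partial>lborel) = (\<integral>\<^sup>+t. ennreal (?f t) \<partial>lborel)"
      unfolding eq[symmetric] by (intro nn_integral_cong) auto
    also have "\<dots> = ennreal (\<integral>t. ?f t \<partial>lborel)"
      using int nn by (intro nn_integral_eq_integral) auto
    finally show "(\<integral>\<^sup>+t. (if a < t then ennreal ((l s - l t) * l s * l t) else 0) \<partial>lborel) = ennreal ((l s)\<^sup>2 * mass_above - l s * square_above)"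
      by (simp only: I)
    show "0 \<le> (l s)\<^sup>2 * mass_above - l s * square_above" unfolding I[symmetric] using nn by (intro integral_nonneg_AE) auto
  qed
  let ?g = "\<lambda>s. (if 0 < s \<and> s < a then (l s)\<^sup>2 else 0) * mass_above - (if 0 < s \<and> s < a then l s else 0) * square_above"
  have "straddling a = (\<integral>\<^sup>+s. ennreal (?g s) \<partial>lborel)"
    unfolding straddling_def using inner by (intro nn_integral_cong) auto
  also have "\<dots> = ennreal (\<integral>s. ?g s \<partial>lborel)"
    using i1 i2 inner_nn by (intro nn_integral_eq_integral) auto
  also have "(\<integral>s. ?g s \<partial>lborel) = square_below * mass_above - mass_below * square_above"
    using i1 i2 by (simp add: square_below_def mass_below_def)
  finally show ?thesis .
qed

end

text \<open>
  The bound is sharp: it is an equality when \<open>l\<close> is linear in \<open>ln t\<close> until it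
  reaches 0.
\<close>

lemma straddling_bound:
  assumes "0 < a" "isCont l a"
  shows "straddling a
    \<le> ennreal ((\<integral>t. (if 0 < t then l t else 0) \<partial>lborel) * (a * (l a)\<^sup>2))"
proof (cases "0 < l a")
  case True
  show ?thesis
    unfolding straddling_integral[OF assms(1) True]
    by (intro ennreal_leI moment_product_le assms True)
next
  case False
  have "l t = 0" if "a < t" for t
    using that assms l_antimono[of a t] l_nonneg[of t] False by auto
  then have "straddling a = (\<integral>\<^sup>+s. 0 \<partial>(lborel::real measure))"
    unfolding straddling_def by (intro nn_integral_cong) (auto intro!: nn_integral_zero' AE_I2)
  then show ?thesis by simp
qed

end

section \<open>Slices of an integrable function\<close>

text \<open>
  The variance as an integral over pairs; the diagonal contributes nothing, so half of all pairs suffice.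
\<close>

lemma variance_ordered_pairs:
  fixes f :: "real \<Rightarrow> real"
  assumes "finite_measure M" and sets_M [measurable_cong]: "sets M = sets borel"
    and f: "integrable M f" and f2: "integrable M (\<lambda>t. (f t)\<^sup>2)" and mean: "(\<integral>t. f t \<partial>M) = 0"
  shows "emeasure M (space M) * (\<integral>\<^sup>+t. ennreal ((f t)\<^sup>2) \<partial>M) =
    (\<integral>\<^sup>+s. \<integral>\<^sup>+t. (if s < t then ennreal ((f s - f t)\<^sup>2) else 0) \<partial>M \<partial>M)" (is "_ = ?Y")
proof -
  interpret finite_measure M by fact
  interpret MM: pair_sigma_finite M M ..
  have [measurable]: "f \<in> borel_measurable M" using f by auto
  then have [measurable]: "f \<in> borel_measurable borel" by (simp add: measurable_cong_sets[OF sets_M])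
  define V where "V = (\<integral>t. (f t)\<^sup>2 \<partial>M)"
  define m where "m = measure M (space M)"
  have V: "(\<integral>\<^sup>+t. ennreal ((f t)\<^sup>2) \<partial>M) = ennreal V" "0 \<le> V"
    unfolding V_def using f2 by (auto intro!: nn_integral_eq_integral)
  have m: "emeasure M (space M) = ennreal m" "0 \<le> m" unfolding m_def by (auto simp: emeasure_eq_measure)
  have "(\<integral>\<^sup>+t. ennreal ((f s - f t)\<^sup>2) \<partial>M) = ennreal ((f s)\<^sup>2) * ennreal m + ennreal V" for s
  proof -
    have eq: "(f s - f t)\<^sup>2 = (f s)\<^sup>2 - 2 * f s * f t + (f t)\<^sup>2" for t by (simp add: power2_diff)
    have int: "integrable M (\<lambda>t. (f s - f t)\<^sup>2)" unfolding eq using f f2 by auto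
    then have "(\<integral>\<^sup>+t. ennreal ((f s - f t)\<^sup>2) \<partial>M) = ennreal (\<integral>t. (f s - f t)\<^sup>2 \<partial>M)"
      by (rule nn_integral_eq_integral) auto
    also have "(\<integral>t. (f s - f t)\<^sup>2 \<partial>M) = (f s)\<^sup>2 * m + V"
      unfolding eq using f f2 mean by (simp add: V_def m_def)
    finally show ?thesis using V m by (simp add: ennreal_mult)
  qed
  then have "(\<integral>\<^sup>+s. \<integral>\<^sup>+t. ennreal ((f s - f t)\<^sup>2) \<partial>M \<partial>M) = (\<integral>\<^sup>+s. ennreal ((f s)\<^sup>2) * ennreal m + ennreal V \<partial>M)"
    by simp
  also have "\<dots> = ennreal V * ennreal m + ennreal V * ennreal m"
    by (subst nn_integral_add) (auto simp: nn_integral_multc V m)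
  finally have all: "(\<integral>\<^sup>+s. \<integral>\<^sup>+t. ennreal ((f s - f t)\<^sup>2) \<partial>M \<partial>M) = 2 * (ennreal m * ennreal V)"
    by (simp add: mult_2 mult.commute)
  have "(\<integral>\<^sup>+s. \<integral>\<^sup>+t. ennreal ((f s - f t)\<^sup>2) \<partial>M \<partial>M) =
    (\<integral>\<^sup>+s. (\<integral>\<^sup>+t. (if s < t then ennreal ((f s - f t)\<^sup>2) else 0) \<partial>M) + (\<integral>\<^sup>+t. (if t < s then ennreal ((f s - f t)\<^sup>2) else 0) \<partial>M) \<partial>M)"
    by (intro nn_integral_cong, subst nn_integral_add[symmetric]) (auto intro!: nn_integral_cong)
  also have "\<dots> = ?Y + (\<integral>\<^sup>+s. \<integral>\<^sup>+t. (if t < s then ennreal ((f s - f t)\<^sup>2) else 0) \<partial>M \<partial>M)"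
    by (subst nn_integral_add) auto
  also have "(\<integral>\<^sup>+s. \<integral>\<^sup>+t. (if t < s then ennreal ((f s - f t)\<^sup>2) else 0) \<partial>M \<partial>M) =
    (\<integral>\<^sup>+t. \<integral>\<^sup>+s. (if t < s then ennreal ((f s - f t)\<^sup>2) else 0) \<partial>M \<partial>M)"
    by (rule MM.Fubini') measurable
  also have "\<dots> = ?Y"
    by (intro nn_integral_cong if_cong refl arg_cong[where f=ennreal] power2_commute)
  finally have "2 * (ennreal m * ennreal V) = 2 * ?Y" unfolding all by (simp add: mult_2)
  then have "ennreal m * ennreal V = ?Y" by (simp add: ennreal_mult_cancel_left)
  then show ?thesis by (simp add: V m)
qed

lemma emeasure_superlevel_finite:
  assumes int: "integrable M h" and nonneg: "\<And>x. 0 \<le> h x" and t: "0 < (t::real)"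
  shows "emeasure M {x \<in> space M. t < h x} < \<infinity>"
proof -
  have [measurable]: "h \<in> borel_measurable M" using int by auto
  have "emeasure M {x \<in> space M. t < h x} = (\<integral>\<^sup>+x. indicator {x \<in> space M. t < h x} x \<partial>M)"
    by simp
  also have "\<dots> \<le> (\<integral>\<^sup>+x. ennreal (1 / t) * ennreal (h x) \<partial>M)"
    using t by (intro nn_integral_mono) (auto simp: indicator_def ennreal_mult[symmetric] nonneg)
  also have "\<dots> = ennreal (1 / t) * ennreal (\<integral>x. h x \<partial>M)"
    using int nonneg by (simp add: nn_integral_cmult nn_integral_eq_integral)
  also have "\<dots> < \<infinity>" by (simp add: ennreal_mult_less_top)
  finally show ?thesis .
qed

text \<open>
  The setting of slice sampling with base measure \<open>\<nu>\<close>: the target has \<open>\<nu>\<close>-density proportional to \<open>h\<close>. The last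
  assumption is the log-concavity of the tail; \<open>no_ties\<close> makes the tail continuous.
\<close>

locale slice_space = sigma_finite_measure \<nu> for \<nu> :: "'a measure" +
  fixes h :: "'a \<Rightarrow> real"
  assumes h_measurable [measurable]: "h \<in> borel_measurable \<nu>"
    and h_nonneg: "\<And>x. 0 \<le> h x"
    and h_integrable: "integrable \<nu> h"
    and h_mass: "0 < (\<integral>x. h x \<partial>\<nu>)"
    and no_ties: "\<And>t. 0 < t \<Longrightarrow> emeasure \<nu> {x \<in> space \<nu>. h x = t} = 0"
    and level_increment: "\<And>r s t. 0 < r \<Longrightarrow> r < 1 \<Longrightarrow> 0 < s \<Longrightarrow> s \<le> t \<Longrightarrow>
      0 < measure \<nu> {x \<in> space \<nu>. t < h x} \<Longrightarrow>
      measure \<nu> {x \<in> space \<nu>. r * s < h x} - measure \<nu> {x \<in> space \<nu>. s < h x} \<le>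
      measure \<nu> {x \<in> space \<nu>. r * t < h x} - measure \<nu> {x \<in> space \<nu>. t < h x}"
begin

definition level :: "real \<Rightarrow> real" where
  "level t = measure \<nu> {x \<in> space \<nu>. t < h x}"

interpretation L: pair_sigma_finite \<nu> "lborel :: real measure" ..

lemma level_nonneg: "0 \<le> level t"
  by (simp add: level_def)

lemma emeasure_level_finite:
  assumes "0 < t" shows "emeasure \<nu> {x \<in> space \<nu>. t < h x} < \<infinity>"
  using h_integrable h_nonneg assms by (rule emeasure_superlevel_finite)

lemma emeasure_level:
  assumes "0 < t" shows "emeasure \<nu> {x \<in> space \<nu>. t < h x} = ennreal (level t)"
  unfolding level_def using emeasure_level_finite[OF assms] by (intro emeasure_eq_ennreal_measure) auto

lemma level_measurable [measurable]: "level \<in> borel_measurable borel"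
proof -
  have "{p \<in> space (borel \<Otimes>\<^sub>M \<nu>). fst p < h (snd p)} \<in> sets (borel \<Otimes>\<^sub>M \<nu>)"
    by measurable
  from measurable_emeasure_Pair[OF this]
  have "(\<lambda>t::real. emeasure \<nu> (Pair t -` {p \<in> space (borel \<Otimes>\<^sub>M \<nu>). fst p < h (snd p)})) \<in> borel_measurable borel" .
  also have "(\<lambda>t::real. Pair t -` {p \<in> space (borel \<Otimes>\<^sub>M \<nu>). fst p < h (snd p)}) = (\<lambda>t. {x \<in> space \<nu>. t < h x})"
    by (auto simp: space_pair_measure)
  finally show ?thesis
    unfolding level_def measure_def by measurable
qed

lemma level_antimono:
  assumes "0 < s" "s \<le> t" shows "level t \<le> level s"
proof -
  have "ennreal (level t) \<le> ennreal (level s)"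
    using assms emeasure_level[of s] emeasure_level[of t] by (auto intro!: emeasure_mono simp del: ennreal_le_iff simp flip: emeasure_level)
  then show ?thesis by (simp add: level_nonneg)
qed

lemma tonelli_slices:
  assumes [measurable]: "f \<in> borel_measurable \<nu>"
  shows "(\<integral>\<^sup>+t. (if 0 < t then \<integral>\<^sup>+x. (if t < h x then f x else 0) \<partial>\<nu> else 0) \<partial>lborel) = (\<integral>\<^sup>+x. f x * ennreal (h x) \<partial>\<nu>)"
proof -
  have "(\<integral>\<^sup>+t. (if 0 < t then \<integral>\<^sup>+x. (if t < h x then f x else 0) \<partial>\<nu> else 0) \<partial>lborel) =
    (\<integral>\<^sup>+t. \<integral>\<^sup>+x. (if 0 < t \<and> t < h x then f x else 0) \<partial>\<nu> \<partial>lborel)"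
    by (intro nn_integral_cong) auto
  also have "\<dots> = (\<integral>\<^sup>+x. \<integral>\<^sup>+t. (if 0 < t \<and> t < h x then f x else 0) \<partial>lborel \<partial>\<nu>)"
    by (rule L.Fubini') measurable
  also have "\<dots> = (\<integral>\<^sup>+x. f x * ennreal (h x) \<partial>\<nu>)"
  proof (intro nn_integral_cong)
    fix x
    have "(\<integral>\<^sup>+t. (if 0 < t \<and> t < h x then f x else 0) \<partial>lborel) = (\<integral>\<^sup>+t. f x * indicator {0<..<h x} t \<partial>lborel)"
      by (intro nn_integral_cong) (auto simp: indicator_def)
    also have "\<dots> = f x * ennreal (h x)" by (simp add: nn_integral_cmult h_nonneg)
    finally show "(\<integral>\<^sup>+t. (if 0 < t \<and> t < h x then f x else 0) \<partial>lborel) = f x * ennreal (h x)" .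
  qed
  finally show ?thesis .
qed

lemma tonelli_levels:
  assumes [measurable]: "f \<in> borel_measurable borel"
  shows "(\<integral>\<^sup>+x. \<integral>\<^sup>+t. (if 0 < t \<and> t < h x then f t else 0) \<partial>lborel \<partial>\<nu>) = (\<integral>\<^sup>+t. (if 0 < t then f t * ennreal (level t) else 0) \<partial>lborel)"
proof -
  let ?f = "\<lambda>x t. if 0 < t \<and> t < h x then f t else 0"
  have "(\<integral>\<^sup>+x. \<integral>\<^sup>+t. ?f x t \<partial>lborel \<partial>\<nu>) = (\<integral>\<^sup>+t. \<integral>\<^sup>+x. ?f x t \<partial>\<nu> \<partial>lborel)"
    by (rule L.Fubini'[symmetric]) measurable
  also have "\<dots> = (\<integral>\<^sup>+t. (if 0 < t then f t * ennreal (level t) else 0) \<partial>lborel)"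
  proof (intro nn_integral_cong)
    fix t :: real
    have "(\<integral>\<^sup>+x. ?f x t \<partial>\<nu>) = (if 0 < t then \<integral>\<^sup>+x. f t * indicator {x \<in> space \<nu>. t < h x} x \<partial>\<nu> else 0)"
      by (auto intro!: nn_integral_cong simp: indicator_def)
    also have "\<dots> = (if 0 < t then f t * ennreal (level t) else 0)"
      by (auto simp: nn_integral_cmult emeasure_level)
    finally show "(\<integral>\<^sup>+x. ?f x t \<partial>\<nu>) = (if 0 < t then f t * ennreal (level t) else 0)" .
  qed
  finally show ?thesis .
qed

lemma level_integrable: "integrable lborel (\<lambda>t. if 0 < t then level t else 0)"
  and level_integral: "(\<integral>t. (if 0 < t then level t else 0) \<partial>lborel) = (\<integral>x. h x \<partial>\<nu>)"
proof -
  have "(\<integral>\<^sup>+t. ennreal (if 0 < t then level t else 0) \<partial>lborel) = (\<integral>\<^sup>+t. (if 0 < t then 1 * ennreal (level t) else 0) \<partial>lborel)"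
    by (intro nn_integral_cong) auto
  also have "\<dots> = (\<integral>\<^sup>+x. \<integral>\<^sup>+t. (if 0 < t \<and> t < h x then 1 else 0) \<partial>lborel \<partial>\<nu>)"
    by (rule tonelli_levels[symmetric]) auto
  also have "\<dots> = (\<integral>\<^sup>+x. \<integral>\<^sup>+t. indicator {0<..<h x} t \<partial>lborel \<partial>\<nu>)"
    by (intro nn_integral_cong) (auto simp: indicator_def)
  also have "\<dots> = (\<integral>\<^sup>+x. ennreal (h x) \<partial>\<nu>)"
    by (simp add: h_nonneg)
  also have "\<dots> = ennreal (\<integral>x. h x \<partial>\<nu>)"
    using h_integrable h_nonneg by (simp add: nn_integral_eq_integral)
  finally have eq: "(\<integral>\<^sup>+t. ennreal (if 0 < t then level t else 0) \<partial>lborel) = ennreal (\<integral>x. h x \<partial>\<nu>)" .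
  show int: "integrable lborel (\<lambda>t. if 0 < t then level t else 0)"
    using eq by (intro integrableI_nonneg) (auto simp: level_nonneg)
  show "(\<integral>t. (if 0 < t then level t else 0) \<partial>lborel) = (\<integral>x. h x \<partial>\<nu>)"
    using eq h_mass by (subst integral_eq_nn_integral) (auto simp: level_nonneg)
qed

definition slab :: "real \<Rightarrow> 'a measure" where
  "slab s = density \<nu> (\<lambda>x. ennreal (if s < h x then 1 else 0))"

lemma sets_slab [measurable_cong, simp]: "sets (slab s) = sets \<nu>"
  and space_slab [simp]: "space (slab s) = space \<nu>"
  by (simp_all add: slab_def)

lemma nn_integral_slab:
  assumes [measurable]: "f \<in> borel_measurable \<nu>"
  shows "(\<integral>\<^sup>+x. f x \<partial>slab s) = (\<integral>\<^sup>+x. (if s < h x then f x else 0) \<partial>\<nu>)"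
  unfolding slab_def by (subst nn_integral_density) (auto intro!: nn_integral_cong)

lemma integral_slab:
  fixes f :: "'a \<Rightarrow> real"
  assumes [measurable]: "f \<in> borel_measurable \<nu>"
  shows "(\<integral>x. f x \<partial>slab s) = (\<integral>x. (if s < h x then f x else 0) \<partial>\<nu>)"
  unfolding slab_def by (subst integral_density) (auto intro!: Bochner_Integration.integral_cong)

lemma emeasure_slab:
  assumes "0 < s" and [measurable]: "Measurable.pred \<nu> P"
  shows "emeasure (slab s) {x \<in> space \<nu>. P x} = emeasure \<nu> {x \<in> space \<nu>. s < h x \<and> P x}"
proof -
  have "emeasure (slab s) {x \<in> space \<nu>. P x} = (\<integral>\<^sup>+x. indicator {x \<in> space \<nu>. s < h x \<and> P x} x \<partial>\<nu>)"
    unfolding slab_def by (subst emeasure_density, simp, simp, intro nn_integral_cong) (auto simp: indicator_def)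
  also have "\<dots> = emeasure \<nu> {x \<in> space \<nu>. s < h x \<and> P x}"
    by (rule nn_integral_indicator) measurable
  finally show ?thesis .
qed

lemma finite_measure_slab:
  assumes "0 < s" shows "finite_measure (slab s)"
  using emeasure_slab[OF assms, of "\<lambda>_. True"] emeasure_level_finite[OF assms]
  by (intro finite_measureI) auto

text \<open>
  Above \<open>s\<close> the tail is a constant minus the distribution function of \<open>h\<close>, and a distribution function is
  continuous where there is no atom.
\<close>

lemma isCont_level:
  assumes "0 < t" shows "isCont level t"
proof -
  define s where "s = t / 2"
  have s: "0 < s" "s < t" using assms by (auto simp: s_def)
  define M where "M = distr (slab s) borel h"
  interpret S: finite_measure "slab s" by (rule finite_measure_slab[OF s(1)])
  interpret M: finite_measure M unfolding M_def by (rule S.finite_measure_distr) auto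
  interpret M: finite_borel_measure M by standard (simp add: M_def)
  have "emeasure M {t} = emeasure (slab s) {x \<in> space \<nu>. h x = t}"
    unfolding M_def by (subst emeasure_distr) (auto intro!: arg_cong[where f="emeasure (slab s)"])
  also have "\<dots> \<le> emeasure \<nu> {x \<in> space \<nu>. h x = t}"
    using emeasure_slab[OF s(1), of "\<lambda>x. h x = t"] by (auto intro!: emeasure_mono)
  finally have "emeasure M {t} = 0" using no_ties[OF assms] by simp
  then have "isCont (cdf M) t" unfolding M.isCont_cdf by (simp add: measure_def)
  then have c: "isCont (\<lambda>z. level s - cdf M z) t" by (intro continuous_intros)
  have eq: "level z = level s - cdf M z" if "s < z" for z
  proof -
    have "emeasure M {..z} = emeasure (slab s) {x \<in> space \<nu>. h x \<le> z}"
      unfolding M_def by (subst emeasure_distr) (auto intro!: arg_cong[where f="emeasure (slab s)"])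
    also have "\<dots> = emeasure \<nu> {x \<in> space \<nu>. s < h x \<and> h x \<le> z}"
      by (rule emeasure_slab[OF s(1)]) auto
    finally have "emeasure M {..z} + ennreal (level z) = emeasure \<nu> {x \<in> space \<nu>. s < h x \<and> h x \<le> z} + emeasure \<nu> {x \<in> space \<nu>. z < h x}"
      using that s by (simp add: emeasure_level)
    also have "\<dots> = emeasure \<nu> ({x \<in> space \<nu>. s < h x \<and> h x \<le> z} \<union> {x \<in> space \<nu>. z < h x})"
      by (rule plus_emeasure) auto
    also have "{x \<in> space \<nu>. s < h x \<and> h x \<le> z} \<union> {x \<in> space \<nu>. z < h x} = {x \<in> space \<nu>. s < h x}"
      using that by auto
    finally have "ennreal (cdf M z + level z) = ennreal (level s)"
      using s by (simp add: emeasure_level cdf_def M.emeasure_eq_measure level_nonneg)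
    then have "cdf M z + level z = level s"
      by (subst (asm) ennreal_inj) (auto simp: level_nonneg cdf_def)
    then show ?thesis by simp
  qed
  have "eventually (\<lambda>z. level z = level s - cdf M z) (nhds t)"
    using eventually_nhds_in_open[of "{s<..}" t] s by (auto elim!: eventually_mono intro: eq)
  then show ?thesis using c by (simp add: isCont_cong)
qed

sublocale log_concave_tail level
proof
  show "level (r * s) - level s \<le> level (r * t) - level t"
    if "0 < r" "r < 1" "0 < s" "s \<le> t" "0 < level t" for r s t
    using level_increment[of r s t] that by (simp add: level_def)
qed (auto intro: level_nonneg level_antimono level_integrable)

lemma level_tendsto_0: "\<exists>t>s. level t < z" if "0 < z" "0 < s"
proof -
  define C where "C = (\<integral>x. h x \<partial>\<nu>)"
  define t where "t = max (s + 1) (C / z + 1)"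
  have "C / z < t" by (simp add: t_def)
  then have t: "0 < t" "s < t" "C < t * z"
    using that by (auto simp: pos_divide_less_eq) (auto simp: t_def)
  have "t * level t = (\<integral>u. indicator {0<..<t} u * level t \<partial>lborel)" using t by simp
  also have "\<dots> \<le> (\<integral>u. (if 0 < u then level u else 0) \<partial>lborel)"
  proof (rule integral_mono)
    have "integrable lborel (indicator {0<..<t} :: real \<Rightarrow> real)"
      by (rule integrable_real_indicator) (use t in auto)
    then show "integrable lborel (\<lambda>u. indicator {0<..<t} u * level t)" by simp
    show "integrable lborel (\<lambda>u. if 0 < u then level u else 0)" by (rule level_integrable)
    show "indicator {0<..<t} u * level t \<le> (if 0 < u then level u else 0)" for u
      using level_antimono[of u t] level_nonneg by (auto simp: indicator_def)
  qed
  also have "\<dots> = C" by (simp add: level_integral C_def)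
  also have "\<dots> < t * z" by fact
  finally show ?thesis using t by (intro exI[of _ t]) (simp add: mult_less_cancel_left_pos)
qed

text \<open>
  The probability integral transform: a continuous tail evaluated at the function itself is uniformly distributed.
  It holds even where \<open>level\<close> is locally constant, because for \<open>level t = z\<close> the set \<open>{h > t}\<close>
  lies between \<open>{level \<circ> h < z}\<close> and \<open>{level \<circ> h \<le> z}\<close>.
\<close>

lemma uniform_rank_slab:
  assumes s: "0 < s" "0 < level s"
  shows "uniform_rank (slab s) (\<lambda>x. level (h x)) (level s)"
proof -
  interpret S: finite_measure "slab s" by (rule finite_measure_slab[OF s(1)])
  define M where "M = distr (slab s) borel (\<lambda>x. level (h x))"
  define b where "b = level s"
  have b: "0 < b" using s by (simp add: b_def)
  define U where "U = density lborel (\<lambda>z::real. indicator {0<..<b} z :: ennreal)"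
  let ?low = "\<lambda>z. {x \<in> space \<nu>. s < h x \<and> level (h x) < z}"
  let ?lowe = "\<lambda>z. {x \<in> space \<nu>. s < h x \<and> level (h x) \<le> z}"
  have em: "emeasure (slab s) {x \<in> space \<nu>. P x} = emeasure \<nu> {x \<in> space \<nu>. s < h x \<and> P x}" if [measurable]: "Measurable.pred \<nu> P" for P
    by (rule emeasure_slab[OF s(1) that])
  have M: "emeasure M {..z} = emeasure \<nu> (?lowe z)" for z
  proof -
    have "emeasure M {..z} = emeasure (slab s) {x \<in> space \<nu>. level (h x) \<le> z}"
      unfolding M_def by (subst emeasure_distr) (auto intro!: arg_cong[where f="emeasure (slab s)"])
    then show ?thesis by (simp add: em)
  qed
  \<comment> \<open>Any \<open>t\<close> with \<open>level t = z\<close>, found by the intermediate value theorem,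
    separates the two sets.\<close>
  have sand: "emeasure \<nu> (?low z) \<le> ennreal z"
    "ennreal z \<le> emeasure \<nu> (?lowe z)" if z: "0 < z" "z < b" for z
  proof -
    obtain T where T: "s < T" "level T < z" using level_tendsto_0[OF z(1) s(1)] by blast
    have "\<exists>t\<ge>s. t \<le> T \<and> level t = z"
      using T z s by (intro IVT2) (auto simp: b_def intro!: isCont_level)
    then obtain t where t: "s \<le> t" "level t = z" by blast
    have "(?low z) \<subseteq> {x \<in> space \<nu>. t < h x}"
      using level_antimono[of _ t] t s by (auto intro!: leI dest: leD) (metis leD leI less_trans)
    moreover have "{x \<in> space \<nu>. t < h x} \<subseteq> (?lowe z)"
      using level_antimono t s by auto
    moreover have "emeasure \<nu> {x \<in> space \<nu>. t < h x} = ennreal z"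
      using t s by (simp add: emeasure_level)
    ultimately show "emeasure \<nu> (?low z) \<le> ennreal z"
      "ennreal z \<le> emeasure \<nu> (?lowe z)"
      using emeasure_mono[of "(?low z)" "{x \<in> space \<nu>. t < h x}" \<nu>]
        emeasure_mono[of "{x \<in> space \<nu>. t < h x}" "(?lowe z)" \<nu>] by auto
  qed
  have U: "emeasure U {..z} = emeasure lborel ({0<..<b} \<inter> {..z})" for z
  proof -
    have "emeasure U {..z} = (\<integral>\<^sup>+x. indicator ({0<..<b} \<inter> {..z}) x \<partial>lborel)"
      unfolding U_def by (subst emeasure_density, simp, simp, intro nn_integral_cong) (auto simp: indicator_def)
    also have "\<dots> = emeasure lborel ({0<..<b} \<inter> {..z})"
      by (rule nn_integral_indicator) measurable
    finally show ?thesis .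
  qed
  have MU: "emeasure M {..z} = emeasure U {..z}" for z
  proof -
    consider "z < 0" | "z = 0" | "0 < z" "z < b" | "b \<le> z" by linarith
    then show ?thesis
    proof cases
      case 1
      then have "(?lowe z) = {}" "{0<..<b} \<inter> {..z} = {}"
        using level_nonneg by (auto simp: not_le intro: less_le_trans)
      then show ?thesis by (simp only: M U) simp
    next
      case 2
      have le: "emeasure M {..z} \<le> ennreal e" if "0 < e" for e
      proof -
        have "emeasure M {..z} \<le> emeasure \<nu> (?low (min e (b / 2)))"
          unfolding M using 2 that b by (intro emeasure_mono) auto
        also have "\<dots> \<le> ennreal (min e (b / 2))"
          using that b by (intro sand) auto
        also have "\<dots> \<le> ennreal e" by (intro ennreal_leI) auto
        finally show ?thesis .
      qed
      have "emeasure M {..z} \<le> 0"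
        by (rule ennreal_le_epsilon) (simp add: le)
      moreover have "{0<..<b} \<inter> {..z} = {}" using 2 by auto
      ultimately show ?thesis by (simp add: U)
    next
      case 3
      have "emeasure M {..z} \<le> ennreal z"
      proof (rule ennreal_le_epsilon)
        fix e :: real assume e: "0 < e"
        have "emeasure M {..z} \<le> emeasure \<nu> (?low (min (z + e) ((z + b) / 2)))"
          unfolding M using 3 e by (intro emeasure_mono) auto
        also have "\<dots> \<le> ennreal (min (z + e) ((z + b) / 2))"
          using 3 e by (intro sand) (auto simp: min_less_iff_disj)
        also have "\<dots> \<le> ennreal (z + e)" by (intro ennreal_leI) auto
        also have "\<dots> = ennreal z + ennreal e" using 3 e by simp
        finally show "emeasure M {..z} \<le> ennreal z + ennreal e" .
      qed
      moreover have "ennreal z \<le> emeasure M {..z}" unfolding M by (rule sand(2)[OF 3])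
      moreover have "{0<..<b} \<inter> {..z} = {0<..z}" using 3 by auto
      ultimately show ?thesis using 3 by (simp add: U)
    next
      case 4
      have "(?lowe z) = {x \<in> space \<nu>. s < h x}"
        using 4 level_antimono[OF s(1)] by (auto simp: b_def) (meson less_imp_le order_trans)
      moreover have "{0<..<b} \<inter> {..z} = {0<..<b}" using 4 by auto
      ultimately show ?thesis using s b by (simp add: M U emeasure_level b_def)
    qed
  qed
  have "finite_measure M" unfolding M_def by (rule S.finite_measure_distr) auto
  then have fM: "finite_borel_measure M"
    by (intro finite_borel_measure.intro finite_borel_measure_axioms.intro) (auto simp: M_def)
  have "finite_measure U"
    unfolding U_def using b by (intro finite_measureI) (auto simp: emeasure_density)
  then have fU: "finite_borel_measure U"
    by (intro finite_borel_measure.intro finite_borel_measure_axioms.intro) (auto simp: U_def)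
  have "M = U"
    by (rule cdf_unique'[OF fM fU]) (auto simp: cdf_def measure_def MU fun_eq_iff)
  then show ?thesis
    by (intro uniform_rank.intro uniform_rank_axioms.intro S.finite_measure_axioms)
      (use b in \<open>auto simp: M_def U_def b_def\<close>)
qed

end

section \<open>Contraction of the two half-steps\<close>

context slice_space begin

interpretation L: pair_sigma_finite \<nu> "lborel :: real measure" ..

text \<open>
  This is \<open>U\<^sub>X g\<close>.
\<close>

definition slice_mean :: "('a \<Rightarrow> real) \<Rightarrow> real \<Rightarrow> real" where
  "slice_mean g t = (\<integral>x. (if t < h x then g x else 0) \<partial>\<nu>) / level t"

text \<open>
  This is \<open>U\<^sub>T f\<close>.
\<close>

definition height_mean :: "(real \<Rightarrow> real) \<Rightarrow> 'a \<Rightarrow> real" where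
  "height_mean f x = (\<integral>t. (if 0 < t \<and> t < h x then f t else 0) \<partial>lborel) / h x"

text \<open>
  The mean over the points of rank below \<open>v\<close>. It agrees with \<open>slice_mean g t\<close> at \<open>v = level t\<close>. The constraint
  \<open>0 < h x\<close> matters where \<open>\<nu>{h > 0}\<close> is infinite, since then \<open>level 0 = 0\<close>.
\<close>

definition rank_mean :: "('a \<Rightarrow> real) \<Rightarrow> real \<Rightarrow> real" where
  "rank_mean g v = (\<integral>x. (if 0 < h x \<and> level (h x) < v then g x else 0) \<partial>\<nu>) / v"

definition deviation :: "('a \<Rightarrow> real) \<Rightarrow> 'a \<Rightarrow> real" where
  "deviation g x = g x - rank_mean g (level (h x))"

lemma measurable_slice_mean [measurable]:
  assumes [measurable]: "g \<in> borel_measurable \<nu>"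
  shows "slice_mean g \<in> borel_measurable borel"
  unfolding slice_mean_def by measurable

lemma measurable_height_mean [measurable]:
  assumes [measurable]: "f \<in> borel_measurable borel"
  shows "height_mean f \<in> borel_measurable \<nu>"
  unfolding height_mean_def by measurable

lemma measurable_rank_mean [measurable]:
  assumes [measurable]: "g \<in> borel_measurable \<nu>"
  shows "rank_mean g \<in> borel_measurable borel"
  unfolding rank_mean_def by measurable

lemma measurable_deviation [measurable]:
  assumes [measurable]: "g \<in> borel_measurable \<nu>"
  shows "deviation g \<in> borel_measurable \<nu>"
  unfolding deviation_def by measurable

lemma avg_slab:
  assumes s: "0 < s" "0 < level s" and v: "v \<le> level s" and [measurable]: "g \<in> borel_measurable \<nu>"
  shows "uniform_rank.avg (slab s) (\<lambda>x. level (h x)) g v = rank_mean g v"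
proof -
  interpret R: uniform_rank "slab s" "\<lambda>x. level (h x)" "level s" by (rule uniform_rank_slab[OF s])
  have iff: "s < h x \<and> level (h x) < v \<longleftrightarrow> 0 < h x \<and> level (h x) < v" for x
  proof -
    have "s < h x" if "0 < h x" "level (h x) < v"
    proof (rule ccontr)
      assume "\<not> s < h x"
      then show False using level_antimono[of "h x" s] that v by auto
    qed
    then show ?thesis using s by auto
  qed
  have "R.cumul g v = (\<integral>x. (if s < h x then if level (h x) < v then g x else 0 else 0) \<partial>\<nu>)"
    unfolding R.cumul_def by (rule integral_slab) measurable
  also have "\<dots> = (\<integral>x. (if 0 < h x \<and> level (h x) < v then g x else 0) \<partial>\<nu>)"
    using iff by (intro Bochner_Integration.integral_cong) auto
  finally show ?thesis by (simp add: R.avg_def rank_mean_def)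
qed

lemma slice_mean_eq_rank_mean:
  assumes s: "0 < s" "0 < level s" and [measurable]: "g \<in> borel_measurable \<nu>"
  shows "slice_mean g s = rank_mean g (level s)"
proof -
  interpret R: uniform_rank "slab s" "\<lambda>x. level (h x)" "level s" by (rule uniform_rank_slab[OF s])
  have "rank_mean g (level s) = R.avg g (level s)"
    using s by (intro avg_slab[symmetric]) auto
  then show ?thesis
    by (simp add: R.avg_def R.cumul_top integral_slab slice_mean_def)
qed

lemma integrable_slab_square:
  assumes s: "0 < s" and [measurable]: "g \<in> borel_measurable \<nu>" and g2: "integrable \<nu> (\<lambda>x. (g x)\<^sup>2 * h x)"
  shows "integrable (slab s) (\<lambda>x. (g x)\<^sup>2)"
proof -
  have "integrable \<nu> (\<lambda>x. (if s < h x then 1 else 0) *\<^sub>R (g x)\<^sup>2)"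
  proof (rule Bochner_Integration.integrable_bound)
    show "integrable \<nu> (\<lambda>x. 1 / s * ((g x)\<^sup>2 * h x))" using g2 by (rule integrable_mult_right)
    show "AE x in \<nu>. norm ((if s < h x then 1 else 0) *\<^sub>R (g x)\<^sup>2) \<le> norm (1 / s * ((g x)\<^sup>2 * h x))"
      using s by (intro AE_I2) (auto simp: abs_mult field_simps intro!: mult_right_mono)
  qed measurable
  then show ?thesis
    unfolding slab_def by (subst integrable_density) auto
qed

lemma null_level:
  assumes t: "0 < t" "level t = 0"
  shows "AE x in \<nu>. \<not> t < h x"
  using emeasure_level[OF t(1)] t by (subst AE_iff_measurable[OF _ refl]) auto

text \<open>
  The energy inequality for the rank \<open>level \<circ> h\<close> on the single slice \<open>{h > t}\<close>.
\<close>

lemma slice_energy: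
  assumes t: "0 < t" and [measurable]: "g \<in> borel_measurable \<nu>" and g2: "integrable \<nu> (\<lambda>x. (g x)\<^sup>2 * h x)"
  shows "(\<integral>\<^sup>+x. (if t < h x then ennreal ((deviation g x)\<^sup>2) else 0) \<partial>\<nu>) + ennreal ((slice_mean g t)\<^sup>2) * ennreal (level t)
    \<le> (\<integral>\<^sup>+x. (if t < h x then ennreal ((g x)\<^sup>2) else 0) \<partial>\<nu>)"
proof (cases "0 < level t")
  case True
  interpret R: uniform_rank "slab t" "\<lambda>x. level (h x)" "level t" by (rule uniform_rank_slab[OF t True])
  have [measurable]: "g \<in> borel_measurable (slab t)" by simp
  have "R.avg g (level (h x)) = rank_mean g (level (h x))" if "t < h x" for x
    using level_antimono[of t "h x"] that t True by (intro avg_slab) auto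
  then have "(\<integral>\<^sup>+x. ennreal ((g x - R.avg g (level (h x)))\<^sup>2) \<partial>slab t) = (\<integral>\<^sup>+x. (if t < h x then ennreal ((deviation g x)\<^sup>2) else 0) \<partial>\<nu>)"
    by (subst nn_integral_slab) (auto intro!: nn_integral_cong simp: deviation_def)
  moreover have "ennreal (level t * (R.avg g (level t))\<^sup>2) = ennreal ((slice_mean g t)\<^sup>2) * ennreal (level t)"
    using t True by (simp add: avg_slab slice_mean_eq_rank_mean ennreal_mult[symmetric] mult.commute)
  moreover have "(\<integral>\<^sup>+x. ennreal ((g x)\<^sup>2) \<partial>slab t) = (\<integral>\<^sup>+x. (if t < h x then ennreal ((g x)\<^sup>2) else 0) \<partial>\<nu>)"
    by (subst nn_integral_slab) auto
  ultimately show ?thesis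
    using R.deviation_energy[OF _ integrable_slab_square[OF t _ g2]] by simp
next
  case False
  then have 0: "level t = 0" using level_nonneg[of t] by simp
  have "(\<integral>\<^sup>+x. (if t < h x then ennreal ((deviation g x)\<^sup>2) else 0) \<partial>\<nu>) = (\<integral>\<^sup>+x. 0 \<partial>\<nu>)"
    using null_level[OF t 0] by (intro nn_integral_cong_AE) auto
  then show ?thesis using 0 by simp
qed

lemma total_energy:
  assumes [measurable]: "g \<in> borel_measurable \<nu>" and g2: "integrable \<nu> (\<lambda>x. (g x)\<^sup>2 * h x)"
  shows "(\<integral>\<^sup>+x. ennreal ((deviation g x)\<^sup>2) * ennreal (h x) \<partial>\<nu>) +
      (\<integral>\<^sup>+t. (if 0 < t then ennreal ((slice_mean g t)\<^sup>2) * ennreal (level t) else 0) \<partial>lborel)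
    \<le> (\<integral>\<^sup>+x. ennreal ((g x)\<^sup>2) * ennreal (h x) \<partial>\<nu>)"
proof -
  let ?D = "\<lambda>t. if 0 < t then \<integral>\<^sup>+x. (if t < h x then ennreal ((deviation g x)\<^sup>2) else 0) \<partial>\<nu> else 0"
    and ?M = "\<lambda>t. if 0 < t then ennreal ((slice_mean g t)\<^sup>2) * ennreal (level t) else 0"
  have "(\<integral>\<^sup>+x. ennreal ((deviation g x)\<^sup>2) * ennreal (h x) \<partial>\<nu>) + (\<integral>\<^sup>+t. ?M t \<partial>lborel)
    = (\<integral>\<^sup>+t. ?D t \<partial>lborel) + (\<integral>\<^sup>+t. ?M t \<partial>lborel)"
    by (subst tonelli_slices) auto
  also have "\<dots> = (\<integral>\<^sup>+t. ?D t + ?M t \<partial>lborel)"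
    by (rule nn_integral_add[symmetric]) measurable
  also have "\<dots> \<le> (\<integral>\<^sup>+t. (if 0 < t then \<integral>\<^sup>+x. (if t < h x then ennreal ((g x)\<^sup>2) else 0) \<partial>\<nu> else 0) \<partial>lborel)"
    using slice_energy[OF _ assms] by (intro nn_integral_mono) auto
  also have "\<dots> = (\<integral>\<^sup>+x. ennreal ((g x)\<^sup>2) * ennreal (h x) \<partial>\<nu>)"
    by (rule tonelli_slices) measurable
  finally show ?thesis .
qed

lemma slice_mean_increment:
  assumes st: "0 < s" "s < t" "0 < level t" and [measurable]: "g \<in> borel_measurable \<nu>" and g2: "integrable \<nu> (\<lambda>x. (g x)\<^sup>2 * h x)"
  shows "ennreal ((slice_mean g s - slice_mean g t)\<^sup>2) \<le>
    (\<integral>\<^sup>+x. (if s < h x \<and> h x < t then ennreal ((deviation g x / level (h x))\<^sup>2) * ennreal (level s - level t) else 0) \<partial>\<nu>)"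
proof -
  have le: "level t \<le> level s" using level_antimono st by auto
  then have s: "0 < level s" using st by auto
  interpret R: uniform_rank "slab s" "\<lambda>x. level (h x)" "level s" by (rule uniform_rank_slab[OF st(1) s])
  have [measurable]: "g \<in> borel_measurable (slab s)" by simp
  have g1: "integrable (slab s) g"
    by (rule R.square_integrable_imp_integrable, measurable) (rule integrable_slab_square[OF st(1) _ g2], measurable)
  have avg: "R.avg g (level (h x)) = rank_mean g (level (h x))" if "s < h x" for x
    using level_antimono[of s "h x"] that st s by (intro avg_slab) auto
  have less: "h x < t" if "level t < level (h x)" for x
  proof (rule ccontr)
    assume "\<not> h x < t"
    then show False using level_antimono[of t "h x"] that st by auto
  qed
  have "ennreal ((slice_mean g s - slice_mean g t)\<^sup>2) = ennreal ((R.avg g (level s) - R.avg g (level t))\<^sup>2)"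
    using st s le by (simp add: avg_slab slice_mean_eq_rank_mean)
  also have "\<dots> \<le> ennreal (level s - level t) * (\<integral>\<^sup>+x. (if level t < level (h x) then ennreal (((g x - R.avg g (level (h x))) / level (h x))\<^sup>2) else 0) \<partial>slab s)"
    using g1 st le by (intro R.avg_increment_square) auto
  also have "(\<integral>\<^sup>+x. (if level t < level (h x) then ennreal (((g x - R.avg g (level (h x))) / level (h x))\<^sup>2) else 0) \<partial>slab s) =
    (\<integral>\<^sup>+x. (if s < h x then (if level t < level (h x) then ennreal (((g x - R.avg g (level (h x))) / level (h x))\<^sup>2) else 0) else 0) \<partial>\<nu>)"
    by (rule nn_integral_slab) measurable
  also have "\<dots> \<le> (\<integral>\<^sup>+x. (if s < h x \<and> h x < t then ennreal ((deviation g x / level (h x))\<^sup>2) else 0) \<partial>\<nu>)"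
    by (intro nn_integral_mono) (auto simp: avg deviation_def less)
  also have "ennreal (level s - level t) * \<dots> = (\<integral>\<^sup>+x. ennreal (level s - level t) * (if s < h x \<and> h x < t then ennreal ((deviation g x / level (h x))\<^sup>2) else 0) \<partial>\<nu>)"
    by (rule nn_integral_cmult[symmetric]) measurable
  also have "\<dots> = (\<integral>\<^sup>+x. (if s < h x \<and> h x < t then ennreal ((deviation g x / level (h x))\<^sup>2) * ennreal (level s - level t) else 0) \<partial>\<nu>)"
    by (intro nn_integral_cong) (auto simp: mult.commute)
  finally show ?thesis by (simp add: mult_left_mono)
qed

definition level_measure :: "real measure" where
  "level_measure = density lborel (\<lambda>t. ennreal (if 0 < t then level t else 0))"

lemma sets_level_measure [measurable_cong, simp]: "sets level_measure = sets borel"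
  and space_level_measure [simp]: "space level_measure = UNIV"
  by (simp_all add: level_measure_def)

lemma nn_integral_level_measure:
  assumes [measurable]: "f \<in> borel_measurable borel"
  shows "(\<integral>\<^sup>+t. f t \<partial>level_measure) = (\<integral>\<^sup>+t. (if 0 < t then f t * ennreal (level t) else 0) \<partial>lborel)"
  unfolding level_measure_def
  by (subst nn_integral_density) (auto intro!: nn_integral_cong simp: mult.commute)

lemma emeasure_level_measure: "emeasure level_measure UNIV = ennreal (\<integral>x. h x \<partial>\<nu>)"
  unfolding level_measure_def level_integral[symmetric]
  by (subst emeasure_density) (auto simp: level_nonneg intro!: nn_integral_eq_integral level_integrable)

lemma finite_level_measure: "finite_measure level_measure"
  by (intro finite_measureI) (simp add: emeasure_level_measure)

text \<open>
  The Poincare inequality for slice means. Each point \<open>x\<close> is charged with its deviation once for every pair of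
  heights \<open>s < h x < t\<close>, and the bound for straddling pairs limits the total charge to a multiple of \<open>h x\<close>.
\<close>

lemma slice_mean_variance_le:
  assumes [measurable]: "g \<in> borel_measurable \<nu>" and g2: "integrable \<nu> (\<lambda>x. (g x)\<^sup>2 * h x)"
    and B1: "integrable level_measure (slice_mean g)" and B2: "integrable level_measure (\<lambda>t. (slice_mean g t)\<^sup>2)"
    and mean: "(\<integral>t. slice_mean g t \<partial>level_measure) = 0"
  shows "(\<integral>\<^sup>+t. ennreal ((slice_mean g t)\<^sup>2) \<partial>level_measure) \<le> (\<integral>\<^sup>+x. ennreal ((deviation g x)\<^sup>2) * ennreal (h x) \<partial>\<nu>)"
proof -
  define C where "C = (\<integral>x. h x \<partial>\<nu>)"
  define q where "q x = ennreal ((deviation g x / level (h x))\<^sup>2)" for x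
  define W where "W s t = ennreal ((level s - level t) * level s * level t)" for s t
  have [measurable]: "q \<in> borel_measurable \<nu>" unfolding q_def by measurable
  have [measurable]: "(\<lambda>p. W (fst p) (snd p)) \<in> borel_measurable (borel \<Otimes>\<^sub>M borel)" unfolding W_def by measurable
  have [measurable]: "(\<lambda>x. W (f1 x) (f2 x)) \<in> borel_measurable M" if "f1 \<in> borel_measurable M" "f2 \<in> borel_measurable M" for f1 f2 and M :: "'x measure"
    unfolding W_def using that by measurable
  let ?\<Delta> = "\<lambda>s t. ennreal ((slice_mean g s - slice_mean g t)\<^sup>2)"
  let ?F = "\<lambda>s t x. if 0 < s \<and> s < h x \<and> h x < t then q x * W s t else 0"
  let ?K = "\<lambda>x. \<integral>\<^sup>+s. (if 0 < s \<and> s < h x then \<integral>\<^sup>+t. (if h x < t then W s t else 0) \<partial>lborel else 0) \<partial>lborel"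
  have "ennreal C * (\<integral>\<^sup>+t. ennreal ((slice_mean g t)\<^sup>2) \<partial>level_measure) =
    (\<integral>\<^sup>+s. \<integral>\<^sup>+t. (if s < t then ?\<Delta> s t else 0) \<partial>level_measure \<partial>level_measure)"
    using variance_ordered_pairs[OF finite_level_measure _ B1 B2 mean] by (simp add: emeasure_level_measure C_def)
  also have "\<dots> = (\<integral>\<^sup>+s. \<integral>\<^sup>+t. (if 0 < t then (if s < t then ?\<Delta> s t else 0) * ennreal (level t) else 0) \<partial>lborel \<partial>level_measure)"
    by (intro nn_integral_cong nn_integral_level_measure) measurable
  also have "\<dots> = (\<integral>\<^sup>+s. (if 0 < s then (\<integral>\<^sup>+t. (if 0 < t then (if s < t then ?\<Delta> s t else 0) * ennreal (level t) else 0) \<partial>lborel) * ennreal (level s) else 0) \<partial>lborel)"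
    by (rule nn_integral_level_measure) measurable
  also have "\<dots> = (\<integral>\<^sup>+s. \<integral>\<^sup>+t. (if 0 < s \<and> s < t then ?\<Delta> s t * ennreal (level s * level t) else 0) \<partial>lborel \<partial>lborel)"
  proof (intro nn_integral_cong)
    fix s :: real
    show "(if 0 < s then (\<integral>\<^sup>+t. (if 0 < t then (if s < t then ?\<Delta> s t else 0) * ennreal (level t) else 0) \<partial>lborel) * ennreal (level s) else 0)
      = (\<integral>\<^sup>+t. (if 0 < s \<and> s < t then ?\<Delta> s t * ennreal (level s * level t) else 0) \<partial>lborel)"
    proof (cases "0 < s")
      case True
      then have "(if 0 < s then (\<integral>\<^sup>+t. (if 0 < t then (if s < t then ?\<Delta> s t else 0) * ennreal (level t) else 0) \<partial>lborel) * ennreal (level s) else 0)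
        = (\<integral>\<^sup>+t. (if 0 < t then (if s < t then ?\<Delta> s t else 0) * ennreal (level t) else 0) * ennreal (level s) \<partial>lborel)"
        by (simp add: nn_integral_multc)
      also have "\<dots> = (\<integral>\<^sup>+t. (if 0 < s \<and> s < t then ?\<Delta> s t * ennreal (level s * level t) else 0) \<partial>lborel)"
        using True by (intro nn_integral_cong) (auto simp: ennreal_mult level_nonneg mult_ac)
      finally show ?thesis .
    qed simp
  qed
  also have "\<dots> \<le> (\<integral>\<^sup>+s. \<integral>\<^sup>+t. \<integral>\<^sup>+x. ?F s t x \<partial>\<nu> \<partial>lborel \<partial>lborel)"
  proof (intro nn_integral_mono)
    fix s t :: real
    show "(if 0 < s \<and> s < t then ?\<Delta> s t * ennreal (level s * level t) else 0) \<le>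
      (\<integral>\<^sup>+x. ?F s t x \<partial>\<nu>)"
    proof (cases "0 < s \<and> s < t \<and> 0 < level t")
      case True
      then have le: "level t \<le> level s" using level_antimono by auto
      have "?\<Delta> s t * ennreal (level s * level t) \<le>
        (\<integral>\<^sup>+x. (if s < h x \<and> h x < t then q x * ennreal (level s - level t) else 0) \<partial>\<nu>) * ennreal (level s * level t)"
        using True g2 unfolding q_def by (intro mult_right_mono slice_mean_increment) auto
      also have "\<dots> = (\<integral>\<^sup>+x. (if s < h x \<and> h x < t then q x * ennreal (level s - level t) else 0) * ennreal (level s * level t) \<partial>\<nu>)"
        by (rule nn_integral_multc[symmetric]) measurable
      also have "\<dots> = (\<integral>\<^sup>+x. ?F s t x \<partial>\<nu>)"
        using True le unfolding W_def
        by (intro nn_integral_cong) (auto simp: ennreal_mult[symmetric] level_nonneg mult.assoc)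
      finally show ?thesis using True by simp
    next
      case False
      then have "0 < s \<Longrightarrow> s < t \<Longrightarrow> level t = 0" using level_nonneg[of t] by auto
      then show ?thesis by simp
    qed
  qed
  also have "\<dots> = (\<integral>\<^sup>+s. \<integral>\<^sup>+x. \<integral>\<^sup>+t. ?F s t x \<partial>lborel \<partial>\<nu> \<partial>lborel)"
    by (intro nn_integral_cong L.Fubini') measurable
  also have "\<dots> = (\<integral>\<^sup>+x. \<integral>\<^sup>+s. \<integral>\<^sup>+t. ?F s t x \<partial>lborel \<partial>lborel \<partial>\<nu>)"
    by (rule L.Fubini') measurable
  also have "\<dots> = (\<integral>\<^sup>+x. q x * ?K x \<partial>\<nu>)"
  proof (intro nn_integral_cong)
    fix x assume "x \<in> space \<nu>"
    have "(\<integral>\<^sup>+s. \<integral>\<^sup>+t. ?F s t x \<partial>lborel \<partial>lborel) =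
      (\<integral>\<^sup>+s. q x * (if 0 < s \<and> s < h x then \<integral>\<^sup>+t. (if h x < t then W s t else 0) \<partial>lborel else 0) \<partial>lborel)"
    proof (intro nn_integral_cong)
      fix s :: real
      have "(\<integral>\<^sup>+t. ?F s t x \<partial>lborel) = (\<integral>\<^sup>+t. q x * (if 0 < s \<and> s < h x then (if h x < t then W s t else 0) else 0) \<partial>lborel)"
        by (intro nn_integral_cong) auto
      also have "\<dots> = q x * (if 0 < s \<and> s < h x then \<integral>\<^sup>+t. (if h x < t then W s t else 0) \<partial>lborel else 0)"
        by (subst nn_integral_cmult) auto
      finally show "(\<integral>\<^sup>+t. ?F s t x \<partial>lborel) = q x * (if 0 < s \<and> s < h x then \<integral>\<^sup>+t. (if h x < t then W s t else 0) \<partial>lborel else 0)" .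
    qed
    also have "\<dots> = q x * ?K x"
      by (rule nn_integral_cmult) measurable
    finally show "(\<integral>\<^sup>+s. \<integral>\<^sup>+t. ?F s t x \<partial>lborel \<partial>lborel) =
      q x * ?K x" .
  qed
  also have "\<dots> \<le> (\<integral>\<^sup>+x. ennreal C * (ennreal ((deviation g x)\<^sup>2) * ennreal (h x)) \<partial>\<nu>)"
  proof (intro nn_integral_mono)
    fix x
    show "q x * ?K x \<le>
      ennreal C * (ennreal ((deviation g x)\<^sup>2) * ennreal (h x))"
    proof (cases "0 < h x")
      case True
      have C: "0 \<le> C" unfolding C_def using h_mass by simp
      have "q x * ?K x \<le>
        q x * ennreal (C * (h x * (level (h x))\<^sup>2))"
        using straddling_bound[OF True isCont_level[OF True]] unfolding straddling_def W_def level_integral C_def by (rule mult_left_mono) simp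
      also have "\<dots> = ennreal ((deviation g x / level (h x))\<^sup>2 * (C * (h x * (level (h x))\<^sup>2)))"
        unfolding q_def using C True by (subst ennreal_mult) auto
      also have "\<dots> \<le> ennreal (C * ((deviation g x)\<^sup>2 * h x))"
        using C True by (intro ennreal_leI) (auto simp: power_divide)
      also have "\<dots> = ennreal C * (ennreal ((deviation g x)\<^sup>2) * ennreal (h x))"
        using C True by (simp add: ennreal_mult)
      finally show ?thesis .
    next
      case False
      then have "?K x = (\<integral>\<^sup>+s. 0 \<partial>(lborel :: real measure))"
        by (intro nn_integral_cong) auto
      then show ?thesis by simp
    qed
  qed
  also have "\<dots> = ennreal C * (\<integral>\<^sup>+x. ennreal ((deviation g x)\<^sup>2) * ennreal (h x) \<partial>\<nu>)"
    by (rule nn_integral_cmult) measurable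
  finally show ?thesis
    using h_mass by (subst (asm) ennreal_mult_le_mult_iff) (auto simp: C_def)
qed

lemma integral_level_measure:
  fixes f :: "real \<Rightarrow> real"
  assumes [measurable]: "f \<in> borel_measurable borel"
  shows "(\<integral>t. f t \<partial>level_measure) = (\<integral>t. (if 0 < t then f t * level t else 0) \<partial>lborel)"
    and "integrable level_measure f \<longleftrightarrow> integrable lborel (\<lambda>t. if 0 < t then f t * level t else 0)"
proof -
  have eq: "(if 0 < t then level t else 0) * f t = (if 0 < t then f t * level t else 0)" for t
    by auto
  show "(\<integral>t. f t \<partial>level_measure) = (\<integral>t. (if 0 < t then f t * level t else 0) \<partial>lborel)"
    unfolding level_measure_def by (subst integral_density) (auto simp: level_nonneg eq)
  show "integrable level_measure f \<longleftrightarrow> integrable lborel (\<lambda>t. if 0 < t then f t * level t else 0)"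
    unfolding level_measure_def by (subst integrable_density) (auto simp: level_nonneg eq)
qed

lemma AE_level_pos: "AE t in level_measure. 0 < t \<and> 0 < level t"
  unfolding level_measure_def
  by (subst AE_density) (auto intro!: AE_I2 split: if_splits)

lemma height_mean_times_height: "height_mean f x * h x = (\<integral>t. (if 0 < t \<and> t < h x then f t else 0) \<partial>lborel)"
proof (cases "h x = 0")
  case True
  have "(\<lambda>t. if 0 < t \<and> t < h x then f t else 0) = (\<lambda>t. 0)" using True by auto
  then show ?thesis using True by simp
qed (simp add: height_mean_def)

lemma slice_mean_times_level:
  assumes t: "0 < t" and [measurable]: "g \<in> borel_measurable \<nu>"
  shows "slice_mean g t * level t = (\<integral>x. (if t < h x then g x else 0) \<partial>\<nu>)"
proof (cases "level t = 0")
  case True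
  have "(\<integral>x. (if t < h x then g x else 0) \<partial>\<nu>) = (\<integral>x. 0 \<partial>\<nu>)"
  proof (rule integral_cong_AE)
    show "AE x in \<nu>. (if t < h x then g x else 0) = 0"
      using null_level[OF t True] by eventually_elim simp
  qed measurable
  then show ?thesis using True by simp
qed (simp add: slice_mean_def)

text \<open>
  Both sides are the integral of \<open>f x * b t\<close> over the region \<open>0 < t < h x\<close> under the graph of \<open>h\<close>.
\<close>

lemma duality:
  assumes [measurable]: "f \<in> borel_measurable \<nu>" "b \<in> borel_measurable borel"
    and f2: "integrable \<nu> (\<lambda>x. (f x)\<^sup>2 * h x)" and b2: "integrable level_measure (\<lambda>t. (b t)\<^sup>2)"
  shows "integrable level_measure (\<lambda>t. b t * slice_mean f t)"
    and "integrable \<nu> (\<lambda>x. f x * height_mean b x * h x)"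
    and "(\<integral>x. f x * height_mean b x * h x \<partial>\<nu>) = (\<integral>t. b t * slice_mean f t \<partial>level_measure)"
proof -
  define F where "F = (\<lambda>(x, t). if 0 < t \<and> t < h x then f x * b t else 0)"
  have [measurable]: "F \<in> borel_measurable (\<nu> \<Otimes>\<^sub>M lborel)" unfolding F_def by measurable
  let ?f2 = "\<lambda>x t. if 0 < t \<and> t < h x then ennreal ((f x)\<^sup>2) else 0"
  let ?b2 = "\<lambda>x t. if 0 < t \<and> t < h x then ennreal ((b t)\<^sup>2) else 0"
  have F: "integrable (\<nu> \<Otimes>\<^sub>M lborel) F"
  proof (rule integrableI_bounded)
    have "(\<integral>\<^sup>+p. ennreal (norm (F p)) \<partial>(\<nu> \<Otimes>\<^sub>M lborel)) = (\<integral>\<^sup>+x. \<integral>\<^sup>+t. ennreal (norm (F (x, t))) \<partial>lborel \<partial>\<nu>)"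
      by (rule lborel.nn_integral_fst[symmetric]) measurable
    also have "\<dots> \<le> (\<integral>\<^sup>+x. \<integral>\<^sup>+t. ?f2 x t + ?b2 x t \<partial>lborel \<partial>\<nu>)"
    proof (intro nn_integral_mono)
      fix x t
      have "\<bar>f x * b t\<bar> \<le> (f x)\<^sup>2 + (b t)\<^sup>2"
        using sum_squares_bound[of "\<bar>f x\<bar>" "\<bar>b t\<bar>"] mult_nonneg_nonneg[of "\<bar>f x\<bar>" "\<bar>b t\<bar>"]
        unfolding abs_mult power2_abs by linarith
      then show "ennreal (norm (F (x, t))) \<le> ?f2 x t + ?b2 x t"
        by (auto simp: F_def ennreal_plus[symmetric] simp del: ennreal_plus intro!: ennreal_leI)
    qed
    also have "\<dots> = (\<integral>\<^sup>+x. (\<integral>\<^sup>+t. ?f2 x t \<partial>lborel) + (\<integral>\<^sup>+t. ?b2 x t \<partial>lborel) \<partial>\<nu>)"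
      by (intro nn_integral_cong nn_integral_add) measurable
    also have "\<dots> = (\<integral>\<^sup>+x. \<integral>\<^sup>+t. ?f2 x t \<partial>lborel \<partial>\<nu>) + (\<integral>\<^sup>+x. \<integral>\<^sup>+t. ?b2 x t \<partial>lborel \<partial>\<nu>)"
      by (rule nn_integral_add) measurable
    also have "(\<integral>\<^sup>+x. \<integral>\<^sup>+t. ?b2 x t \<partial>lborel \<partial>\<nu>) = (\<integral>\<^sup>+t. ennreal ((b t)\<^sup>2) \<partial>level_measure)"
      by (subst tonelli_levels, measurable, subst nn_integral_level_measure) auto
    also have "(\<integral>\<^sup>+x. \<integral>\<^sup>+t. ?f2 x t \<partial>lborel \<partial>\<nu>) = (\<integral>\<^sup>+x. ennreal ((f x)\<^sup>2 * h x) \<partial>\<nu>)"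
    proof (intro nn_integral_cong)
      fix x
      have "(\<integral>\<^sup>+t. ?f2 x t \<partial>lborel) = (\<integral>\<^sup>+t. ennreal ((f x)\<^sup>2) * indicator {0<..<h x} t \<partial>lborel)"
        by (intro nn_integral_cong) (auto simp: indicator_def)
      also have "\<dots> = ennreal ((f x)\<^sup>2 * h x)" by (simp add: nn_integral_cmult h_nonneg ennreal_mult)
      finally show "(\<integral>\<^sup>+t. ?f2 x t \<partial>lborel) = ennreal ((f x)\<^sup>2 * h x)" .
    qed
    also have "\<dots> + (\<integral>\<^sup>+t. ennreal ((b t)\<^sup>2) \<partial>level_measure) < \<infinity>"
      using f2 b2 h_nonneg by (simp add: nn_integral_eq_integral)
    finally show "(\<integral>\<^sup>+p. ennreal (norm (F p)) \<partial>(\<nu> \<Otimes>\<^sub>M lborel)) < \<infinity>" .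
  qed measurable
  have x: "(\<integral>t. F (x, t) \<partial>lborel) = f x * height_mean b x * h x" for x
  proof -
    have "(\<integral>t. F (x, t) \<partial>lborel) = (\<integral>t. f x * (if 0 < t \<and> t < h x then b t else 0) \<partial>lborel)"
      by (intro Bochner_Integration.integral_cong) (auto simp: F_def)
    then show ?thesis by (simp add: height_mean_times_height mult.assoc)
  qed
  have t: "(\<integral>x. F (x, t) \<partial>\<nu>) = (if 0 < t then b t * slice_mean f t * level t else 0)" for t
  proof (cases "0 < t")
    case True
    then have "(\<integral>x. F (x, t) \<partial>\<nu>) = (\<integral>x. b t * (if t < h x then f x else 0) \<partial>\<nu>)"
      by (intro Bochner_Integration.integral_cong) (auto simp: F_def)
    then show ?thesis using True by (simp add: slice_mean_times_level mult.assoc)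
  qed (simp add: F_def)
  have F': "integrable (\<nu> \<Otimes>\<^sub>M lborel) (case_prod (\<lambda>x t. F (x, t)))" using F by simp
  show "integrable \<nu> (\<lambda>x. f x * height_mean b x * h x)"
    using L.integrable_fst[OF F'] by (simp add: x)
  show "integrable level_measure (\<lambda>t. b t * slice_mean f t)"
    using L.integrable_snd[OF F'] by (subst integral_level_measure(2)) (auto simp: t)
  show "(\<integral>x. f x * height_mean b x * h x \<partial>\<nu>) = (\<integral>t. b t * slice_mean f t \<partial>level_measure)"
    using L.Fubini_integral[OF F'] by (subst integral_level_measure(1)) (auto simp: x t)
qed

lemma height_mean_one: "height_mean (\<lambda>_. 1) x * h x = h x"
proof -
  have "(\<integral>t. (if 0 < t \<and> t < h x then 1 else 0) \<partial>lborel) = (\<integral>t. indicator {0<..<h x} t \<partial>lborel)"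
    by (intro Bochner_Integration.integral_cong) (auto simp: indicator_def)
  also have "\<dots> = h x" using h_nonneg by simp
  finally show ?thesis by (simp add: height_mean_times_height)
qed

lemma slice_mean_one:
  assumes "0 < t" "0 < level t" shows "slice_mean (\<lambda>_. 1) t = 1"
proof -
  have "(\<integral>x. (if t < h x then 1 else 0) \<partial>\<nu>) = (\<integral>x. indicator {x \<in> space \<nu>. t < h x} x \<partial>\<nu>)"
    by (intro Bochner_Integration.integral_cong) (auto simp: indicator_def)
  also have "\<dots> = level t" by (simp add: level_def Int_def conj_ac)
  finally show ?thesis using assms by (simp add: slice_mean_def)
qed

lemma integrable_level_square_imp:
  fixes b :: "real \<Rightarrow> real"
  assumes [measurable]: "b \<in> borel_measurable borel" and b2: "integrable level_measure (\<lambda>t. (b t)\<^sup>2)"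
  shows "integrable level_measure b"
proof -
  interpret finite_measure level_measure by (rule finite_level_measure)
  show ?thesis by (rule square_integrable_imp_integrable[OF _ b2]) measurable
qed

lemma integral_slice_mean:
  assumes g: "g \<in> borel_measurable \<nu>" and g2: "integrable \<nu> (\<lambda>x. (g x)\<^sup>2 * h x)"
  shows "(\<integral>t. slice_mean g t \<partial>level_measure) = (\<integral>x. g x * h x \<partial>\<nu>)"
proof -
  interpret finite_measure level_measure by (rule finite_level_measure)
  show ?thesis
    using duality(3)[of g "\<lambda>_. 1"] g g2 by (simp add: mult.assoc height_mean_one)
qed

lemma integral_height_mean:
  assumes b: "b \<in> borel_measurable borel" and b2: "integrable level_measure (\<lambda>t. (b t)\<^sup>2)"
  shows "(\<integral>x. height_mean b x * h x \<partial>\<nu>) = (\<integral>t. b t \<partial>level_measure)"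
proof -
  note b[measurable]
  have "(\<integral>x. height_mean b x * h x \<partial>\<nu>) = (\<integral>t. b t * slice_mean (\<lambda>_. 1) t \<partial>level_measure)"
    using duality(3)[of "\<lambda>_. 1" b] b b2 h_integrable by simp
  also have "\<dots> = (\<integral>t. b t \<partial>level_measure)"
  proof (rule integral_cong_AE)
    show "AE t in level_measure. b t * slice_mean (\<lambda>_. 1) t = b t"
      using AE_level_pos by eventually_elim (simp add: slice_mean_one)
  qed measurable
  finally show ?thesis .
qed

lemma integrable_slice_mean_square:
  assumes g: "g \<in> borel_measurable \<nu>" and g2: "integrable \<nu> (\<lambda>x. (g x)\<^sup>2 * h x)"
  shows "integrable level_measure (\<lambda>t. (slice_mean g t)\<^sup>2)"
proof (rule integrableI_bounded)
  note g[measurable]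
  show "(\<lambda>t. (slice_mean g t)\<^sup>2) \<in> borel_measurable level_measure" by measurable
  have "(\<integral>\<^sup>+t. ennreal ((slice_mean g t)\<^sup>2) \<partial>level_measure) \<le> (\<integral>\<^sup>+x. ennreal ((g x)\<^sup>2) * ennreal (h x) \<partial>\<nu>)"
    using order_trans[OF add_increasing[OF zero_le order_refl] total_energy[OF g g2]] by (subst nn_integral_level_measure) measurable
  also have "\<dots> = (\<integral>\<^sup>+x. ennreal ((g x)\<^sup>2 * h x) \<partial>\<nu>)"
    by (simp add: ennreal_mult h_nonneg)
  also have "\<dots> < \<infinity>" using g2 h_nonneg by (simp add: nn_integral_eq_integral)
  finally show "(\<integral>\<^sup>+t. ennreal (norm ((slice_mean g t)\<^sup>2)) \<partial>level_measure) < \<infinity>" by simp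
qed

text \<open>
  The energy inequality says that deviations and slice means share the energy of \<open>g\<close>, and the Poincare inequality
  that the slice means have at most half of it.
\<close>

lemma slice_mean_contraction:
  assumes g: "g \<in> borel_measurable \<nu>" and g2: "integrable \<nu> (\<lambda>x. (g x)\<^sup>2 * h x)" and mean: "(\<integral>x. g x * h x \<partial>\<nu>) = 0"
  shows "2 * (\<integral>t. (slice_mean g t)\<^sup>2 \<partial>level_measure) \<le> (\<integral>x. (g x)\<^sup>2 * h x \<partial>\<nu>)"
proof -
  note g[measurable]
  note B2 = integrable_slice_mean_square[OF g g2]
  define Z where "Z = (\<integral>t. (slice_mean g t)\<^sup>2 \<partial>level_measure)"
  define G where "G = (\<integral>x. (g x)\<^sup>2 * h x \<partial>\<nu>)"
  have nn: "0 \<le> Z" "0 \<le> G" using h_nonneg by (auto simp: Z_def G_def intro!: integral_nonneg_AE)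
  have Z: "(\<integral>\<^sup>+t. ennreal ((slice_mean g t)\<^sup>2) \<partial>level_measure) = ennreal Z"
    unfolding Z_def by (rule nn_integral_eq_integral[OF B2]) auto
  have "(\<integral>\<^sup>+x. ennreal ((g x)\<^sup>2) * ennreal (h x) \<partial>\<nu>) = (\<integral>\<^sup>+x. ennreal ((g x)\<^sup>2 * h x) \<partial>\<nu>)"
    by (simp add: ennreal_mult h_nonneg)
  also have "\<dots> = ennreal G"
    unfolding G_def by (rule nn_integral_eq_integral[OF g2]) (auto simp: h_nonneg)
  finally have G: "(\<integral>\<^sup>+x. ennreal ((g x)\<^sup>2) * ennreal (h x) \<partial>\<nu>) = ennreal G" .
  have "ennreal Z \<le> (\<integral>\<^sup>+x. ennreal ((deviation g x)\<^sup>2) * ennreal (h x) \<partial>\<nu>)"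
    unfolding Z[symmetric]
  proof (rule slice_mean_variance_le[OF g g2 _ B2])
    show "integrable level_measure (slice_mean g)"
      by (rule integrable_level_square_imp[OF _ B2]) measurable
    show "(\<integral>t. slice_mean g t \<partial>level_measure) = 0"
      using integral_slice_mean[OF g g2] mean by simp
  qed
  then have "ennreal Z + ennreal Z \<le> (\<integral>\<^sup>+x. ennreal ((deviation g x)\<^sup>2) * ennreal (h x) \<partial>\<nu>) + ennreal Z"
    by (rule add_right_mono)
  also have "\<dots> = (\<integral>\<^sup>+x. ennreal ((deviation g x)\<^sup>2) * ennreal (h x) \<partial>\<nu>) +
      (\<integral>\<^sup>+t. (if 0 < t then ennreal ((slice_mean g t)\<^sup>2) * ennreal (level t) else 0) \<partial>lborel)"
    unfolding Z[symmetric] by (subst nn_integral_level_measure) auto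
  also have "\<dots> \<le> ennreal G" unfolding G[symmetric] by (rule total_energy[OF g g2])
  finally show ?thesis using nn by (simp add: ennreal_plus[symmetric] Z_def[symmetric] G_def[symmetric] del: ennreal_plus)
qed

lemma integrable_height_mean_square:
  assumes b: "b \<in> borel_measurable borel" and b2: "integrable level_measure (\<lambda>t. (b t)\<^sup>2)"
  shows "integrable \<nu> (\<lambda>x. (height_mean b x)\<^sup>2 * h x)"
proof (rule integrableI_bounded)
  note b[measurable]
  let ?b2 = "\<lambda>x t. if 0 < t \<and> t < h x then ennreal ((b t)\<^sup>2) else 0"
  show "(\<lambda>x. (height_mean b x)\<^sup>2 * h x) \<in> borel_measurable \<nu>" by measurable
  have "(\<integral>\<^sup>+x. ennreal (norm ((height_mean b x)\<^sup>2 * h x)) \<partial>\<nu>) \<le> (\<integral>\<^sup>+x. \<integral>\<^sup>+t. ?b2 x t \<partial>lborel \<partial>\<nu>)"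
  proof (intro nn_integral_mono)
    fix x
    show "ennreal (norm ((height_mean b x)\<^sup>2 * h x)) \<le> (\<integral>\<^sup>+t. ?b2 x t \<partial>lborel)"
    proof (cases "0 < h x")
      case True
      have "(\<integral>t. indicator {0<..<h x} t * b t \<partial>lborel) = height_mean b x * h x"
        unfolding height_mean_times_height by (intro Bochner_Integration.integral_cong) (auto simp: indicator_def)
      then have "ennreal ((height_mean b x * h x)\<^sup>2) \<le> ennreal (h x) * (\<integral>\<^sup>+t. indicator {0<..<h x} t * ennreal ((b t)\<^sup>2) \<partial>lborel)"
        using integral_square_le[of b lborel "{0<..<h x}"] h_nonneg[of x] by simp
      also have "(\<integral>\<^sup>+t. indicator {0<..<h x} t * ennreal ((b t)\<^sup>2) \<partial>lborel) = (\<integral>\<^sup>+t. ?b2 x t \<partial>lborel)"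
        by (intro nn_integral_cong) (auto simp: indicator_def)
      also have "ennreal ((height_mean b x * h x)\<^sup>2) = ennreal (h x) * ennreal ((height_mean b x)\<^sup>2 * h x)"
        using True by (simp add: ennreal_mult[symmetric] power2_eq_square mult_ac)
      finally show ?thesis
        using True by (subst (asm) ennreal_mult_le_mult_iff) auto
    next
      case False
      then have "h x = 0" using h_nonneg[of x] by simp
      then show ?thesis by simp
    qed
  qed
  also have "\<dots> = (\<integral>\<^sup>+t. ennreal ((b t)\<^sup>2) \<partial>level_measure)"
    by (subst tonelli_levels, measurable, subst nn_integral_level_measure) auto
  also have "\<dots> < \<infinity>" using b2 by (simp add: nn_integral_eq_integral)
  finally show "(\<integral>\<^sup>+x. ennreal (norm ((height_mean b x)\<^sup>2 * h x)) \<partial>\<nu>) < \<infinity>" .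
qed

text \<open>
  An operator and its adjoint have the same norm. Concretely, with \<open>f = height_mean b\<close>, duality expresses the squared
  norm of \<open>f\<close> as the inner product of \<open>b\<close> with \<open>slice_mean f\<close>, to which the contraction of slice means applies.
\<close>

lemma height_mean_contraction:
  assumes b: "b \<in> borel_measurable borel" and b2: "integrable level_measure (\<lambda>t. (b t)\<^sup>2)" and mean: "(\<integral>t. b t \<partial>level_measure) = 0"
  shows "2 * (\<integral>x. (height_mean b x)\<^sup>2 * h x \<partial>\<nu>) \<le> (\<integral>t. (b t)\<^sup>2 \<partial>level_measure)"
proof -
  note b[measurable]
  define f where "f = height_mean b"
  have [measurable]: "f \<in> borel_measurable \<nu>" unfolding f_def by measurable
  have f2: "integrable \<nu> (\<lambda>x. (f x)\<^sup>2 * h x)"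
    unfolding f_def by (rule integrable_height_mean_square[OF b b2])
  note s2 = integrable_slice_mean_square[OF _ f2]
  have "(\<integral>x. (f x)\<^sup>2 * h x \<partial>\<nu>) = (\<integral>t. b t * slice_mean f t \<partial>level_measure)"
    using duality(3)[OF _ b f2 b2] by (simp add: f_def[symmetric] power2_eq_square)
  \<comment> \<open>The weights are chosen so that half of the squared norm of \<open>f\<close> is absorbed on the
    left.\<close>
  also have "\<dots> \<le> (\<integral>t. (b t)\<^sup>2 / 4 + (slice_mean f t)\<^sup>2 \<partial>level_measure)"
  proof (rule integral_mono)
    show "integrable level_measure (\<lambda>t. b t * slice_mean f t)"
      by (rule duality(1)[OF _ b f2 b2]) measurable
    show "integrable level_measure (\<lambda>t. (b t)\<^sup>2 / 4 + (slice_mean f t)\<^sup>2)"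
      using b2 s2 by simp
    show "b t * slice_mean f t \<le> (b t)\<^sup>2 / 4 + (slice_mean f t)\<^sup>2" for t
      using sum_squares_bound[of "b t / 2" "slice_mean f t"] by (simp add: power_divide)
  qed
  also have "\<dots> = (\<integral>t. (b t)\<^sup>2 \<partial>level_measure) / 4 + (\<integral>t. (slice_mean f t)\<^sup>2 \<partial>level_measure)"
    using b2 s2 by simp
  finally have "(\<integral>x. (f x)\<^sup>2 * h x \<partial>\<nu>) \<le> (\<integral>t. (b t)\<^sup>2 \<partial>level_measure) / 4 + (\<integral>t. (slice_mean f t)\<^sup>2 \<partial>level_measure)" .
  moreover have "2 * (\<integral>t. (slice_mean f t)\<^sup>2 \<partial>level_measure) \<le> (\<integral>x. (f x)\<^sup>2 * h x \<partial>\<nu>)"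
    using f2 integral_height_mean[OF b b2] mean by (intro slice_mean_contraction) (auto simp: f_def)
  ultimately show ?thesis unfolding f_def by linarith
qed

theorem slice_sampling_contraction:
  assumes g: "g \<in> borel_measurable \<nu>" and g2: "integrable \<nu> (\<lambda>x. (g x)\<^sup>2 * h x)" and mean: "(\<integral>x. g x * h x \<partial>\<nu>) = 0"
  shows "4 * (\<integral>x. (height_mean (slice_mean g) x)\<^sup>2 * h x \<partial>\<nu>) \<le> (\<integral>x. (g x)\<^sup>2 * h x \<partial>\<nu>)"
proof -
  note g[measurable]
  have "2 * (\<integral>x. (height_mean (slice_mean g) x)\<^sup>2 * h x \<partial>\<nu>) \<le> (\<integral>t. (slice_mean g t)\<^sup>2 \<partial>level_measure)"
    using integral_slice_mean[OF g g2] mean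
    by (intro height_mean_contraction integrable_slice_mean_square[OF g g2]) auto
  with slice_mean_contraction[OF assms] show ?thesis by simp
qed

end

section \<open>The kernel of polar slice sampling\<close>

lemma integral_uniform_measure_eq:
  fixes f :: "'a \<Rightarrow> real"
  assumes [measurable]: "f \<in> borel_measurable M" "S \<in> sets M" and m: "emeasure M S = ennreal m" "0 < m"
  shows "(\<integral>x. f x \<partial>uniform_measure M S) = (\<integral>x. (if x \<in> S then f x else 0) \<partial>M) / m"
proof -
  have "uniform_measure M S = density M (\<lambda>x. ennreal (if x \<in> S then 1 / m else 0))"
    unfolding uniform_measure_def using m
    by (intro arg_cong[where f="density M"] ext) (auto simp: indicator_def divide_ennreal ennreal_1[symmetric] simp del: ennreal_1)
  then have "(\<integral>x. f x \<partial>uniform_measure M S) = (\<integral>x. (if x \<in> S then 1 / m else 0) *\<^sub>R f x \<partial>M)"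
    using m by (simp add: integral_density)
  also have "\<dots> = (\<integral>x. (if x \<in> S then f x else 0) / m \<partial>M)"
    by (intro Bochner_Integration.integral_cong) auto
  finally show ?thesis by simp
qed

text \<open>
  Fubini for kernels, obtained from the nonnegative case by splitting \<open>g\<close> into its positive and negative part.
\<close>

lemma integral_bind_finite:
  fixes g :: "'b \<Rightarrow> real"
  assumes N [measurable]: "N \<in> measurable M (subprob_algebra K)" and [measurable]: "g \<in> borel_measurable K"
    and space: "space M \<noteq> {}"
    and fin: "(\<integral>\<^sup>+t. \<integral>\<^sup>+y. ennreal \<bar>g y\<bar> \<partial>N t \<partial>M) < \<infinity>"
  shows "integrable (M \<bind> N) g" and "(\<integral>y. g y \<partial>(M \<bind> N)) = (\<integral>t. \<integral>y. g y \<partial>N t \<partial>M)"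
proof -
  note meas = measurable_compose[OF N nn_integral_measurable_subprob_algebra]
  have sets [measurable_cong]: "sets (M \<bind> N) = sets K"
    by (rule sets_bind[OF sets_kernel[OF N] space])
  have nn: "(\<integral>\<^sup>+y. f y \<partial>(M \<bind> N)) = (\<integral>\<^sup>+t. \<integral>\<^sup>+y. f y \<partial>N t \<partial>M)" if "f \<in> borel_measurable K" for f :: "'b \<Rightarrow> ennreal"
    by (rule nn_integral_bind[OF that N])
  define p where "p t = (\<integral>\<^sup>+y. ennreal (g y) \<partial>N t)" for t
  define q where "q t = (\<integral>\<^sup>+y. ennreal (- g y) \<partial>N t)" for t
  have [measurable]: "p \<in> borel_measurable M" "q \<in> borel_measurable M"
    unfolding p_def q_def by (rule meas, measurable)+
  show int: "integrable (M \<bind> N) g"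
  proof (rule integrableI_bounded)
    show "(\<integral>\<^sup>+y. ennreal (norm (g y)) \<partial>(M \<bind> N)) < \<infinity>"
      using fin by (subst nn) auto
  qed measurable
  have le: "p t \<le> (\<integral>\<^sup>+y. ennreal \<bar>g y\<bar> \<partial>N t)" "q t \<le> (\<integral>\<^sup>+y. ennreal \<bar>g y\<bar> \<partial>N t)" for t
    unfolding p_def q_def by (auto intro!: nn_integral_mono ennreal_leI)
  have AE: "AE t in M. (\<integral>\<^sup>+y. ennreal \<bar>g y\<bar> \<partial>N t) \<noteq> \<infinity>"
    using fin by (intro nn_integral_noteq_infinite meas) auto
  have fin_p: "(\<integral>\<^sup>+t. p t \<partial>M) < \<infinity>" and fin_q: "(\<integral>\<^sup>+t. q t \<partial>M) < \<infinity>"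
    by (rule le_less_trans[OF nn_integral_mono fin], rule le)+
  have AEp: "AE t in M. p t = ennreal (enn2real (p t))" and AEq: "AE t in M. q t = ennreal (enn2real (q t))"
  proof -
    have fin_le: "x = ennreal (enn2real x)" if "x \<le> y" "y \<noteq> \<infinity>" for x y
      using that by (cases x) (auto simp: top_unique)
    show "AE t in M. p t = ennreal (enn2real (p t))"
      using AE by eventually_elim (rule fin_le[OF le(1)])
    show "AE t in M. q t = ennreal (enn2real (q t))"
      using AE by eventually_elim (rule fin_le[OF le(2)])
  qed
  have r: "integrable M (\<lambda>t. enn2real (f t))" "(\<integral>t. enn2real (f t) \<partial>M) = enn2real (\<integral>\<^sup>+t. f t \<partial>M)"
    if [measurable]: "f \<in> borel_measurable M" and "(\<integral>\<^sup>+t. f t \<partial>M) < \<infinity>" and "AE t in M. f t = ennreal (enn2real (f t))" for f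
  proof -
    have eq: "(\<integral>\<^sup>+t. ennreal (enn2real (f t)) \<partial>M) = (\<integral>\<^sup>+t. f t \<partial>M)"
      using that(3) by (intro nn_integral_cong_AE) auto
    show "integrable M (\<lambda>t. enn2real (f t))"
      using that(2) eq by (intro integrableI_nonneg) auto
    show "(\<integral>t. enn2real (f t) \<partial>M) = enn2real (\<integral>\<^sup>+t. f t \<partial>M)"
      by (subst integral_eq_nn_integral) (auto simp: eq)
  qed
  note rp = r[OF _ fin_p AEp] and rq = r[OF _ fin_q AEq]
  have "(\<integral>y. g y \<partial>(M \<bind> N)) = enn2real (\<integral>\<^sup>+t. p t \<partial>M) - enn2real (\<integral>\<^sup>+t. q t \<partial>M)"
    unfolding real_lebesgue_integral_def[OF int] p_def q_def by (subst (1 2) nn) auto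
  also have "\<dots> = (\<integral>t. enn2real (p t) - enn2real (q t) \<partial>M)"
    using rp rq by simp
  also have "\<dots> = (\<integral>t. \<integral>y. g y \<partial>N t \<partial>M)"
  proof (rule integral_cong_AE)
    show "(\<lambda>t. \<integral>y. g y \<partial>N t) \<in> borel_measurable M"
      by (rule measurable_compose[OF N integral_measurable_subprob_algebra]) measurable
    show "AE t in M. enn2real (p t) - enn2real (q t) = (\<integral>y. g y \<partial>N t)"
      using AE AE_space
    proof eventually_elim
      case (elim t)
      have "g \<in> borel_measurable (N t)"
        using elim(2) by (subst measurable_cong_sets[OF sets_kernel[OF N] refl]) auto
      then have "integrable (N t) g"
        using elim(1) by (intro integrableI_bounded) (auto simp: less_top)
      then show ?case unfolding p_def q_def by (rule real_lebesgue_integral_def[symmetric])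
    qed
  qed measurable
  finally show "(\<integral>y. g y \<partial>(M \<bind> N)) = (\<integral>t. \<integral>y. g y \<partial>N t \<partial>M)" .
qed

text \<open>
  The kernels and the target of polar slice sampling for a density \<open>\<rho>\<close> whose \<open>p\<^sub>1\<close> has the properties of a slice
  space over \<open>pss_base\<close>.
\<close>

locale polar_slice =
  fixes \<rho> :: "'a::euclidean_space \<Rightarrow> real" and \<nu>T :: "real measure" and \<nu>X :: "'a measure"
  assumes rho [measurable]: "\<rho> \<in> borel_measurable borel"
    and factorization: "\<And>x. pss_p0 x * pss_p1 \<rho> x = \<rho> x"
    and nuT: "prob_space \<nu>T" "sets \<nu>T = sets borel" "AE t in \<nu>T. 0 < t"
    and nuX: "prob_space \<nu>X" "sets \<nu>X = sets borel"
    and slice: "slice_space pss_base (pss_p1 \<rho>)"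
begin

sublocale slice_space pss_base "pss_p1 \<rho>" by (rule slice)

abbreviation "h \<equiv> pss_p1 \<rho>"
abbreviation "\<nu> \<equiv> pss_base :: 'a measure"
abbreviation "UT \<equiv> pss_UT \<rho> \<nu>T"
abbreviation "UX \<equiv> pss_UX \<rho> \<nu>X"
abbreviation "P \<equiv> pss_kernel \<rho> \<nu>T \<nu>X"
abbreviation "\<pi> \<equiv> normalized_measure \<rho>"

definition mass where "mass = (\<integral>x. h x \<partial>\<nu>)"

lemma h_borel [measurable]: "h \<in> borel_measurable borel"
  unfolding pss_p1_def by measurable

lemma mass_pos: "0 < mass" unfolding mass_def by (rule h_mass)

lemma space_base [simp]: "space pss_base = UNIV" by (simp add: pss_base_def)

lemma p0_nonneg: "0 \<le> pss_p0 (x :: 'a)"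
  by (simp add: pss_p0_def)

lemma integral_rho: "(\<integral>x. \<rho> x \<partial>lborel) = mass"
  unfolding mass_def pss_base_def
  by (subst integral_density) (auto simp: factorization p0_nonneg)

lemma pi_eq: "\<pi> = density \<nu> (\<lambda>x. ennreal (h x / mass))"
proof -
  have "ennreal (\<rho> x / mass) = ennreal (pss_p0 x) * ennreal (h x / mass)" for x
    using mass_pos h_nonneg[of x] p0_nonneg[of x] by (simp add: ennreal_mult[symmetric] factorization)
  then show ?thesis
    unfolding normalized_measure_def integral_rho pss_base_def by (subst density_density_eq) auto
qed

lemma sets_pi [simp, measurable_cong]: "sets \<pi> = sets borel"
  and space_pi [simp]: "space \<pi> = UNIV"
  by (simp_all add: normalized_measure_def)

lemma integral_pi:
  fixes f :: "'a \<Rightarrow> real"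
  assumes [measurable]: "f \<in> borel_measurable borel"
  shows "(\<integral>x. f x \<partial>\<pi>) = (\<integral>x. f x * h x \<partial>\<nu>) / mass"
    and "integrable \<pi> f \<longleftrightarrow> integrable \<nu> (\<lambda>x. f x * h x)"
proof -
  have eq: "h x / mass * f x = inverse mass * (f x * h x)" for x by (simp add: divide_inverse)
  have [measurable]: "f \<in> borel_measurable \<nu>" by simp
  show "(\<integral>x. f x \<partial>\<pi>) = (\<integral>x. f x * h x \<partial>\<nu>) / mass"
    unfolding pi_eq using mass_pos h_nonneg by (subst integral_density) (auto simp: mult.commute)
  show "integrable \<pi> f \<longleftrightarrow> integrable \<nu> (\<lambda>x. f x * h x)"
    unfolding pi_eq using mass_pos h_nonneg by (subst integrable_density) (auto simp: eq simp del: times_divide_eq_left)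
qed

lemma AE_pi: "(AE x in \<nu>. 0 < h x \<longrightarrow> Q x) \<Longrightarrow> AE x in \<pi>. 0 < h x \<and> Q x"
  unfolding pi_eq using mass_pos
  by (subst AE_density) (auto elim!: eventually_mono simp: zero_less_divide_iff)

lemma prob_pi: "prob_space \<pi>"
proof
  have "emeasure \<pi> (space \<pi>) = (\<integral>\<^sup>+x. ennreal (h x / mass) \<partial>\<nu>)"
    unfolding pi_eq by (subst emeasure_density) (auto intro!: nn_integral_cong)
  also have "\<dots> = ennreal (\<integral>x. h x / mass \<partial>\<nu>)"
    using h_integrable h_nonneg mass_pos by (intro nn_integral_eq_integral) auto
  also have "\<dots> = 1" using mass_pos by (simp add: mass_def)
  finally show "emeasure \<pi> (space \<pi>) = 1" .
qed

lemma sets_UX: "sets (UX t) = sets borel" by (simp add: pss_UX_def nuX)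
lemma sets_UT: "sets (UT x) = sets borel" by (simp add: pss_UT_def nuT)

lemma level_set: "emeasure \<nu> (pss_level \<rho> t) = ennreal (level t)" if "0 < t"
  using emeasure_level[OF that] by (simp add: pss_level_def)

lemma UX_kernel: "UX \<in> measurable borel (subprob_algebra borel)"
proof (rule measurable_subprob_algebra)
  fix t :: real
  show "sets (UX t) = sets borel" by (rule sets_UX)
  show "(\<lambda>t. emeasure (UX t) A) \<in> borel_measurable borel" if "A \<in> sets borel" for A
    using that by (intro measurable_pss_UX rho)
  show "subprob_space (UX t)"
  proof (cases "emeasure \<nu> (pss_level \<rho> t) = 0")
    case True
    then show ?thesis using nuX by (simp add: pss_UX_def prob_space_imp_subprob_space)
  next
    case False
    define e where "e = emeasure \<nu> (pss_level \<rho> t)"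
    have "e / e \<le> 1"
    proof (cases "e = \<infinity>")
      case True
      then show ?thesis by (simp add: divide_ennreal_def)
    next
      case False
      then show ?thesis using \<open>emeasure \<nu> (pss_level \<rho> t) \<noteq> 0\<close>
        by (simp add: e_def ennreal_divide_self less_top)
    qed
    moreover have "emeasure (uniform_measure \<nu> (pss_level \<rho> t)) UNIV = e / e"
      using pss_level_measurable[OF rho, of t] by (subst emeasure_uniform_measure) (auto simp: e_def)
    ultimately have "emeasure (uniform_measure \<nu> (pss_level \<rho> t)) (space (uniform_measure \<nu> (pss_level \<rho> t))) \<le> 1"
      by simp
    then show ?thesis using False by (auto simp: pss_UX_def intro!: subprob_spaceI)
  qed
qed

lemma prob_UX: "0 < t \<Longrightarrow> prob_space (UX t)"
  unfolding pss_UX_def using nuX emeasure_level_finite[of t] by (auto intro!: prob_space_uniform_measure simp: pss_level_def)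

lemma emeasure_Ioo_h: "emeasure lborel {0<..<h x} = ennreal (h x)"
  using h_nonneg[of x] by simp

lemma UT_kernel: "UT \<in> measurable borel (subprob_algebra borel)"
proof (rule measurable_subprob_algebra)
  fix x :: 'a
  show "sets (UT x) = sets borel" by (rule sets_UT)
  show "subprob_space (UT x)"
    using nuT h_nonneg[of x] unfolding pss_UT_def
    by (auto intro!: prob_space_imp_subprob_space prob_space_uniform_measure simp: emeasure_Ioo_h)
  fix A :: "real set" assume [measurable]: "A \<in> sets borel"
  have "emeasure lborel ({0<..<h x} \<inter> A) = (\<integral>\<^sup>+t. (if 0 < t \<and> t < h x \<and> t \<in> A then 1 else 0) \<partial>lborel)" for x
  proof -
    have "emeasure lborel ({0<..<h x} \<inter> A) = (\<integral>\<^sup>+t. indicator ({0<..<h x} \<inter> A) t \<partial>lborel)"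
      by (rule nn_integral_indicator[symmetric]) measurable
    also have "\<dots> = (\<integral>\<^sup>+t. (if 0 < t \<and> t < h x \<and> t \<in> A then 1 else 0) \<partial>lborel)"
      by (intro nn_integral_cong) (auto simp: indicator_def)
    finally show ?thesis .
  qed
  then have "emeasure (UT x) A = (if h x = 0 then emeasure \<nu>T A else
      (\<integral>\<^sup>+t. (if 0 < t \<and> t < h x \<and> t \<in> A then 1 else 0) \<partial>lborel) / ennreal (h x))" for x
    by (simp add: pss_UT_def emeasure_Ioo_h)
  then show "(\<lambda>x. emeasure (UT x) A) \<in> borel_measurable borel" by simp
qed

lemma AE_UT_pos: "AE t in UT x. 0 < t"
proof (cases "h x = 0")
  case True
  then have UT: "UT x = \<nu>T" by (simp add: pss_UT_def)
  show ?thesis unfolding UT by (rule nuT(3))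
next
  case False
  then have UT: "UT x = uniform_measure lborel {0<..<h x}" by (simp add: pss_UT_def)
  show ?thesis unfolding UT by (rule AE_uniform_measureI) auto
qed

lemma UT_kernel': "UX \<in> measurable (UT x) (subprob_algebra borel)"
  by (subst measurable_cong_sets[OF sets_UT refl]) (rule UX_kernel)

lemma space_UT: "space (UT x) = UNIV"
  using sets_eq_imp_space_eq[OF sets_UT, of x] by simp

lemma kernel_eq_bind: "P x = UT x \<bind> UX"
proof (rule measure_eqI)
  have sP: "sets (P x) = sets borel"
    using sets.sigma_sets_eq[of "borel :: 'a measure"] by (simp add: pss_kernel_def)
  show "sets (P x) = sets (UT x \<bind> UX)"
    unfolding sP by (rule sets_bind[symmetric]) (auto simp: sets_UX space_UT)
  fix B assume "B \<in> sets (P x)"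
  then have B: "B \<in> sets borel" by (simp add: sP)
  have "emeasure (P x) B = (\<integral>\<^sup>+t\<in>{0<..}. emeasure (UX t) B \<partial>UT x)"
    by (rule emeasure_pss_kernel[OF rho nuT(2) nuX(2) B])
  also have "\<dots> = (\<integral>\<^sup>+t. emeasure (UX t) B \<partial>UT x)"
    using AE_UT_pos[of x] by (intro nn_integral_cong_AE) (auto elim!: eventually_mono simp: indicator_def)
  also have "\<dots> = emeasure (UT x \<bind> UX) B"
    by (rule emeasure_bind[symmetric, OF _ UT_kernel' B]) (simp add: space_UT)
  finally show "emeasure (P x) B = emeasure (UT x \<bind> UX) B" .
qed

lemma P_kernel: "P \<in> measurable borel (subprob_algebra borel)"
proof -
  have eq: "P = (\<lambda>x. UT x \<bind> UX)" by (rule ext) (rule kernel_eq_bind)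
  have "(\<lambda>x. UT x \<bind> UX) \<in> measurable borel (subprob_algebra borel)"
    by (rule measurable_bind2[OF UT_kernel UX_kernel])
  then show ?thesis by (simp only: eq)
qed

lemma measurable_kernel_op [measurable]:
  assumes [measurable]: "g \<in> borel_measurable borel"
  shows "kernel_op P g \<in> borel_measurable borel"
proof -
  have eq: "kernel_op P g = (\<lambda>x. \<integral>y. g y \<partial>P x)" by (rule ext) (simp only: kernel_op_def)
  have "(\<lambda>x. \<integral>y. g y \<partial>P x) \<in> borel_measurable borel"
    using integral_measurable_subprob_algebra[OF assms] by (rule measurable_compose[OF P_kernel])
  then show ?thesis by (simp only: eq)
qed

lemma prob_P:
  assumes "0 < h x" shows "prob_space (P x)"
proof
  have sP: "sets (P x) = sets borel"
    using sets.sigma_sets_eq[of "borel :: 'a measure"] by (simp add: pss_kernel_def)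
  interpret UT: prob_space "UT x"
    using assms unfolding pss_UT_def by (auto intro!: prob_space_uniform_measure simp: emeasure_Ioo_h)
  have "emeasure (P x) (space (P x)) = (\<integral>\<^sup>+t. emeasure (UX t) UNIV \<partial>UT x)"
    using sets_eq_imp_space_eq[OF sP] unfolding kernel_eq_bind
    by (subst emeasure_bind[OF _ UT_kernel']) (auto simp: space_UT)
  also have "\<dots> = (\<integral>\<^sup>+t. 1 \<partial>UT x)"
  proof (rule nn_integral_cong_AE)
    show "AE t in UT x. emeasure (UX t) UNIV = 1"
      using AE_UT_pos[of x]
    proof eventually_elim
      case (elim t)
      show ?case using prob_space.emeasure_space_1[OF prob_UX[OF elim]] sets_eq_imp_space_eq[OF sets_UX, of t] by simp
    qed
  qed
  also have "\<dots> = 1" by (simp add: UT.emeasure_space_1)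
  finally show "emeasure (P x) (space (P x)) = 1" .
qed

lemma integral_UX:
  assumes "0 < t" "0 < level t" and [measurable]: "g \<in> borel_measurable borel"
  shows "(\<integral>y. g y \<partial>UX t) = slice_mean g t"
proof -
  have [measurable]: "g \<in> borel_measurable \<nu>" "pss_level \<rho> t \<in> sets \<nu>"
    using pss_level_measurable[OF rho] by auto
  have "UX t = uniform_measure \<nu> (pss_level \<rho> t)"
    using assms by (simp add: pss_UX_def level_set)
  then show ?thesis
    unfolding slice_mean_def using assms
    by (simp add: integral_uniform_measure_eq[OF _ _ level_set]) (simp add: pss_level_def)
qed

lemma nn_integral_UX:
  assumes "0 < t" and [measurable]: "f \<in> borel_measurable borel"
  shows "(\<integral>\<^sup>+y. f y \<partial>UX t) * ennreal (level t) = (\<integral>\<^sup>+y. (if t < h y then f y else 0) \<partial>\<nu>)"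
proof (cases "level t = 0")
  case True
  have "(\<integral>\<^sup>+y. (if t < h y then f y else 0) \<partial>\<nu>) = (\<integral>\<^sup>+y. 0 \<partial>\<nu>)"
    using null_level[OF assms(1) True] by (intro nn_integral_cong_AE) auto
  then show ?thesis using True by simp
next
  case False
  then have pos: "0 < level t" using level_nonneg[of t] by simp
  have [measurable]: "f \<in> borel_measurable \<nu>" "pss_level \<rho> t \<in> sets \<nu>"
    using pss_level_measurable[OF rho] by auto
  have "UX t = uniform_measure \<nu> (pss_level \<rho> t)"
    using assms pos by (simp add: pss_UX_def level_set)
  then have "(\<integral>\<^sup>+y. f y \<partial>UX t) * ennreal (level t) = (\<integral>\<^sup>+y. f y * indicator (pss_level \<rho> t) y \<partial>\<nu>) / ennreal (level t) * ennreal (level t)"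
    using assms by (simp add: nn_integral_uniform_measure level_set)
  also have "\<dots> = (\<integral>\<^sup>+y. f y * indicator (pss_level \<rho> t) y \<partial>\<nu>)"
  proof -
    have "z / ennreal (level t) * ennreal (level t) = z" for z
    proof -
      have "z / ennreal (level t) * ennreal (level t) = z * ennreal (level t) / ennreal (level t)"
        by (metis ennreal_times_divide mult.commute)
      also have "\<dots> = z" by (rule ennreal_mult_divide_eq) (use pos in auto)
      finally show ?thesis .
    qed
    then show ?thesis .
  qed
  also have "\<dots> = (\<integral>\<^sup>+y. (if t < h y then f y else 0) \<partial>\<nu>)"
    by (intro nn_integral_cong) (auto simp: pss_level_def indicator_def)
  finally show ?thesis .
qed

text \<open>
  The kernel acts as \<open>U\<^sub>T U\<^sub>X\<close> wherever the mean of \<open>\<bar>g\<bar>\<close> under the kernel is finite and no height below \<open>h x\<close>, up to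
  null sets, has a null superlevel set. Both hold almost everywhere by Tonelli.
\<close>

lemma kernel_op_eq:
  assumes [measurable]: "g \<in> borel_measurable borel" and g1: "integrable \<pi> g"
  shows "AE x in \<pi>. integrable (P x) g \<and> kernel_op P g x = height_mean (slice_mean g) x"
proof -
  define q where "q t = (\<integral>\<^sup>+y. ennreal \<bar>g y\<bar> \<partial>UX t)" for t
  have [measurable]: "q \<in> borel_measurable borel"
    unfolding q_def by (rule measurable_compose[OF UX_kernel nn_integral_measurable_subprob_algebra]) measurable
  have [measurable]: "g \<in> borel_measurable \<nu>" by simp
  have gi: "integrable \<nu> (\<lambda>x. g x * h x)" using g1 by (simp add: integral_pi)
  have "(\<integral>\<^sup>+x. \<integral>\<^sup>+t. (if 0 < t \<and> t < h x then q t else 0) \<partial>lborel \<partial>\<nu>) = (\<integral>\<^sup>+t. (if 0 < t then q t * ennreal (level t) else 0) \<partial>lborel)"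
    by (rule tonelli_levels) measurable
  also have "\<dots> = (\<integral>\<^sup>+t. (if 0 < t then \<integral>\<^sup>+y. (if t < h y then ennreal \<bar>g y\<bar> else 0) \<partial>\<nu> else 0) \<partial>lborel)"
    by (intro nn_integral_cong) (auto simp: q_def nn_integral_UX)
  also have "\<dots> = (\<integral>\<^sup>+y. ennreal \<bar>g y\<bar> * ennreal (h y) \<partial>\<nu>)"
    by (rule tonelli_slices) measurable
  also have "\<dots> = (\<integral>\<^sup>+y. ennreal (norm (g y * h y)) \<partial>\<nu>)"
    by (simp add: abs_mult h_nonneg ennreal_mult)
  also have "\<dots> < \<infinity>" using gi by (simp add: integrable_iff_bounded)
  \<comment> \<open>The mean of \<open>\<bar>g\<bar>\<close> under the kernel is finite at almost every point.\<close>
  finally have AE1: "AE x in \<nu>. (\<integral>\<^sup>+t. (if 0 < t \<and> t < h x then q t else 0) \<partial>lborel) \<noteq> \<infinity>"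
    by (intro nn_integral_noteq_infinite) auto
  have "(\<integral>\<^sup>+x. \<integral>\<^sup>+t. (if 0 < t \<and> t < h x then (if level t = 0 then 1 else 0) else 0) \<partial>lborel \<partial>\<nu>) =
    (\<integral>\<^sup>+t. (if 0 < t then (if level t = 0 then 1 else 0) * ennreal (level t) else 0) \<partial>lborel)"
    by (rule tonelli_levels) measurable
  also have "\<dots> = (\<integral>\<^sup>+t. 0 \<partial>(lborel :: real measure))"
    by (intro nn_integral_cong) auto
  finally have "(\<integral>\<^sup>+x. \<integral>\<^sup>+t. (if 0 < t \<and> t < h x then (if level t = 0 then 1 else 0) else 0) \<partial>lborel \<partial>\<nu>) = 0" by simp
  \<comment> \<open>For almost every \<open>x\<close>, almost all heights below \<open>h x\<close> have a superlevel
    set of positive mass.\<close>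
  then have AE2: "AE x in \<nu>. (\<integral>\<^sup>+t. (if 0 < t \<and> t < h x then (if level t = 0 then 1 else 0) else 0) \<partial>lborel) = 0"
    by (subst (asm) nn_integral_0_iff_AE) auto
  have "AE x in \<nu>. 0 < h x \<longrightarrow> integrable (P x) g \<and> kernel_op P g x = height_mean (slice_mean g) x"
    using AE1 AE2
  proof eventually_elim
    case (elim x)
    show ?case
    proof
      assume h: "0 < h x"
      have UT: "UT x = uniform_measure lborel {0<..<h x}" using h by (simp add: pss_UT_def)
      have "(\<integral>\<^sup>+t. q t \<partial>UT x) = (\<integral>\<^sup>+t. q t * indicator {0<..<h x} t \<partial>lborel) / ennreal (h x)"
        unfolding UT by (simp add: nn_integral_uniform_measure emeasure_Ioo_h)
      also have "(\<integral>\<^sup>+t. q t * indicator {0<..<h x} t \<partial>lborel) = (\<integral>\<^sup>+t. (if 0 < t \<and> t < h x then q t else 0) \<partial>lborel)"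
        by (intro nn_integral_cong) (auto simp: indicator_def)
      also have "\<dots> / ennreal (h x) < \<infinity>"
        using elim(1) h by (simp add: ennreal_divide_eq_top_iff less_top[symmetric])
      finally have fin: "(\<integral>\<^sup>+t. \<integral>\<^sup>+y. ennreal \<bar>g y\<bar> \<partial>UX t \<partial>UT x) < \<infinity>"
        unfolding q_def .
      note bind = integral_bind_finite[OF UT_kernel' _ _ fin]
      have "kernel_op P g x = (\<integral>t. \<integral>y. g y \<partial>UX t \<partial>UT x)"
        unfolding kernel_op_def kernel_eq_bind by (rule bind(2)) (auto simp: space_UT)
      also have "\<dots> = (\<integral>t. (if t \<in> {0<..<h x} then \<integral>y. g y \<partial>UX t else 0) \<partial>lborel) / h x"
        unfolding UT
      proof (rule integral_uniform_measure_eq)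
        show "(\<lambda>t. \<integral>y. g y \<partial>UX t) \<in> borel_measurable lborel"
          by (simp, rule measurable_compose[OF UX_kernel integral_measurable_subprob_algebra]) measurable
      qed (use h in \<open>auto simp: emeasure_Ioo_h\<close>)
      also have "(\<integral>t. (if t \<in> {0<..<h x} then \<integral>y. g y \<partial>UX t else 0) \<partial>lborel) = (\<integral>t. (if 0 < t \<and> t < h x then slice_mean g t else 0) \<partial>lborel)"
      proof (rule integral_cong_AE)
        have [measurable]: "(\<lambda>t. \<integral>y. g y \<partial>UX t) \<in> borel_measurable borel"
          by (rule measurable_compose[OF UX_kernel integral_measurable_subprob_algebra]) measurable
        show "(\<lambda>t. if t \<in> {0<..<h x} then \<integral>y. g y \<partial>UX t else 0) \<in> borel_measurable lborel" by measurable
        have "AE t in lborel. (if 0 < t \<and> t < h x then (if level t = 0 then 1 else 0) else 0 :: ennreal) = 0"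
          using elim(2) by (subst (asm) nn_integral_0_iff_AE) auto
        then show "AE t in lborel. (if t \<in> {0<..<h x} then \<integral>y. g y \<partial>UX t else 0) = (if 0 < t \<and> t < h x then slice_mean g t else 0)"
        proof eventually_elim
          case (elim t)
          then show ?case using level_nonneg[of t] by (auto simp: integral_UX split: if_splits)
        qed
      qed measurable
      also have "\<dots> / h x = height_mean (slice_mean g) x" by (simp add: height_mean_def)
      finally have eq: "kernel_op P g x = height_mean (slice_mean g) x" .
      have "integrable (P x) g"
        unfolding kernel_eq_bind by (rule bind(1)) (auto simp: space_UT)
      then show "integrable (P x) g \<and> kernel_op P g x = height_mean (slice_mean g) x"
        using eq by (rule conjI)
    qed
  qed
  from AE_pi[OF this] show ?thesis by (auto elim!: eventually_mono)
qed

text \<open>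
  With \<open>f = g - \<pi>(g)\<close>, the function \<open>P g - \<pi>(g)\<close> equals \<open>P f\<close> almost everywhere, and \<open>f\<close> is centred with norm at most
  that of \<open>g\<close>.
\<close>

theorem operator_norm_le:
  assumes g: "L2_norm \<pi> g \<le> 1"
  shows "L2_norm \<pi> (\<lambda>x. kernel_op P g x - mean_op \<pi> g x) \<le> 1 / 2"
proof -
  interpret pi: prob_space \<pi> by (rule prob_pi)
  note pi.prob_space[simplified, simp]
  have gL: "g \<in> L2 \<pi>" using g by (auto simp: L2_norm_def split: if_splits)
  then have [measurable]: "g \<in> borel_measurable borel" and g2: "integrable \<pi> (\<lambda>x. (g x)\<^sup>2)"
    by (auto simp: L2_def)
  have [measurable]: "g \<in> borel_measurable \<nu>" by simp
  have norm_g: "(\<integral>x. (g x)\<^sup>2 \<partial>\<pi>) \<le> 1"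
    using g gL by (simp add: L2_norm_def one_ereal_def)
  have g1: "integrable \<pi> g" by (rule pi.square_integrable_imp_integrable[OF _ g2]) measurable
  define m where "m = (\<integral>x. g x \<partial>\<pi>)"
  define f where "f x = g x - m" for x
  have [measurable]: "f \<in> borel_measurable borel" "f \<in> borel_measurable \<nu>" unfolding f_def by auto
  have sq: "(f x)\<^sup>2 = (g x)\<^sup>2 - 2 * m * g x + m\<^sup>2" for x by (simp add: f_def power2_diff)
  have f1: "integrable \<pi> f" unfolding f_def using g1 by simp
  have f2: "integrable \<pi> (\<lambda>x. (f x)\<^sup>2)" unfolding sq using g1 g2 by simp
  have f_mean: "(\<integral>x. f x \<partial>\<pi>) = 0" unfolding f_def using g1 by (simp add: m_def)
  have "(\<integral>x. (f x)\<^sup>2 \<partial>\<pi>) = (\<integral>x. (g x)\<^sup>2 \<partial>\<pi>) - m\<^sup>2"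
    unfolding sq using g1 g2 by (simp add: m_def[symmetric] power2_eq_square)
  then have norm_f: "(\<integral>x. (f x)\<^sup>2 \<partial>\<pi>) \<le> 1" using norm_g by (smt (verit) zero_le_power2)
  have f2': "integrable \<nu> (\<lambda>x. (f x)\<^sup>2 * h x)" using f2 by (subst (asm) integral_pi) auto
  have mean': "(\<integral>x. f x * h x \<partial>\<nu>) = 0" using f_mean mass_pos by (subst (asm) integral_pi) auto
  define F where "F = height_mean (slice_mean f)"
  have [measurable]: "F \<in> borel_measurable \<nu>" "F \<in> borel_measurable borel"
    unfolding F_def using measurable_height_mean[of "slice_mean f"] by auto
  have F2': "integrable \<nu> (\<lambda>x. (F x)\<^sup>2 * h x)"
    unfolding F_def by (intro integrable_height_mean_square integrable_slice_mean_square f2') measurable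
  have F2: "integrable \<pi> (\<lambda>x. (F x)\<^sup>2)" using F2' by (subst integral_pi) auto
  have "4 * (\<integral>x. (F x)\<^sup>2 * h x \<partial>\<nu>) \<le> (\<integral>x. (f x)\<^sup>2 * h x \<partial>\<nu>)"
    unfolding F_def by (rule slice_sampling_contraction[OF _ f2' mean']) measurable
  then have "4 * (\<integral>x. (F x)\<^sup>2 \<partial>\<pi>) \<le> (\<integral>x. (f x)\<^sup>2 \<partial>\<pi>)"
    using mass_pos by (subst (1 2) integral_pi) (auto simp: divide_right_mono)
  then have norm_F: "(\<integral>x. (F x)\<^sup>2 \<partial>\<pi>) \<le> (1 / 2)\<^sup>2" using norm_f by (simp add: power2_eq_square)
  have Kg: "AE x in \<pi>. integrable (P x) g \<and> kernel_op P g x = height_mean (slice_mean g) x"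
    by (rule kernel_op_eq[OF _ g1]) measurable
  have Kf: "AE x in \<pi>. integrable (P x) f \<and> kernel_op P f x = height_mean (slice_mean f) x"
    by (rule kernel_op_eq[OF _ f1]) measurable
  have h_pos: "AE x in \<pi>. 0 < h x \<and> True"
    by (rule AE_pi) simp
  have AE_eq: "AE x in \<pi>. kernel_op P g x - mean_op \<pi> g x = F x"
    using Kg Kf h_pos
  proof eventually_elim
    case (elim x)
    then interpret Px: prob_space "P x" by (intro prob_P) auto
    have "kernel_op P f x = kernel_op P g x - m"
      using elim unfolding kernel_op_def f_def by (simp add: Px.prob_space)
    then show ?case using elim by (simp add: F_def mean_op_def m_def)
  qed
  let ?T = "\<lambda>x. kernel_op P g x - mean_op \<pi> g x"
  have [measurable]: "?T \<in> borel_measurable borel" unfolding mean_op_def by measurable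
  have AE_sq: "AE x in \<pi>. (?T x)\<^sup>2 = (F x)\<^sup>2" using AE_eq by eventually_elim simp
  have "integrable \<pi> (\<lambda>x. (?T x)\<^sup>2)"
    using F2 AE_sq by (subst integrable_cong_AE[OF _ _ AE_sq]) auto
  moreover have "(\<integral>x. (?T x)\<^sup>2 \<partial>\<pi>) = (\<integral>x. (F x)\<^sup>2 \<partial>\<pi>)"
    by (rule integral_cong_AE) (use AE_sq in auto)
  ultimately have "L2_norm \<pi> ?T = ereal (sqrt (\<integral>x. (F x)\<^sup>2 \<partial>\<pi>))"
    by (simp add: L2_norm_def L2_def)
  moreover have "sqrt (\<integral>x. (F x)\<^sup>2 \<partial>\<pi>) \<le> 1 / 2"
    using norm_F by (intro real_le_lsqrt) auto
  moreover have "(1 / 2 :: ereal) = ereal (1 / 2)"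
    by (simp add: one_ereal_def numeral_eq_ereal)
  ultimately show ?thesis by (simp only: ereal_less_eq)
qed

theorem spectral_gap_ge: "spectral_gap \<pi> P \<ge> 1 / 2"
proof -
  have "L2_opnorm \<pi> (\<lambda>g x. kernel_op P g x - mean_op \<pi> g x) \<le> 1 / 2"
    unfolding L2_opnorm_def by (intro SUP_least operator_norm_le) auto
  then have "1 - (1 / 2 :: ereal) \<le> spectral_gap \<pi> P"
    unfolding spectral_gap_def by (intro ereal_minus_mono) auto
  moreover have "1 - (1 / 2 :: ereal) = 1 / 2"
    by (simp add: one_ereal_def numeral_eq_ereal)
  ultimately show ?thesis by simp
qed

end

section \<open>Radial functions with convex potential\<close>

text \<open>
  A set of reals lies in the interval between its infimum and its supremum.
\<close>

lemma measure_lborel_le_diameter: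
  fixes S :: "real set"
  assumes S: "S \<in> sets borel" "S \<noteq> {}" and diam: "\<And>x y. x \<in> S \<Longrightarrow> y \<in> S \<Longrightarrow> y - x \<le> K"
  shows "measure lborel S \<le> K"
proof -
  obtain x0 where x0: "x0 \<in> S" using S by blast
  have "bdd_below S" "bdd_above S"
    using diam[OF x0] diam[OF _ x0] by (auto simp: algebra_simps intro!: bdd_belowI[of _ "x0 - K"] bdd_aboveI[of _ "x0 + K"])
  then have sub: "S \<subseteq> {Inf S..Sup S}" by (auto intro: cInf_lower cSup_upper)
  have "y \<le> Inf S + K" if "y \<in> S" for y
  proof -
    have "y - K \<le> Inf S" using that diam by (intro cInf_greatest S) (auto simp: algebra_simps)
    then show ?thesis by simp
  qed
  then have "Sup S \<le> Inf S + K" by (intro cSup_least S) auto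
  moreover have "Inf S \<le> Sup S" using sub x0 by auto
  moreover have "measure lborel S \<le> measure lborel {Inf S..Sup S}"
    using sub S by (intro measure_mono_fmeasurable) (auto simp: fmeasurable_def emeasure_lborel_Icc_eq)
  ultimately show ?thesis by simp
qed

text \<open>
  The one-dimensional Brunn-Minkowski inequality: the convex combination of two points of the sublevel sets at \<open>a\<close> and
  \<open>b\<close> lies in the sublevel set at the combined level, so the combination of two segments does as well. Varying the
  end points of the segments exhausts the lengths.
\<close>

lemma sublevel_length_concave:
  fixes \<psi> :: "real \<Rightarrow> real"
  assumes conv: "convex_on I \<psi>"
    and meas: "\<And>a. {r \<in> I. \<psi> r < a} \<in> sets borel" and fin: "\<And>a. emeasure lborel {r \<in> I. \<psi> r < a} < \<infinity>"
    and ne: "{r \<in> I. \<psi> r < a} \<noteq> {}" "{r \<in> I. \<psi> r < b} \<noteq> {}" and \<theta>: "0 < \<theta>" "\<theta> < 1"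
  shows "(1 - \<theta>) * measure lborel {r \<in> I. \<psi> r < a} + \<theta> * measure lborel {r \<in> I. \<psi> r < b}
    \<le> measure lborel {r \<in> I. \<psi> r < (1 - \<theta>) * a + \<theta> * b}"
proof -
  define J where "J a = {r \<in> I. \<psi> r < a}" for a
  define M where "M = measure lborel (J ((1 - \<theta>) * a + \<theta> * b))"
  have convI: "convex I" using conv by (simp add: convex_on_def)
  have mix: "(1 - \<theta>) * x + \<theta> * z \<in> J ((1 - \<theta>) * a + \<theta> * b)" if "x \<in> J a" "z \<in> J b" for x z
  proof -
    have "\<psi> ((1 - \<theta>) * x + \<theta> * z) \<le> (1 - \<theta>) * \<psi> x + \<theta> * \<psi> z"
      using convex_onD[OF conv, of \<theta> x z] that \<theta> by (auto simp: J_def)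
    also have "\<dots> < (1 - \<theta>) * a + \<theta> * b"
      using that \<theta> by (intro add_strict_mono mult_strict_left_mono) (auto simp: J_def)
    finally show ?thesis
      using convexD[OF convI, of x z "1 - \<theta>" \<theta>] that \<theta> by (auto simp: J_def)
  qed
  have convJ: "{p..q} \<subseteq> J e" if "p \<in> J e" "q \<in> J e" for p q e
  proof -
    have "convex (J e)"
    proof (rule convexI)
      fix x y u v :: real assume h: "x \<in> J e" "y \<in> J e" "0 \<le> u" "0 \<le> v" "u + v = 1"
      have "\<psi> (u *\<^sub>R x + v *\<^sub>R y) \<le> max (\<psi> x) (\<psi> y)"
        using h by (intro convex_lower[OF conv]) (auto simp: J_def)
      also have "\<dots> < e" using h by (auto simp: J_def)
      finally show "u *\<^sub>R x + v *\<^sub>R y \<in> J e"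
        using h convexD[OF convI, of x y u v] by (auto simp: J_def)
    qed
    then have "is_interval (J e)" by (simp only: is_interval_convex_1)
    then show ?thesis using that unfolding is_interval_1 by (meson atLeastAtMost_iff subsetI)
  qed
  have seg: "(1 - \<theta>) * (y - x) + \<theta> * (y' - x') \<le> M" if "x \<in> J a" "y \<in> J a" "x' \<in> J b" "y' \<in> J b" for x y x' y'
  proof -
    define p where "p = (1 - \<theta>) * x + \<theta> * x'"
    define q where "q = (1 - \<theta>) * y + \<theta> * y'"
    have sub: "{p..q} \<subseteq> J ((1 - \<theta>) * a + \<theta> * b)"
      using that unfolding p_def q_def by (intro convJ mix)
    have "measure lborel {p..q} \<le> M"
      unfolding M_def using sub fin[of "(1 - \<theta>) * a + \<theta> * b"] meas[of "(1 - \<theta>) * a + \<theta> * b"]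
      by (intro measure_mono_fmeasurable) (auto simp: fmeasurable_def J_def)
    moreover have "q - p \<le> measure lborel {p..q}" by (cases "p \<le> q") auto
    ultimately show ?thesis by (simp add: p_def q_def algebra_simps)
  qed
  have 1: "(1 - \<theta>) * measure lborel (J a) + \<theta> * (y' - x') \<le> M" if "x' \<in> J b" "y' \<in> J b" for x' y'
  proof -
    have "measure lborel (J a) \<le> (M - \<theta> * (y' - x')) / (1 - \<theta>)"
    proof (rule measure_lborel_le_diameter)
      show "y - x \<le> (M - \<theta> * (y' - x')) / (1 - \<theta>)" if "x \<in> J a" "y \<in> J a" for x y
      proof -
        have "(y - x) * (1 - \<theta>) \<le> M - \<theta> * (y' - x')"
          using seg[OF that \<open>x' \<in> J b\<close> \<open>y' \<in> J b\<close>] by (simp add: mult.commute)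
        then show ?thesis using \<theta> by (simp add: pos_le_divide_eq)
      qed
    qed (use meas ne in \<open>auto simp: J_def\<close>)
    then show ?thesis using \<theta> by (simp add: pos_le_divide_eq algebra_simps)
  qed
  have "measure lborel (J b) \<le> (M - (1 - \<theta>) * measure lborel (J a)) / \<theta>"
  proof (rule measure_lborel_le_diameter)
    show "y - x \<le> (M - (1 - \<theta>) * measure lborel (J a)) / \<theta>" if "x \<in> J b" "y \<in> J b" for x y
    proof -
      have "(y - x) * \<theta> \<le> M - (1 - \<theta>) * measure lborel (J a)"
        using 1[OF that] by (simp add: mult.commute)
      then show ?thesis using \<theta> by (simp add: pos_le_divide_eq)
    qed
  qed (use meas ne in \<open>auto simp: J_def\<close>)
  then show ?thesis using \<theta> by (simp add: pos_le_divide_eq algebra_simps J_def M_def)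
qed

text \<open>
  The law of the radius. Both sides give the mass of a centred ball to \<open>{..r}\<close>.
\<close>

lemma distr_norm_lborel:
  "distr lborel borel (norm :: 'a::euclidean_space \<Rightarrow> real) =
    density lborel (\<lambda>r. ennreal (if 0 < r then real DIM('a) * unit_ball_vol (real DIM('a)) * r ^ (DIM('a) - 1) else 0))"
    (is "?M = density lborel ?f")
proof -
  define V where "V = unit_ball_vol (real DIM('a))"
  have V: "0 < V" by (simp add: V_def)
  have M: "emeasure ?M {..r} = ennreal (if 0 \<le> r then V * r ^ DIM('a) else 0)" for r
  proof -
    have "emeasure ?M {..r} = emeasure lborel (cball (0::'a) r)"
      by (subst emeasure_distr) (auto intro!: arg_cong[where f="emeasure lborel"])
    then show ?thesis by (auto simp: emeasure_cball V_def)
  qed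
  have N: "emeasure (density lborel ?f) {..r} = ennreal (if 0 \<le> r then V * r ^ DIM('a) else 0)" for r
  proof (cases "0 \<le> r")
    case False
    have "emeasure (density lborel ?f) {..r} = (\<integral>\<^sup>+x. ?f x * indicator {..r} x \<partial>lborel)"
      by (rule emeasure_density) measurable
    also have "\<dots> = (\<integral>\<^sup>+x. 0 \<partial>(lborel :: real measure))"
      using False by (intro nn_integral_cong) (auto simp: indicator_def)
    finally show ?thesis using False by simp
  next
    case True
    have "emeasure (density lborel ?f) {..r} = (\<integral>\<^sup>+x. ?f x * indicator {..r} x \<partial>lborel)"
      by (rule emeasure_density) measurable
    also have "\<dots> = (\<integral>\<^sup>+x. ennreal (real DIM('a) * V * x ^ (DIM('a) - 1)) * indicator {0..r} x \<partial>lborel)"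
    proof -
      have ae: "AE x in lborel. ?f x * indicator {..r} x = ennreal (real DIM('a) * V * x ^ (DIM('a) - 1)) * indicator {0..r} x"
        using AE_lborel_singleton[of 0] by eventually_elim (auto simp: indicator_def V_def)
      show ?thesis by (rule nn_integral_cong_AE[OF ae])
    qed
    also have "\<dots> = ennreal (V * r ^ DIM('a) - V * 0 ^ DIM('a))"
    proof (rule nn_integral_FTC_Icc)
      fix x
      show "DERIV (\<lambda>x. V * x ^ DIM('a)) x :> real DIM('a) * V * x ^ (DIM('a) - 1)"
        by (auto intro!: derivative_eq_intros)
    qed (use True V in auto)
    finally show ?thesis using True by (simp add: power_0_left)
  qed
  show ?thesis
  proof (rule measure_eqI_generator_eq_countable[where E="range atMost" and \<Omega>=UNIV and A="range (\<lambda>n::nat. {..real n})"])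
    have "{..a} \<inter> {..b} = {..min a b}" for a b :: real by auto
    then show "Int_stable (range (atMost :: real \<Rightarrow> real set))" by (auto simp: Int_stable_def)
    show "sets ?M = sigma_sets UNIV (range atMost)" "sets (density lborel ?f) = sigma_sets UNIV (range atMost)"
      by (simp_all add: borel_eq_atMost[where 'a=real])
    show "(\<Union>(range (\<lambda>n::nat. {..real n}))) = UNIV"
      using real_arch_simple by auto
  qed (auto simp: M N)
qed

text \<open>
  The weight \<open>\<parallel>x\<parallel>\<^bsup>1 - d\<^esup>\<close> cancels the Jacobian \<open>r\<^bsup>d - 1\<^esup>\<close> of polar coordinates, so radial sets have a mass
  proportional to the length of their set of radii.
\<close>

lemma emeasure_pss_base_radial:
  assumes S [measurable]: "S \<in> sets borel"
  shows "emeasure (pss_base :: 'a::euclidean_space measure) {x. norm x \<in> S} =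
    ennreal (real DIM('a) * unit_ball_vol (real DIM('a))) * emeasure lborel (S \<inter> {0<..})"
proof -
  define c where "c = real DIM('a) * unit_ball_vol (real DIM('a))"
  have c: "0 \<le> c" by (simp add: c_def)
  define p where "p r = r powi (1 - int DIM('a))" for r :: real
  have p: "p r = inverse (r ^ (DIM('a) - 1))" for r
  proof -
    have "1 - int DIM('a) = - int (DIM('a) - 1)"
      using DIM_positive[where 'a='a] by linarith
    then show ?thesis by (simp only: p_def power_int_minus power_int_of_nat)
  qed
  have [measurable]: "p \<in> borel_measurable borel" unfolding p[abs_def] by measurable
  have "emeasure (pss_base :: 'a measure) {x. norm x \<in> S} = (\<integral>\<^sup>+x. ennreal (p (norm (x::'a))) * indicator S (norm x) \<partial>lborel)"
    unfolding pss_base_def pss_p0_def p_def[symmetric]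
    by (subst emeasure_density) (auto intro!: nn_integral_cong simp: indicator_def)
  also have "\<dots> = (\<integral>\<^sup>+r. ennreal (p r) * indicator S r \<partial>distr lborel borel (norm :: 'a \<Rightarrow> real))"
    by (subst nn_integral_distr) auto
  also have "\<dots> = (\<integral>\<^sup>+r. ennreal (if 0 < r then c * r ^ (DIM('a) - 1) else 0) * (ennreal (p r) * indicator S r) \<partial>lborel)"
    unfolding distr_norm_lborel c_def by (subst nn_integral_density) auto
  also have "\<dots> = (\<integral>\<^sup>+r. ennreal c * indicator (S \<inter> {0<..}) r \<partial>lborel)"
  proof (intro nn_integral_cong)
    fix r :: real
    have "ennreal (c * r ^ (DIM('a) - 1)) * ennreal (p r) = ennreal c" if "0 < r"
      using that c by (subst ennreal_mult[symmetric]) (auto simp: p)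
    then show "ennreal (if 0 < r then c * r ^ (DIM('a) - 1) else 0) * (ennreal (p r) * indicator S r) = ennreal c * indicator (S \<inter> {0<..}) r"
      by (auto simp: indicator_def)
  qed
  also have "\<dots> = ennreal c * emeasure lborel (S \<inter> {0<..})"
    by (rule nn_integral_cmult_indicator) measurable
  finally show ?thesis by (simp add: c_def)
qed

text \<open>
  Among three points of the level set, the middle one would have to lie strictly below the level.
\<close>

lemma strict_convex_level_finite:
  fixes \<psi> :: "real \<Rightarrow> real"
  assumes strict: "\<And>x y z. x \<in> I \<Longrightarrow> z \<in> I \<Longrightarrow> x < y \<Longrightarrow> y < z \<Longrightarrow> \<psi> y < max (\<psi> x) (\<psi> z)"
  shows "finite {r \<in> I. \<psi> r = a}"
proof (rule ccontr)
  assume "infinite {r \<in> I. \<psi> r = a}"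
  then obtain T where T: "T \<subseteq> {r \<in> I. \<psi> r = a}" "card T = 3" "finite T"
    using infinite_arbitrarily_large by blast
  then obtain x y z where xyz: "T = {x, y, z}" "x \<noteq> y" "x \<noteq> z" "y \<noteq> z" by (auto simp: card_3_iff)
  have no: "\<not> (u < v \<and> v < w)" if "u \<in> T" "v \<in> T" "w \<in> T" for u v w
  proof -
    have "u \<in> I" "w \<in> I" "\<psi> u = a" "\<psi> v = a" "\<psi> w = a" using that T(1) by auto
    then show ?thesis using strict[of u w v] by auto
  qed
  show False using no xyz by (metis insertCI linorder_neqE_linordered_idom)
qed

text \<open>
  The logarithm is strictly concave. Both claims come from the tangent bound \<open>ln v \<le> v - 1\<close>, strict for \<open>v \<noteq> 1\<close>,
  at \<open>v = x / y\<close> and \<open>v = z / y\<close>, where \<open>y\<close> is the convex combination of \<open>x\<close> and \<open>z\<close>.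
\<close>

lemma convex_minus_ln_strict:
  fixes \<phi> :: "real \<Rightarrow> real"
  assumes conv: "convex_on I \<phi>" and pos: "\<And>r. r \<in> I \<Longrightarrow> 0 < r" and k: "0 < k"
  shows "convex_on I (\<lambda>r. \<phi> r - k * ln r)"
    and "\<And>x y z. x \<in> I \<Longrightarrow> z \<in> I \<Longrightarrow> x < y \<Longrightarrow> y < z \<Longrightarrow> \<phi> y - k * ln y < max (\<phi> x - k * ln x) (\<phi> z - k * ln z)"
proof -
  have I: "convex I" using conv by (simp add: convex_on_def)
  have ln: "(1 - t) * ln x + t * ln z \<le> ln ((1 - t) * x + t * z)"
    "x \<noteq> z \<Longrightarrow> 0 < t \<Longrightarrow> t < 1 \<Longrightarrow> (1 - t) * ln x + t * ln z < ln ((1 - t) * x + t * z)"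
    if xz: "0 < x" "0 < z" and t: "0 \<le> t" "t \<le> 1" for x z t :: real
  proof -
    define y where "y = (1 - t) * x + t * z"
    have y: "0 < y"
    proof (cases "t = 0")
      case False
      then show ?thesis unfolding y_def using xz t by (intro add_nonneg_pos) auto
    qed (use xz in \<open>simp add: y_def\<close>)
    have lx: "ln x - ln y \<le> x / y - 1" and lz: "ln z - ln y \<le> z / y - 1"
      using ln_le_minus_one[of "x / y"] ln_le_minus_one[of "z / y"] xz y by (auto simp: ln_div)
    have sum: "(1 - t) * (x / y - 1) + t * (z / y - 1) = 0"
    proof -
      have "(1 - t) * (x / y - 1) + t * (z / y - 1) = ((1 - t) * x + t * z) / y - 1"
        using y by (simp add: field_simps)
      then show ?thesis using y by (simp add: y_def[symmetric])
    qed
    have "(1 - t) * (ln x - ln y) + t * (ln z - ln y) \<le> (1 - t) * (x / y - 1) + t * (z / y - 1)"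
      using lx lz t by (intro add_mono mult_left_mono) auto
    then have "(1 - t) * ln x + t * ln z \<le> ln y" unfolding sum by (simp add: algebra_simps)
    then show "(1 - t) * ln x + t * ln z \<le> ln ((1 - t) * x + t * z)" by (simp add: y_def)
    assume ne: "x \<noteq> z" "0 < t" "t < 1"
    have "x \<noteq> y"
    proof
      assume "x = y"
      moreover have "y - x = t * (z - x)" by (simp add: y_def algebra_simps)
      ultimately show False using ne by simp
    qed
    then have "ln x - ln y \<noteq> x / y - 1"
      using ln_eq_minus_one[of "x / y"] xz y by (auto simp: ln_div)
    with lx have "ln x - ln y < x / y - 1" by simp
    then have "(1 - t) * (ln x - ln y) + t * (ln z - ln y) < (1 - t) * (x / y - 1) + t * (z / y - 1)"
      using lz ne by (intro add_less_le_mono mult_strict_left_mono mult_left_mono) auto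
    then have "(1 - t) * ln x + t * ln z < ln y" unfolding sum by (simp add: algebra_simps)
    then show "(1 - t) * ln x + t * ln z < ln ((1 - t) * x + t * z)" by (simp add: y_def)
  qed
  show "convex_on I (\<lambda>r. \<phi> r - k * ln r)"
  proof (rule convex_onI)
    show "convex I" by (rule I)
  next
    fix t x z :: real assume t: "0 < t" "t < 1" and xz: "x \<in> I" "z \<in> I"
    have "k * ((1 - t) * ln x + t * ln z) \<le> k * ln ((1 - t) * x + t * z)"
      using t xz pos k by (intro mult_left_mono ln) auto
    then show "\<phi> ((1 - t) *\<^sub>R x + t *\<^sub>R z) - k * ln ((1 - t) *\<^sub>R x + t *\<^sub>R z) \<le> (1 - t) * (\<phi> x - k * ln x) + t * (\<phi> z - k * ln z)"
      using convex_onD[OF conv, of t x z] t xz by (simp add: algebra_simps)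
  qed
  fix x y z assume xz: "x \<in> I" "z \<in> I" and y: "x < y" "y < z"
  define t where "t = (y - x) / (z - x)"
  have t: "0 < t" "t < 1" using y by (auto simp: t_def divide_simps)
  have y_eq: "y = (1 - t) * x + t * z"
  proof -
    have "t * (z - x) = y - x" using y by (simp add: t_def)
    then show ?thesis by (simp add: algebra_simps)
  qed
  have "k * ((1 - t) * ln x + t * ln z) < k * ln y"
    unfolding y_eq using t xz pos k y by (intro mult_strict_left_mono ln(2)) auto
  moreover have "\<phi> y \<le> (1 - t) * \<phi> x + t * \<phi> z"
    using convex_onD[OF conv, of t x z] t xz by (simp add: y_eq)
  ultimately have "\<phi> y - k * ln y < (1 - t) * (\<phi> x - k * ln x) + t * (\<phi> z - k * ln z)"
    by (simp add: algebra_simps)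
  also have "\<dots> \<le> (1 - t) * max (\<phi> x - k * ln x) (\<phi> z - k * ln z) + t * max (\<phi> x - k * ln x) (\<phi> z - k * ln z)"
    using t by (intro add_mono mult_left_mono) auto
  also have "\<dots> = max (\<phi> x - k * ln x) (\<phi> z - k * ln z)" by (simp add: algebra_simps)
  finally show "\<phi> y - k * ln y < max (\<phi> x - k * ln x) (\<phi> z - k * ln z)" .
qed

text \<open>
  Superlevel sets of \<open>h\<close> correspond to sublevel intervals of \<open>\<psi>\<close>, and \<open>t \<mapsto> r t\<close> becomes a shift of the level \<open>- ln t\<close>
  by \<open>- ln r\<close>. The required monotonicity of increments is concavity of the interval length.
\<close>

lemma slice_space_radial:
  fixes \<psi> :: "real \<Rightarrow> real" and h :: "'a::euclidean_space \<Rightarrow> real"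
  assumes conv: "convex_on I \<psi>"
    and strict: "\<And>x y z. x \<in> I \<Longrightarrow> z \<in> I \<Longrightarrow> x < y \<Longrightarrow> y < z \<Longrightarrow> \<psi> y < max (\<psi> x) (\<psi> z)"
    and cont: "continuous_on I \<psi>" and I: "open I" "I \<noteq> {}" "I \<subseteq> {0<..}"
    and h: "\<And>x. h x = (if norm x \<in> I then exp (- \<psi> (norm x)) else 0)"
    and int: "integrable pss_base h"
  shows "slice_space pss_base h"
proof -
  define \<nu> where "\<nu> = (pss_base :: 'a measure)"
  define c where "c = real DIM('a) * unit_ball_vol (real DIM('a))"
  have c: "0 < c" by (simp add: c_def)
  have space [simp]: "space \<nu> = UNIV" by (simp add: \<nu>_def pss_base_def)
  have [measurable]: "h \<in> borel_measurable \<nu>" using int by (auto simp: \<nu>_def)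
  define J where "J a = {r \<in> I. \<psi> r < a}" for a
  have J_open: "open (J a)" for a
    using continuous_open_preimage[OF cont I(1), of "{..<a}"] by (auto simp: J_def vimage_def Int_def)
  then have J_borel [measurable]: "J a \<in> sets borel" for a by simp
  have radial: "emeasure \<nu> {x. norm x \<in> S} = ennreal c * emeasure lborel S" if "S \<in> sets borel" "S \<subseteq> I" for S
  proof -
    have "S \<inter> {0<..} = S" using that I by auto
    then show ?thesis using emeasure_pss_base_radial[OF that(1), where 'a='a] by (simp add: c_def \<nu>_def)
  qed
  have level_iff: "t < h x \<longleftrightarrow> norm x \<in> J (- ln t)" if "0 < t" for t x
  proof -
    have "t < exp (- \<psi> (norm x)) \<longleftrightarrow> ln t < - \<psi> (norm x)"
      using that by (metis exp_less_cancel_iff exp_ln)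
    then show ?thesis using that by (auto simp: h J_def)
  qed
  have h_nonneg: "0 \<le> h x" for x by (simp add: h)
  have level: "emeasure \<nu> {x \<in> space \<nu>. t < h x} = ennreal c * emeasure lborel (J (- ln t))" if "0 < t" for t
  proof -
    have "{x \<in> space \<nu>. t < h x} = {x. norm x \<in> J (- ln t)}" using level_iff[OF that] by simp
    moreover have "J (- ln t) \<subseteq> I" by (auto simp: J_def)
    ultimately show ?thesis using radial[of "J (- ln t)"] J_borel by simp
  qed
  have fin: "emeasure lborel (J a) < \<infinity>" for a
  proof -
    have "ennreal c * emeasure lborel (J a) < \<infinity>"
      using emeasure_superlevel_finite[OF int h_nonneg, of "exp (- a)"] level[of "exp (- a)"] by (simp add: \<nu>_def)
    then show ?thesis using c by (auto simp: ennreal_mult_less_top)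
  qed
  have level_measure: "measure \<nu> {x \<in> space \<nu>. t < h x} = c * measure lborel (J (- ln t))" if "0 < t" for t
    using level[OF that] c by (simp add: measure_def enn2real_mult)
  show ?thesis
    unfolding \<nu>_def[symmetric]
  proof (intro slice_space.intro slice_space_axioms.intro)
    show "sigma_finite_measure \<nu>" unfolding \<nu>_def by (rule sigma_finite_pss_base)
    show "h \<in> borel_measurable \<nu>" by measurable
    show "0 \<le> h x" for x by (rule h_nonneg)
    show "integrable \<nu> h" using int by (simp add: \<nu>_def)
    show "0 < (\<integral>x. h x \<partial>\<nu>)"
    proof (rule ccontr)
      assume "\<not> 0 < (\<integral>x. h x \<partial>\<nu>)"
      moreover have "0 \<le> (\<integral>x. h x \<partial>\<nu>)" using h_nonneg by (intro integral_nonneg_AE) auto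
      ultimately have "(\<integral>x. h x \<partial>\<nu>) = 0" by simp
      then have "AE x in \<nu>. h x = 0"
        using int h_nonneg by (subst (asm) integral_nonneg_eq_0_iff_AE) (auto simp: \<nu>_def)
      moreover have "{x \<in> space \<nu>. h x \<noteq> 0} \<in> sets \<nu>" by measurable
      ultimately have "emeasure \<nu> {x \<in> space \<nu>. h x \<noteq> 0} = 0"
        using AE_iff_measurable[of "{x \<in> space \<nu>. h x \<noteq> 0}" \<nu> "\<lambda>x. h x = 0"] by simp
      moreover have "{x \<in> space \<nu>. h x \<noteq> 0} = {x. norm x \<in> I}" by (auto simp: h)
      ultimately have "ennreal c * emeasure lborel I = 0" using radial[of I] I by simp
      then have "emeasure lborel I = 0" using c by auto
      moreover obtain r e where "0 < e" "ball r e \<subseteq> I"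
        using I by (meson open_contains_ball ex_in_conv)
      moreover have "emeasure lborel (ball r e) = ennreal (2 * e)"
        using \<open>0 < e\<close> by (simp add: ball_eq_greaterThanLessThan)
      ultimately show False
        using emeasure_mono[of "ball r e" I lborel] I by simp
    qed
    show "emeasure \<nu> {x \<in> space \<nu>. h x = t} = 0" if t: "0 < t" for t
    proof -
      define S where "S = {r \<in> I. \<psi> r = - ln t}"
      have "finite S" unfolding S_def by (rule strict_convex_level_finite[OF strict])
      have "h x = t \<longleftrightarrow> norm x \<in> S" for x
      proof -
        have "exp (- \<psi> (norm x)) = t \<longleftrightarrow> - \<psi> (norm x) = ln t"
          using t by (metis exp_ln ln_exp)
        then show ?thesis using t by (auto simp: h S_def)
      qed
      then have "emeasure \<nu> {x \<in> space \<nu>. h x = t} = emeasure \<nu> {x. norm x \<in> S}" by simp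
      also have "\<dots> = ennreal c * emeasure lborel S"
        using \<open>finite S\<close> by (intro radial) (auto simp: S_def intro: borel_closed finite_imp_closed)
      also have "emeasure lborel S = 0" using \<open>finite S\<close> by (rule emeasure_lborel_countable[OF countable_finite])
      finally show ?thesis by simp
    qed
    fix r s t :: real
    assume r: "0 < r" "r < 1" and st: "0 < s" "s \<le> t" and pos: "0 < measure \<nu> {x \<in> space \<nu>. t < h x}"
    define m where "m a = measure lborel (J a)" for a
    define a where "a = - ln t"
    define b where "b = - ln (r * s)"
    define \<delta> where "\<delta> = - ln r"
    have t: "0 < t" using st by simp
    have \<delta>: "0 < \<delta>" using r by (simp add: \<delta>_def)
    have ab: "a + \<delta> \<le> b" using r st by (simp add: a_def b_def \<delta>_def ln_mult)
    \<comment> \<open>Both \<open>a + \<delta>\<close> and \<open>b - \<delta>\<close> are convex combinations of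
      \<open>a\<close> and \<open>b\<close>, with exchanged weights.\<close>
    define \<theta> where "\<theta> = \<delta> / (b - a)"
    have \<theta>: "0 < \<theta>" "\<theta> \<le> 1" using \<delta> ab by (auto simp: \<theta>_def divide_simps)
    have "0 < m a" using pos level_measure[OF t] c by (simp add: m_def a_def zero_less_mult_iff)
    then have ne: "J a \<noteq> {}" by (auto simp: m_def)
    moreover have "J a \<subseteq> J b" using ab \<delta> by (auto simp: J_def)
    ultimately have ne': "J b \<noteq> {}" by auto
    have conc: "(1 - u) * m a + u * m b \<le> m ((1 - u) * a + u * b)" if "0 < u" "u < 1" for u
      unfolding m_def J_def
      using that ne ne' fin J_borel by (intro sublevel_length_concave[OF conv]) (auto simp: J_def)
    have d: "\<theta> * b - \<theta> * a = \<delta>"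
    proof -
      have "\<theta> * (b - a) = \<delta>" using \<delta> ab by (simp add: \<theta>_def)
      then show ?thesis by (simp add: right_diff_distrib)
    qed
    have e1: "(1 - \<theta>) * a + \<theta> * b = a + \<delta>"
      using d by (simp add: algebra_simps)
    have e2: "(1 - (1 - \<theta>)) * a + (1 - \<theta>) * b = b - \<delta>"
      using d by (simp add: algebra_simps)
    have "m a + m b \<le> m (a + \<delta>) + m (b - \<delta>)"
    proof (cases "\<theta> = 1")
      case True
      then show ?thesis using e1 e2 by simp
    next
      case False
      then have "(1 - \<theta>) * m a + \<theta> * m b \<le> m (a + \<delta>)" "(1 - (1 - \<theta>)) * m a + (1 - \<theta>) * m b \<le> m (b - \<delta>)"
        using \<theta> conc[of \<theta>] conc[of "1 - \<theta>"] unfolding e1 e2 by auto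
      then show ?thesis by (simp add: algebra_simps)
    qed
    then have "c * (m b - m (b - \<delta>)) \<le> c * (m (a + \<delta>) - m a)"
      using c by (intro mult_left_mono) auto
    moreover have "measure \<nu> {x \<in> space \<nu>. r * s < h x} = c * m b"
      using level_measure[of "r * s"] r st by (simp add: m_def b_def)
    moreover have "measure \<nu> {x \<in> space \<nu>. t < h x} = c * m a"
      using level_measure[OF t] by (simp add: m_def a_def)
    moreover have "measure \<nu> {x \<in> space \<nu>. s < h x} = c * m (b - \<delta>)"
    proof -
      have "b - \<delta> = - ln s" using r st by (simp add: b_def \<delta>_def ln_mult)
      then show ?thesis using level_measure[of s] st by (simp only: m_def)
    qed
    moreover have "measure \<nu> {x \<in> space \<nu>. r * t < h x} = c * m (a + \<delta>)"
    proof -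
      have "a + \<delta> = - ln (r * t)" using r t by (simp add: a_def \<delta>_def ln_mult)
      then show ?thesis using level_measure[of "r * t"] r t by (simp only: m_def mult_pos_pos)
    qed
    ultimately show "measure \<nu> {x \<in> space \<nu>. r * s < h x} - measure \<nu> {x \<in> space \<nu>. s < h x} \<le>
      measure \<nu> {x \<in> space \<nu>. r * t < h x} - measure \<nu> {x \<in> space \<nu>. t < h x}"
      by (simp only: right_diff_distrib)
  qed
qed

section \<open>The spectral gap\<close>

theorem theorem3p13:
  fixes \<phi> :: "real \<Rightarrow> real" and \<kappa> :: ereal
    and \<nu>T :: "real measure" and \<nu>X :: "'a::euclidean_space measure"
  defines "\<rho> \<equiv> \<lambda>x::'a. exp (- \<phi> (norm x)) * indicator (einterval 0 \<kappa>) (norm x)"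
  assumes "DIM('a) \<ge> 2"
    and "0 < \<kappa>"
    and "convex_on (einterval 0 \<kappa>) \<phi>"
    and "\<forall>r \<in> einterval 0 \<kappa>. \<phi> differentiable (at r)"
    and "\<forall>r \<in> einterval 0 \<kappa>. deriv \<phi> differentiable (at r)"
    and "filterlim (\<phi> \<circ> real_of_ereal) at_top (at_left \<kappa>)"
    and "integrable lborel \<rho>"
    and "prob_space \<nu>T" and "sets \<nu>T = sets borel" and "AE t in \<nu>T. 0 < t"
    and "prob_space \<nu>X" and "sets \<nu>X = sets borel"
  shows "spectral_gap (normalized_measure \<rho>) (pss_kernel \<rho> \<nu>T \<nu>X) \<ge> 1 / 2"
proof -
  define I where "I = einterval 0 \<kappa>"
  define k where "k = real (DIM('a) - 1)"
  define \<psi> where "\<psi> r = \<phi> r - k * ln r" for r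
  have k: "0 < k" using assms(2) by (simp add: k_def)
  have I: "open I" "I \<noteq> {}" "I \<subseteq> {0<..}"
    using einterval_nonempty[OF assms(3)] by (auto simp: I_def einterval_iff)
  have pos: "0 < r" if "r \<in> I" for r using I that by auto
  have conv: "convex_on I \<phi>" using assms(4) by (simp add: I_def)
  have cont: "continuous_on I \<phi>"
    using assms(5) differentiable_imp_continuous_within
    by (intro continuous_at_imp_continuous_on) (auto simp: I_def)
  have rho: "\<rho> \<in> borel_measurable borel" using assms(8) by auto
  have h: "pss_p1 \<rho> x = (if norm x \<in> I then exp (- \<psi> (norm x)) else 0)" for x
  proof (cases "norm x \<in> I")
    case True
    then have "exp (k * ln (norm x)) = norm x ^ (DIM('a) - 1)"
      using pos[OF True] by (simp only: k_def exp_of_nat_mult exp_ln)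
    then show ?thesis using True
      by (simp add: pss_p1_def \<rho>_def \<psi>_def I_def exp_diff exp_minus exp_add field_simps)
  qed (simp add: pss_p1_def \<rho>_def I_def)
  have fact: "pss_p0 x * pss_p1 \<rho> x = \<rho> x" for x
  proof (cases "x = 0")
    case True
    then show ?thesis by (simp add: pss_p1_def \<rho>_def einterval_iff zero_ereal_def)
  next
    case False
    have "1 - int DIM('a) = - int (DIM('a) - 1)"
      using DIM_positive[where 'a='a] by linarith
    then have "pss_p0 x = inverse (norm x ^ (DIM('a) - 1))"
      by (simp only: pss_p0_def power_int_minus power_int_of_nat)
    then show ?thesis using False by (simp add: pss_p1_def)
  qed
  have p0: "0 \<le> pss_p0 x" for x :: 'a by (simp add: pss_p0_def)
  have [measurable]: "pss_p1 \<rho> \<in> borel_measurable borel"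
    unfolding pss_p1_def[abs_def] using rho by measurable
  have int: "integrable pss_base (pss_p1 \<rho>)"
    unfolding pss_base_def using assms(8) p0 by (subst integrable_density) (auto simp: fact)
  have "slice_space pss_base (pss_p1 \<rho>)"
  proof (rule slice_space_radial[OF _ _ _ I h int])
    show "convex_on I \<psi>"
      unfolding \<psi>_def by (rule convex_minus_ln_strict(1)[OF conv pos k])
    show "\<psi> y < max (\<psi> x) (\<psi> z)" if "x \<in> I" "z \<in> I" "x < y" "y < z" for x y z
      unfolding \<psi>_def by (rule convex_minus_ln_strict(2)[OF conv pos k that])
    show "continuous_on I \<psi>"
      unfolding \<psi>_def using cont pos by (intro continuous_intros) (auto dest: pos)
  qed
  then interpret polar_slice \<rho> \<nu>T \<nu>X
    using rho fact assms(9-13) by (intro polar_slice.intro)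
  show ?thesis by (rule spectral_gap_ge)
qed

end
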